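(* Let the parameters be regular. Let $(\boldsymbol n,\boldsymbol m)\in\mathbb N_0^p\times\mathbb N_0^q$ with $|\boldsymbol m|=|\boldsymbol n|+1$, $\boldsymbol m$ near the diagonal and $\boldsymbol n-\mathbf 1_p\in\mathbb N_0^p$. Choose an admissible $B$-side local data set $(\boldsymbol u_k),(\boldsymbol{\mathfrak u}_k),(\boldsymbol v_k),(\boldsymbol{\mathfrak v}_k)$ (see context), with associated vectors $\mathbf W_j^+,\mathbf W^0,\mathbf W_i^-$, and assume the denominators below do not vanish. Then $$z\mathbf W^0(z)=\sum_{j=1}^qc^{B,+j}_{\boldsymbol n,\boldsymbol m}\mathbf W_j^+(z)+c^{B,0}_{\boldsymbol n,\boldsymbol m}\mathbf W^0(z)+\sum_{i=1}^pc^{B,-i}_{\boldsymbol n,\boldsymbol m}\mathbf W_i^-(z),$$ where for $1\le i\le p$, $1\le j\le q$ $$c^{B,+j}_{\boldsymbol n,\boldsymbol m}=\frac{\mathscr P^{(\boldsymbol n+\boldsymbol{\mathfrak u}_{j+1},\boldsymbol m+\boldsymbol v_{j-1})}_{1,(\boldsymbol n,\boldsymbol m)}}{\mathscr P^{(\boldsymbol n+\boldsymbol{\mathfrak u}_{j+1},\boldsymbol m+\boldsymbol v_{j-1})}_{0,(\boldsymbol n+\boldsymbol{\mathfrak u}_j,\boldsymbol m+\boldsymbol v_j)}},\quad c^{B,0}_{\boldsymbol n,\boldsymbol m}=\frac{\mathscr P^{(\boldsymbol n+\boldsymbol{\mathfrak u}_1,\boldsymbol m-\boldsymbol{\mathfrak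 v}_1)}_{1,(\boldsymbol n,\boldsymbol m)}}{\mathscr P^{(\boldsymbol n+\boldsymbol{\mathfrak u}_1,\boldsymbol m-\boldsymbol{\mathfrak v}_1)}_{0,(\boldsymbol n,\boldsymbol m)}},\quad c^{B,-i}_{\boldsymbol n,\boldsymbol m}=\frac{\mathscr P^{(\boldsymbol n-\boldsymbol u_{i-1},\boldsymbol m-\boldsymbol{\mathfrak v}_{i+1})}_{1,(\boldsymbol n,\boldsymbol m)}}{\mathscr P^{(\boldsymbol n-\boldsymbol u_{i-1},\boldsymbol m-\boldsymbol{\mathfrak v}_{i+1})}_{0,(\boldsymbol n-\boldsymbol u_i,\boldsymbol m-\boldsymbol{\mathfrak v}_i)}} .$$ The $p+q+1$ vectors $\mathbf W_1^+,\dots,\mathbf W_q^+,\mathbf W^0,\mathbf W_1^-,\dots,\mathbf W_p^-$ form a basis of the local recurrence space $\mathscr L(\boldsymbol n-\mathbf 1_p,\boldsymbol m+\mathbf 1_q)$ containing $z\mathbf W^0$.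
   Context: Notation. $\mathbf 1_d$: all-ones vector; $\boldsymbol e_j$: standard basis vector; $|\boldsymbol n|=\sum n_i$; $\boldsymbol c^{*i}$: $\boldsymbol c$ with its $i$-th component removed; vector inequalities are componentwise. $(x)_n=\Gamma(x+n)/\Gamma(x)$ for $n\in\mathbb Z$; for vectors $\Gamma(\boldsymbol v)=\prod_h\Gamma(v_h)$, $(\boldsymbol c)_{\boldsymbol m}=\prod_h(c_h)_{m_h}$, a scalar subscript is applied to each component; empty products are $1$. $\mathbb P_N$: polynomials of degree $\le N$, $\mathbb P_{-1}=\{0\}$. $\mathbb T$: positively oriented unit circle. $\mathbb Z_{\le0}=\{0,-1,\dots\}$. $\mathcal N_q(M)=\{\boldsymbol\nu\in\mathbb N_0^q:|\boldsymbol\nu|=M,\ |\nu_\alpha-\nu_\beta|\le1\ \forall\alpha,\beta\}$ ("near the diagonal"). Parameters: $p,q\ge1$, $0\le r<q$, $\boldsymbol a\in\mathbb C^r$, $\boldsymbol b\in\mathbb C^q$, $\boldsymbol\kappa\in\mathbb C^p$; regular: $b_j-b_h\notin\mathbb Z$ $(j\ne h)$, $\kappa_i-\kappa_h\notin\mathbb Z$ $(i\ne h)$. Weights: $C_{j,i}(z)=\sum_{k\ge0}\frac{\Gamma((k+\kappa_i)\mathbf 1_r+\boldsymbol a+\mathbf 1_r)}{\Gamma((k+\kappa_i)\mathbf 1_q+\boldsymbol b+\boldsymbol e_j+\mathbf 1_q)}z^{-k-1}$. For near-diagonal $\boldsymbol m$: $m_{\min}=\min_hm_h$, $j_{\min}=\min\{j:m_j=m_{\min}\}$,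 $m_{\max}=\max_hm_h$, $j_{\max}=\max\{j:m_j=m_{\max}\}$. Parameters are admissible for $\boldsymbol m$ if for all $i,j,\rho$, $\kappa_i+a_\rho+1\notin\mathbb Z_{\le0}$, $\kappa_i+b_j+1\notin\mathbb Z_{\le0}$; $a_\rho-b_j-m_j+1\notin\mathbb Z_{\le0}$ whenever $m_j\ge1$; $a_\rho-b_{j_{\min}}-m_{\min}\notin\mathbb Z_{\le0}$. Local recurrence space: $\mathscr L(\boldsymbol N,\boldsymbol M)$ is the space of row vectors $(Q^{(1)},\dots,Q^{(q)})$ with $Q^{(j)}\in\mathbb P_{M_j-1}$ and $\sum_j\oint_{\mathbb T}z^\ell Q^{(j)}C_{j,i}\frac{\mathrm dz}{2\pi\mathrm i}=0$ for $0\le\ell\le N_i-1$, $1\le i\le p$. $B$-side local data: sequences $\boldsymbol u_k,\boldsymbol{\mathfrak u}_k\in\mathbb N_0^p$, $\boldsymbol v_k,\boldsymbol{\mathfrak v}_k\in\mathbb N_0^q$, $k\in\mathbb N_0$, all starting at $\boldsymbol 0$ and obtained by adding one standard basis vector at each step, with $\boldsymbol u_i\le\mathbf 1_p$ for $i\le p$, $\boldsymbol v_j\le\mathbf 1_q$ for $j\le q$, $\boldsymbol m+\boldsymbol v_k\in\mathcal N_q(|\boldsymbol m|+k)$ for $0\le k\le q$, and $\boldsymbol m-\boldsymbol{\mathfrak v}_k\in\mathcal N_q(|\boldsymbol m|-k)$ for $0\le k\le p+1$. Recurrence vectors: $\mathbf W_j^+=\mathbf B_{\boldsymbol n+\boldsymbol{\mathfrak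 u}_j,\boldsymbol m+\boldsymbol v_j}$ $(1\le j\le q)$, $\mathbf W^0=\mathbf B_{\boldsymbol n,\boldsymbol m}$, $\mathbf W_i^-=\mathbf B_{\boldsymbol n-\boldsymbol u_i,\boldsymbol m-\boldsymbol{\mathfrak v}_i}$ $(1\le i\le p)$. Test vectors: $\mathbf U_j^+=\mathbf A_{\boldsymbol n+\boldsymbol{\mathfrak u}_{j+1},\boldsymbol m+\boldsymbol v_{j-1}}$, $\mathbf U^0=\mathbf A_{\boldsymbol n+\boldsymbol{\mathfrak u}_1,\boldsymbol m-\boldsymbol{\mathfrak v}_1}$, $\mathbf U_i^-=\mathbf A_{\boldsymbol n-\boldsymbol u_{i-1},\boldsymbol m-\boldsymbol{\mathfrak v}_{i+1}}$. The data set is admissible if every index pair appearing in these recurrence and test vectors is componentwise nonnegative with near-diagonal row index, and the parameters are admissible for each of these row indices. Normalized vectors. For $|\boldsymbol n|=|\boldsymbol m|+1$: $A^{(i)}_{\boldsymbol n,\boldsymbol m}=0$ if $n_i=0$, else $$A^{(i)}_{\boldsymbol n,\boldsymbol m}(z)=\nu^AC_{\boldsymbol n,\boldsymbol m;i}\sum_{k=0}^{n_i-1}\frac{(1-n_i)_k(\kappa_i\mathbf 1_q+\boldsymbol b+\boldsymbol m+\mathbf 1_q)_k(\kappa_i\mathbf 1_{p-1}-\boldsymbol\kappa^{*i}-\boldsymbol n^{*i}+\mathbf 1_{p-1})_k}{(\kappa_i\mathbf 1_r+\boldsymbol a+\mathbf 1_r)_k(\kappa_i\mathbf 1_{p-1}-\boldsymbol\kappa^{*i}+\mathbf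 1_{p-1})_k}\frac{z^k}{k!},$$ $$C_{\boldsymbol n,\boldsymbol m;i}=(-1)^{|\boldsymbol n|}\frac{\Gamma(\kappa_i\mathbf 1_q+\boldsymbol b+\mathbf 1_q)}{\Gamma(\kappa_i\mathbf 1_r+\boldsymbol a+\mathbf 1_r)}\frac{\prod_j(\kappa_i+b_j+1)_{m_j}}{(-1)^{n_i-1}(n_i-1)!\prod_{\ell\ne i}(\kappa_i-\kappa_\ell-n_\ell+1)_{n_\ell}},$$ $$\nu^A=-\frac{\prod_i(\kappa_i+b_{j_{\min}}+m_{\min}+1)_{n_i}}{(\boldsymbol a-b_{j_{\min}}\mathbf 1_r-m_{\min}\mathbf 1_r)_{m_{\min}}\prod_{h:m_h=m_{\min}+1}(b_h-b_{j_{\min}})}.$$ For $|\boldsymbol m|=|\boldsymbol n|+1$: $B^{(j)}_{\boldsymbol n,\boldsymbol m}=0$ if $m_j=0$, else $$B^{(j)}_{\boldsymbol n,\boldsymbol m}(z)=\nu^B\Bigg[\pi_{j,0}+\frac{(\boldsymbol a-b_j\mathbf 1_r)_1}{(\boldsymbol b^{*j}-b_j\mathbf 1_{q-1})_1}\sum_{H=1}^q\sum_{K=1}^{m_H-1}\pi_{H,K}\frac{(\boldsymbol b^{*j}-(b_H+K)\mathbf 1_{q-1})_1}{(\boldsymbol a-(b_H+K)\mathbf 1_r)_1}\sum_{d=0}^{K-1+\delta_{j,H}}\frac{(\boldsymbol b-(b_H+K)\mathbf 1_q+\mathbf 1_q-\boldsymbol e_j)_d}{(\boldsymbol a-(b_H+K)\mathbf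 1_r+\mathbf 1_r)_d}z^d\Bigg],$$ $$\pi_{H,K}=-\frac{\prod_i(\kappa_i+b_H+K+1)_{n_i}}{(-1)^KK!(m_H-K-1)!\prod_{I\ne H}(b_I-b_H-K)_{m_I}},$$ $$\nu^B=-\frac{(\boldsymbol a-b_{j_{\max}}\mathbf 1_r-(m_{\max}-1)\mathbf 1_r)_{m_{\max}}\prod_{h\ne j_{\max},m_h=m_{\max}}(b_h-b_{j_{\max}})}{(\boldsymbol a-b_{j_{\max}}\mathbf 1_r)_1\prod_i(\kappa_i+b_{j_{\max}}+m_{\max})_{n_i}}.$$ Pairing block, for $|\boldsymbol\mu|=|\boldsymbol\nu|+1$, $|\boldsymbol\lambda|=|\boldsymbol\eta|+1$, $\boldsymbol\mu,\boldsymbol\eta$ near the diagonal, $d\in\{0,1\}$ (it equals $\sum_{j,i}\oint_{\mathbb T}z^dB^{(j)}_{\boldsymbol\nu,\boldsymbol\mu}C_{j,i}A^{(i)}_{\boldsymbol\lambda,\boldsymbol\eta}\frac{\mathrm dz}{2\pi\mathrm i}$). Put $\eta_-=\min_h\eta_h$, $j_-=\min\{h:\eta_h=\eta_-\}$, $\mu_+=\max_h\mu_h$, $j_+=\max\{h:\mu_h=\mu_+\}$, $K_+=\mu_+-1$, $$\mathcal N=\frac{(\boldsymbol\kappa+(b_{j_-}+\eta_-+1)\mathbf 1_p)_{\boldsymbol\lambda}\,(\boldsymbol a-(b_{j_+}+K_+)\mathbf 1_r)_{K_+}}{(\boldsymbol a-(b_{j_-}+\eta_-)\mathbf 1_r)_{\eta_-}\prod_{h:\eta_h=\eta_-+1}(b_h-b_{j_-})}\prod_{h\ne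 j_+,\,\mu_h=\mu_+}(b_h-b_{j_+}).$$ For $0\le\alpha\le\lambda_i-1$: if $H=j$, $0\le K\le\mu_H-1$, $0\le\beta\le K$, $$\begin{aligned}\mathcal S_{d;i,H,H,K}(\alpha,\beta)=&\frac{(-1)^{|\boldsymbol\lambda|-\lambda_i+\alpha+\beta-K}}{\alpha!(\lambda_i-1-\alpha)!(K-\beta)!(\mu_H-K-1)!}\\&\times\frac{(\kappa_i\mathbf 1_r+\boldsymbol a+(\alpha+1)\mathbf 1_r)_{d+\beta}\,(\boldsymbol a-(b_H+K)\mathbf 1_r+(\beta+1)\mathbf 1_r)_{K-\beta}}{(\kappa_i\mathbf 1_{p-1}-\boldsymbol\kappa^{*i}-\boldsymbol\lambda^{*i}+(\alpha+1)\mathbf 1_{p-1})_{\boldsymbol\lambda^{*i}}\,(\boldsymbol a-(b_H+K)\mathbf 1_r)_K}\cdot\frac{(\boldsymbol\kappa+(b_H+K+1)\mathbf 1_p)_{\boldsymbol\nu}}{(\boldsymbol\kappa+(b_{j_+}+K_++1)\mathbf 1_p)_{\boldsymbol\nu}}\\&\times\frac{(\kappa_i\mathbf 1_q+\boldsymbol b+(d+\alpha+\beta+1)\mathbf 1_q+\boldsymbol e_H)_{\boldsymbol\eta-(d+\beta)\mathbf 1_q-\boldsymbol e_H}}{(\boldsymbol b^{*H}-b_H\mathbf 1_{q-1})_1\,(\boldsymbol b^{*H}-(b_H+K)\mathbf 1_{q-1}+(\beta+1)\mathbf 1_{q-1})_{\boldsymbol\mu^{*H}-(\beta+1)\mathbf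 1_{q-1}}};\end{aligned}$$ if $H\ne j$, $1\le K\le\mu_H-1$, $0\le\beta\le K-1$, $$\begin{aligned}\mathcal S_{d;i,j,H,K}(\alpha,\beta)=&\frac{(-1)^{|\boldsymbol\lambda|-\lambda_i+1+\alpha+K+\beta}}{\alpha!(\lambda_i-1-\alpha)!(K-1-\beta)!(\mu_H-K-1)!}\\&\times\frac{(\boldsymbol a-b_j\mathbf 1_r)_1\,(\kappa_i\mathbf 1_r+\boldsymbol a+(\alpha+1)\mathbf 1_r)_{d+\beta}}{(\kappa_i\mathbf 1_{p-1}-\boldsymbol\kappa^{*i}-\boldsymbol\lambda^{*i}+(\alpha+1)\mathbf 1_{p-1})_{\boldsymbol\lambda^{*i}}\,(\boldsymbol a-(b_H+K)\mathbf 1_r)_{\beta+1}}\cdot\frac{(\boldsymbol\kappa+(b_H+K+1)\mathbf 1_p)_{\boldsymbol\nu}}{(\boldsymbol\kappa+(b_{j_+}+K_++1)\mathbf 1_p)_{\boldsymbol\nu}}\\&\times\frac{(\kappa_i\mathbf 1_q+\boldsymbol b+(d+\alpha+\beta+1)\mathbf 1_q+\boldsymbol e_j)_{\boldsymbol\eta-(d+\beta)\mathbf 1_q-\boldsymbol e_j}}{(\boldsymbol b^{*j}-b_j\mathbf 1_{q-1})_1\,(\boldsymbol b^{*H}-(b_H+K)\mathbf 1_{q-1}+(\beta+1)\mathbf 1_{q-1}-\boldsymbol e_j^{*H})_{\boldsymbol\mu^{*H}-(\beta+1)\mathbf 1_{q-1}+\boldsymbol e_j^{*H}}};\end{aligned}$$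 and $\mathcal S=0$ otherwise. Then $\mathscr P^{(\boldsymbol\lambda,\boldsymbol\eta)}_{d,(\boldsymbol\nu,\boldsymbol\mu)}=\mathcal N\sum_{j=1}^q\sum_{i=1}^p\sum_{\beta=0}^{\mu_j-1}\sum_{\alpha=0}^{\lambda_i-1}\sum_{H=1}^q\sum_{K=0}^{\mu_H-1}\mathcal S_{d;i,j,H,K}(\alpha,\beta)$. *)

theory Defs
  imports
    "HOL-Complex_Analysis.Complex_Analysis"
    "HOL-Computational_Algebra.Polynomial"
    "HOL-Library.Function_Algebras"
begin

text \<open>
  A vector with \<open>s\<close> components is a function on \<open>nat\<close> of which only the values on \<open>{1..s}\<close>
  are used (so \<open>s = 0\<close> is allowed). Multi-indices are integer valued, since differences of
  multi-indices and negative Pochhammer subscripts occur; membership in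
  \<open>\<nat>\<^sub>0\<close> is stated explicitly. The vector \<open>e\<^sub>j\<close> is
  \<open>\<lambda>h. of_bool (h = j)\<close>, and the removal of component \<open>i\<close> is expressed by
  the index set \<open>{1..s} - {i}\<close>.
\<close>

text \<open>
  The Pochhammer symbol \<open>\<Gamma>(x + n) / \<Gamma>(x)\<close> as a rational function of \<open>x\<close>.
  The literal quotient would be wrong at poles of \<open>Gamma\<close>, where HOL sets \<open>Gamma\<close> to \<open>0\<close>.
\<close>
definition poch :: "complex \<Rightarrow> int \<Rightarrow> complex" where
  "poch x n = (if n \<ge> 0 then pochhammer x (nat n)
               else 1 / pochhammer (x + of_int n) (nat (- n)))"

lemma poch_eq_Gamma_quotient:
  assumes "x \<notin> \<int>\<^sub>\<le>\<^sub>0" "x + of_int n \<notin> \<int>\<^sub>\<le>\<^sub>0"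
  shows "poch x n = Gamma (x + of_int n) / Gamma x"
proof (cases "n \<ge> 0")
  case True
  then show ?thesis
    using pochhammer_Gamma[OF assms(1), of "nat n"] by (simp add: poch_def)
next
  case False
  then show ?thesis
    using pochhammer_Gamma[OF assms(2), of "nat (- n)"] by (simp add: poch_def)
qed

definition vpoch :: "nat set \<Rightarrow> (nat \<Rightarrow> complex) \<Rightarrow> (nat \<Rightarrow> int) \<Rightarrow> complex" where
  "vpoch I c s = (\<Prod>h\<in>I. poch (c h) (s h))"

definition vGamma :: "nat set \<Rightarrow> (nat \<Rightarrow> complex) \<Rightarrow> complex" where
  "vGamma I c = (\<Prod>h\<in>I. Gamma (c h))"

definition ifact :: "int \<Rightarrow> complex" where
  "ifact n = fact (nat n)"

definition nonneg_idx :: "nat \<Rightarrow> (nat \<Rightarrow> int) \<Rightarrow> bool" where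
  "nonneg_idx s n \<longleftrightarrow> (\<forall>h\<in>{1..s}. 0 \<le> n h)"

definition idx_size :: "nat \<Rightarrow> (nat \<Rightarrow> int) \<Rightarrow> int" where
  "idx_size s n = (\<Sum>h=1..s. n h)"

definition near_diag :: "nat \<Rightarrow> int \<Rightarrow> (nat \<Rightarrow> int) set" where
  "near_diag q M = {\<nu>. nonneg_idx q \<nu> \<and> idx_size q \<nu> = M \<and>
                       (\<forall>\<alpha>\<in>{1..q}. \<forall>\<beta>\<in>{1..q}. \<bar>\<nu> \<alpha> - \<nu> \<beta>\<bar> \<le> 1)}"

definition is_near_diag :: "nat \<Rightarrow> (nat \<Rightarrow> int) \<Rightarrow> bool" where
  "is_near_diag q \<nu> \<longleftrightarrow> \<nu> \<in> near_diag q (idx_size q \<nu>)"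

definition m_min :: "nat \<Rightarrow> (nat \<Rightarrow> int) \<Rightarrow> int" where
  "m_min q m = Min (m ` {1..q})"

definition j_min :: "nat \<Rightarrow> (nat \<Rightarrow> int) \<Rightarrow> nat" where
  "j_min q m = Min {j \<in> {1..q}. m j = m_min q m}"

definition m_max :: "nat \<Rightarrow> (nat \<Rightarrow> int) \<Rightarrow> int" where
  "m_max q m = Max (m ` {1..q})"

definition j_max :: "nat \<Rightarrow> (nat \<Rightarrow> int) \<Rightarrow> nat" where
  "j_max q m = Max {j \<in> {1..q}. m j = m_max q m}"

definition regular_params ::
  "nat \<Rightarrow> nat \<Rightarrow> (nat \<Rightarrow> complex) \<Rightarrow> (nat \<Rightarrow> complex) \<Rightarrow> bool" where
  "regular_params p q b \<kappa> \<longleftrightarrow>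
     (\<forall>j\<in>{1..q}. \<forall>h\<in>{1..q}. j \<noteq> h \<longrightarrow> b j - b h \<notin> \<int>) \<and>
     (\<forall>i\<in>{1..p}. \<forall>h\<in>{1..p}. i \<noteq> h \<longrightarrow> \<kappa> i - \<kappa> h \<notin> \<int>)"

definition admissible_params ::
  "nat \<Rightarrow> nat \<Rightarrow> nat \<Rightarrow> (nat \<Rightarrow> complex) \<Rightarrow> (nat \<Rightarrow> complex) \<Rightarrow> (nat \<Rightarrow> complex) \<Rightarrow> (nat \<Rightarrow> int) \<Rightarrow> bool" where
  "admissible_params p q r a b \<kappa> m \<longleftrightarrow>
     (\<forall>i\<in>{1..p}. \<forall>\<rho>\<in>{1..r}. \<kappa> i + a \<rho> + 1 \<notin> \<int>\<^sub>\<le>\<^sub>0) \<and>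
     (\<forall>i\<in>{1..p}. \<forall>j\<in>{1..q}. \<kappa> i + b j + 1 \<notin> \<int>\<^sub>\<le>\<^sub>0) \<and>
     (\<forall>j\<in>{1..q}. \<forall>\<rho>\<in>{1..r}. m j \<ge> 1 \<longrightarrow> a \<rho> - b j - of_int (m j) + 1 \<notin> \<int>\<^sub>\<le>\<^sub>0) \<and>
     (\<forall>\<rho>\<in>{1..r}. a \<rho> - b (j_min q m) - of_int (m_min q m) \<notin> \<int>\<^sub>\<le>\<^sub>0)"

definition weight ::
  "nat \<Rightarrow> nat \<Rightarrow> (nat \<Rightarrow> complex) \<Rightarrow> (nat \<Rightarrow> complex) \<Rightarrow> (nat \<Rightarrow> complex) \<Rightarrow>
   nat \<Rightarrow> nat \<Rightarrow> complex \<Rightarrow> complex" where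
  "weight q r a b \<kappa> j i z =
     (\<Sum>k. vGamma {1..r} (\<lambda>\<rho>. of_nat k + \<kappa> i + a \<rho> + 1) /
           vGamma {1..q} (\<lambda>h. of_nat k + \<kappa> i + b h + of_bool (h = j) + 1) *
           z powi (- int k - 1))"

definition row_scale :: "complex \<Rightarrow> (nat \<Rightarrow> complex poly) \<Rightarrow> nat \<Rightarrow> complex poly" where
  "row_scale c Q = (\<lambda>j. smult c (Q j))"

interpretation row: vector_space row_scale
  by standard (auto simp: row_scale_def fun_eq_iff smult_add_right smult_add_left)

text \<open>The disjunct \<open>f = 0\<close> matters for \<open>N = -1\<close>, since \<open>degree 0 = 0\<close> in HOL.\<close>
definition polys_le :: "int \<Rightarrow> complex poly set" where
  "polys_le N = {f. f = 0 \<or> int (degree f) \<le> N}"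

text \<open>
  Components outside \<open>{1..q}\<close> are required to vanish, so that equality of functions is
  equality of row vectors with \<open>q\<close> components.
\<close>
definition local_space ::
  "nat \<Rightarrow> nat \<Rightarrow> nat \<Rightarrow> (nat \<Rightarrow> complex) \<Rightarrow> (nat \<Rightarrow> complex) \<Rightarrow> (nat \<Rightarrow> complex) \<Rightarrow>
   (nat \<Rightarrow> int) \<Rightarrow> (nat \<Rightarrow> int) \<Rightarrow> (nat \<Rightarrow> complex poly) set" where
  "local_space p q r a b \<kappa> N M =
     {Q. (\<forall>j. j \<notin> {1..q} \<longrightarrow> Q j = 0) \<and>
         (\<forall>j\<in>{1..q}. Q j \<in> polys_le (M j - 1)) \<and>
         (\<forall>i\<in>{1..p}. \<forall>l::nat. int l \<le> N i - 1 \<longrightarrow>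
            (\<Sum>j=1..q. contour_integral (circlepath 0 1)
                (\<lambda>z. z ^ l * poly (Q j) z * weight q r a b \<kappa> j i z) / (2 * pi * \<i>)) = 0)}"

definition B_pi ::
  "nat \<Rightarrow> nat \<Rightarrow> (nat \<Rightarrow> complex) \<Rightarrow> (nat \<Rightarrow> complex) \<Rightarrow>
   (nat \<Rightarrow> int) \<Rightarrow> (nat \<Rightarrow> int) \<Rightarrow> nat \<Rightarrow> int \<Rightarrow> complex" where
  "B_pi p q b \<kappa> n m H K =
     - ((\<Prod>i=1..p. poch (\<kappa> i + b H + of_int K + 1) (n i)) /
        ((-1) powi K * ifact K * ifact (m H - K - 1) *
         (\<Prod>I\<in>{1..q} - {H}. poch (b I - b H - of_int K) (m I))))"

definition B_nu ::
  "nat \<Rightarrow> nat \<Rightarrow> nat \<Rightarrow> (nat \<Rightarrow> complex) \<Rightarrow> (nat \<Rightarrow> complex) \<Rightarrow> (nat \<Rightarrow> complex) \<Rightarrow>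
   (nat \<Rightarrow> int) \<Rightarrow> (nat \<Rightarrow> int) \<Rightarrow> complex" where
  "B_nu p q r a b \<kappa> n m =
     (let mx = m_max q m; jx = j_max q m in
      - (vpoch {1..r} (\<lambda>\<rho>. a \<rho> - b jx - of_int (mx - 1)) (\<lambda>_. mx) *
         (\<Prod>h\<in>{h \<in> {1..q}. h \<noteq> jx \<and> m h = mx}. b h - b jx) /
         (vpoch {1..r} (\<lambda>\<rho>. a \<rho> - b jx) (\<lambda>_. 1) *
          (\<Prod>i=1..p. poch (\<kappa> i + b jx + of_int mx) (n i)))))"

definition B_poly ::
  "nat \<Rightarrow> nat \<Rightarrow> nat \<Rightarrow> (nat \<Rightarrow> complex) \<Rightarrow> (nat \<Rightarrow> complex) \<Rightarrow> (nat \<Rightarrow> complex) \<Rightarrow>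
   (nat \<Rightarrow> int) \<Rightarrow> (nat \<Rightarrow> int) \<Rightarrow> nat \<Rightarrow> complex poly" where
  "B_poly p q r a b \<kappa> n m j =
     (if m j = 0 then 0 else
      smult (B_nu p q r a b \<kappa> n m)
        ([:B_pi p q b \<kappa> n m j 0:] +
         smult (vpoch {1..r} (\<lambda>\<rho>. a \<rho> - b j) (\<lambda>_. 1) /
                vpoch ({1..q} - {j}) (\<lambda>h. b h - b j) (\<lambda>_. 1))
           (\<Sum>H=1..q. \<Sum>K=1..m H - 1.
              smult (B_pi p q b \<kappa> n m H K *
                     (vpoch ({1..q} - {j}) (\<lambda>h. b h - (b H + of_int K)) (\<lambda>_. 1) /
                      vpoch {1..r} (\<lambda>\<rho>. a \<rho> - (b H + of_int K)) (\<lambda>_. 1)))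
                (\<Sum>d=0..K - 1 + of_bool (j = H).
                   monom (vpoch {1..q} (\<lambda>h. b h - (b H + of_int K) + 1 - of_bool (h = j)) (\<lambda>_. d) /
                          vpoch {1..r} (\<lambda>\<rho>. a \<rho> - (b H + of_int K) + 1) (\<lambda>_. d))
                         (nat d)))))"

definition B_vec ::
  "nat \<Rightarrow> nat \<Rightarrow> nat \<Rightarrow> (nat \<Rightarrow> complex) \<Rightarrow> (nat \<Rightarrow> complex) \<Rightarrow> (nat \<Rightarrow> complex) \<Rightarrow>
   (nat \<Rightarrow> int) \<Rightarrow> (nat \<Rightarrow> int) \<Rightarrow> nat \<Rightarrow> complex poly" where
  "B_vec p q r a b \<kappa> n m = (\<lambda>j. if j \<in> {1..q} then B_poly p q r a b \<kappa> n m j else 0)"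

definition pair_N ::
  "nat \<Rightarrow> nat \<Rightarrow> nat \<Rightarrow> (nat \<Rightarrow> complex) \<Rightarrow> (nat \<Rightarrow> complex) \<Rightarrow> (nat \<Rightarrow> complex) \<Rightarrow>
   (nat \<Rightarrow> int) \<Rightarrow> (nat \<Rightarrow> int) \<Rightarrow> (nat \<Rightarrow> int) \<Rightarrow> complex" where
  "pair_N p q r a b \<kappa> \<mu> lam \<eta> =
     (let em = m_min q \<eta>; jm = j_min q \<eta>; jp = j_max q \<mu>; Kp = m_max q \<mu> - 1 in
      vpoch {1..p} (\<lambda>i. \<kappa> i + (b jm + of_int em + 1)) lam *
      vpoch {1..r} (\<lambda>\<rho>. a \<rho> - (b jp + of_int Kp)) (\<lambda>_. Kp) /
      (vpoch {1..r} (\<lambda>\<rho>. a \<rho> - (b jm + of_int em)) (\<lambda>_. em) *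
       (\<Prod>h\<in>{h \<in> {1..q}. \<eta> h = em + 1}. b h - b jm)) *
      (\<Prod>h\<in>{h \<in> {1..q}. h \<noteq> jp \<and> \<mu> h = m_max q \<mu>}. b h - b jp))"

definition pair_S ::
  "nat \<Rightarrow> nat \<Rightarrow> nat \<Rightarrow> (nat \<Rightarrow> complex) \<Rightarrow> (nat \<Rightarrow> complex) \<Rightarrow> (nat \<Rightarrow> complex) \<Rightarrow>
   int \<Rightarrow> (nat \<Rightarrow> int) \<Rightarrow> (nat \<Rightarrow> int) \<Rightarrow> (nat \<Rightarrow> int) \<Rightarrow> (nat \<Rightarrow> int) \<Rightarrow>
   nat \<Rightarrow> nat \<Rightarrow> nat \<Rightarrow> int \<Rightarrow> int \<Rightarrow> int \<Rightarrow> complex" where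
  "pair_S p q r a b \<kappa> d \<nu> \<mu> lam \<eta> i j H K \<alpha> \<beta> =
     (let jp = j_max q \<mu>; Kp = m_max q \<mu> - 1 in
      if 0 \<le> \<alpha> \<and> \<alpha> \<le> lam i - 1 \<and> H = j \<and> 0 \<le> K \<and> K \<le> \<mu> H - 1 \<and> 0 \<le> \<beta> \<and> \<beta> \<le> K then
        (-1) powi (idx_size p lam - lam i + \<alpha> + \<beta> - K) /
        (ifact \<alpha> * ifact (lam i - 1 - \<alpha>) * ifact (K - \<beta>) * ifact (\<mu> H - K - 1)) *
        (vpoch {1..r} (\<lambda>\<rho>. \<kappa> i + a \<rho> + of_int (\<alpha> + 1)) (\<lambda>_. d + \<beta>) *
         vpoch {1..r} (\<lambda>\<rho>. a \<rho> - (b H + of_int K) + of_int (\<beta> + 1)) (\<lambda>_. K - \<beta>) /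
         (vpoch ({1..p} - {i}) (\<lambda>l. \<kappa> i - \<kappa> l - of_int (lam l) + of_int (\<alpha> + 1)) lam *
          vpoch {1..r} (\<lambda>\<rho>. a \<rho> - (b H + of_int K)) (\<lambda>_. K))) *
        (vpoch {1..p} (\<lambda>l. \<kappa> l + (b H + of_int K + 1)) \<nu> /
         vpoch {1..p} (\<lambda>l. \<kappa> l + (b jp + of_int Kp + 1)) \<nu>) *
        (vpoch {1..q} (\<lambda>h. \<kappa> i + b h + of_int (d + \<alpha> + \<beta> + 1) + of_bool (h = H))
                      (\<lambda>h. \<eta> h - (d + \<beta>) - of_bool (h = H)) /
         (vpoch ({1..q} - {H}) (\<lambda>h. b h - b H) (\<lambda>_. 1) *
          vpoch ({1..q} - {H}) (\<lambda>h. b h - (b H + of_int K) + of_int (\<beta> + 1))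
                               (\<lambda>h. \<mu> h - (\<beta> + 1))))
      else if 0 \<le> \<alpha> \<and> \<alpha> \<le> lam i - 1 \<and> H \<noteq> j \<and> 1 \<le> K \<and> K \<le> \<mu> H - 1 \<and> 0 \<le> \<beta> \<and> \<beta> \<le> K - 1 then
        (-1) powi (idx_size p lam - lam i + 1 + \<alpha> + K + \<beta>) /
        (ifact \<alpha> * ifact (lam i - 1 - \<alpha>) * ifact (K - 1 - \<beta>) * ifact (\<mu> H - K - 1)) *
        (vpoch {1..r} (\<lambda>\<rho>. a \<rho> - b j) (\<lambda>_. 1) *
         vpoch {1..r} (\<lambda>\<rho>. \<kappa> i + a \<rho> + of_int (\<alpha> + 1)) (\<lambda>_. d + \<beta>) /
         (vpoch ({1..p} - {i}) (\<lambda>l. \<kappa> i - \<kappa> l - of_int (lam l) + of_int (\<alpha> + 1)) lam *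
          vpoch {1..r} (\<lambda>\<rho>. a \<rho> - (b H + of_int K)) (\<lambda>_. \<beta> + 1))) *
        (vpoch {1..p} (\<lambda>l. \<kappa> l + (b H + of_int K + 1)) \<nu> /
         vpoch {1..p} (\<lambda>l. \<kappa> l + (b jp + of_int Kp + 1)) \<nu>) *
        (vpoch {1..q} (\<lambda>h. \<kappa> i + b h + of_int (d + \<alpha> + \<beta> + 1) + of_bool (h = j))
                      (\<lambda>h. \<eta> h - (d + \<beta>) - of_bool (h = j)) /
         (vpoch ({1..q} - {j}) (\<lambda>h. b h - b j) (\<lambda>_. 1) *
          vpoch ({1..q} - {H}) (\<lambda>h. b h - (b H + of_int K) + of_int (\<beta> + 1) - of_bool (h = j))
                               (\<lambda>h. \<mu> h - (\<beta> + 1) + of_bool (h = j))))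
      else 0)"

text \<open>
  Argument order: \<open>pairing p q r a b \<kappa> d \<nu> \<mu> lam \<eta>\<close> has lower indices
  \<open>d, (\<nu>, \<mu>)\<close> and upper index \<open>(lam, \<eta>)\<close>.
\<close>
definition pairing ::
  "nat \<Rightarrow> nat \<Rightarrow> nat \<Rightarrow> (nat \<Rightarrow> complex) \<Rightarrow> (nat \<Rightarrow> complex) \<Rightarrow> (nat \<Rightarrow> complex) \<Rightarrow>
   int \<Rightarrow> (nat \<Rightarrow> int) \<Rightarrow> (nat \<Rightarrow> int) \<Rightarrow> (nat \<Rightarrow> int) \<Rightarrow> (nat \<Rightarrow> int) \<Rightarrow> complex" where
  "pairing p q r a b \<kappa> d \<nu> \<mu> lam \<eta> =
     pair_N p q r a b \<kappa> \<mu> lam \<eta> *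
     (\<Sum>j=1..q. \<Sum>i=1..p. \<Sum>\<beta>=0..\<mu> j - 1. \<Sum>\<alpha>=0..lam i - 1. \<Sum>H=1..q. \<Sum>K=0..\<mu> H - 1.
        pair_S p q r a b \<kappa> d \<nu> \<mu> lam \<eta> i j H K \<alpha> \<beta>)"

definition idx_add :: "(nat \<Rightarrow> int) \<Rightarrow> (nat \<Rightarrow> int) \<Rightarrow> nat \<Rightarrow> int" (infixl "\<oplus>\<^sub>v" 65) where
  "n \<oplus>\<^sub>v s = (\<lambda>h. n h + s h)"

definition idx_diff :: "(nat \<Rightarrow> int) \<Rightarrow> (nat \<Rightarrow> int) \<Rightarrow> nat \<Rightarrow> int" (infixl "\<ominus>\<^sub>v" 65) where
  "n \<ominus>\<^sub>v s = (\<lambda>h. n h - s h)"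

definition unit_step_seq :: "nat \<Rightarrow> (nat \<Rightarrow> nat \<Rightarrow> int) \<Rightarrow> bool" where
  "unit_step_seq s w \<longleftrightarrow>
     (\<forall>h\<in>{1..s}. w 0 h = 0) \<and>
     (\<forall>k. \<exists>l\<in>{1..s}. \<forall>h\<in>{1..s}. w (Suc k) h = w k h + of_bool (h = l))"

text \<open>
  \<open>u, v\<close> are the roman sequences, \<open>fu, fv\<close> the fraktur ones. The increments
  \<open>fu\<close> (columns) and \<open>v\<close> (rows) are added, \<open>u\<close> (columns) and \<open>fv\<close> (rows) are
  subtracted.
\<close>
definition B_local_data ::
  "nat \<Rightarrow> nat \<Rightarrow> (nat \<Rightarrow> int) \<Rightarrow> (nat \<Rightarrow> nat \<Rightarrow> int) \<Rightarrow> (nat \<Rightarrow> nat \<Rightarrow> int) \<Rightarrow>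
   (nat \<Rightarrow> nat \<Rightarrow> int) \<Rightarrow> (nat \<Rightarrow> nat \<Rightarrow> int) \<Rightarrow> bool" where
  "B_local_data p q m u fu v fv \<longleftrightarrow>
     unit_step_seq p u \<and> unit_step_seq p fu \<and> unit_step_seq q v \<and> unit_step_seq q fv \<and>
     (\<forall>i\<le>p. \<forall>h\<in>{1..p}. u i h \<le> 1) \<and>
     (\<forall>j\<le>q. \<forall>h\<in>{1..q}. v j h \<le> 1) \<and>
     (\<forall>k\<le>q. m \<oplus>\<^sub>v v k \<in> near_diag q (idx_size q m + int k)) \<and>
     (\<forall>k\<le>p + 1. m \<ominus>\<^sub>v fv k \<in> near_diag q (idx_size q m - int k))"

definition admissible_pair ::
  "nat \<Rightarrow> nat \<Rightarrow> nat \<Rightarrow> (nat \<Rightarrow> complex) \<Rightarrow> (nat \<Rightarrow> complex) \<Rightarrow> (nat \<Rightarrow> complex) \<Rightarrow>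
   (nat \<Rightarrow> int) \<Rightarrow> (nat \<Rightarrow> int) \<Rightarrow> bool" where
  "admissible_pair p q r a b \<kappa> n m \<longleftrightarrow>
     nonneg_idx p n \<and> nonneg_idx q m \<and> is_near_diag q m \<and> admissible_params p q r a b \<kappa> m"

text \<open>
  The first three index pairs are those of the recurrence vectors, the last three those of the
  test vectors.
\<close>
definition admissible_B_data ::
  "nat \<Rightarrow> nat \<Rightarrow> nat \<Rightarrow> (nat \<Rightarrow> complex) \<Rightarrow> (nat \<Rightarrow> complex) \<Rightarrow> (nat \<Rightarrow> complex) \<Rightarrow>
   (nat \<Rightarrow> int) \<Rightarrow> (nat \<Rightarrow> int) \<Rightarrow> (nat \<Rightarrow> nat \<Rightarrow> int) \<Rightarrow> (nat \<Rightarrow> nat \<Rightarrow> int) \<Rightarrow>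
   (nat \<Rightarrow> nat \<Rightarrow> int) \<Rightarrow> (nat \<Rightarrow> nat \<Rightarrow> int) \<Rightarrow> bool" where
  "admissible_B_data p q r a b \<kappa> n m u fu v fv \<longleftrightarrow>
     B_local_data p q m u fu v fv \<and>
     (\<forall>j\<in>{1..q}. admissible_pair p q r a b \<kappa> (n \<oplus>\<^sub>v fu j) (m \<oplus>\<^sub>v v j)) \<and>
     admissible_pair p q r a b \<kappa> n m \<and>
     (\<forall>i\<in>{1..p}. admissible_pair p q r a b \<kappa> (n \<ominus>\<^sub>v u i) (m \<ominus>\<^sub>v fv i)) \<and>
     (\<forall>j\<in>{1..q}. admissible_pair p q r a b \<kappa> (n \<oplus>\<^sub>v fu (j + 1)) (m \<oplus>\<^sub>v v (j - 1))) \<and>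
     admissible_pair p q r a b \<kappa> (n \<oplus>\<^sub>v fu 1) (m \<ominus>\<^sub>v fv 1) \<and>
     (\<forall>i\<in>{1..p}. admissible_pair p q r a b \<kappa> (n \<ominus>\<^sub>v u (i - 1)) (m \<ominus>\<^sub>v fv (i + 1)))"

end

theory Submission
  imports Defs
begin

text \<open>
  The moments of \<open>C\<^sub>j\<^sub>,\<^sub>i\<close> are Gamma quotients, so up to a factor independent of \<open>j\<close> and
  \<open>Q\<close> the moment conditions on a row vector \<open>Q\<close> say that one rational function of \<open>t\<close>,
  its transform, vanishes at the nodes \<open>\<kappa>\<^sub>i + l\<close>. Partial fractions and a telescoping sum
  identify the transform of \<open>B\<close> with index \<open>(n, m)\<close> as a multiple of
  \<open>(\<Prod>i. (\<kappa>\<^sub>i - t)\<^bsub>n i\<^esub>) / (\<Prod>h. (t + b\<^sub>h + 1)\<^bsub>m h\<^esub>)\<close>. Termwise comparison shows that a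
  pairing block is a constant, depending only on the test vector, times the sum over the nodes of
  the residues of \<open>(\<Prod>h. (t + b\<^sub>h + 1)\<^bsub>\<eta> h\<^esub>) * transform Q t / (\<Prod>k. t - node k)\<close>; such a sum is
  \<open>0\<close> if the transform vanishes at the nodes, and also if the degrees of \<open>Q\<close> are below
  \<open>\<eta>\<close>, by Lagrange interpolation. Along the two monotone paths of index pairs the recurrence and
  test vectors are therefore biorthogonal. Clearing denominators embeds the local space into
  polynomials with prescribed zeros, which bounds its dimension by \<open>p + q + 1\<close>.
\<close>

section \<open>Interpolation, Pochhammer symbols and circle integrals\<close>

text \<open>No vector A is ever formed. Multiplied by the Gamma factor of the moments, its
  coefficients become node values of one product divided by node differences, so a pairing is a
  finite sum of residues. Each test vector takes its column index from the next recurrence vector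
  and its row index from the previous one. Hence each of the two vanishing criteria settles one side
  of the diagonal, and the denominators assumed nonzero are multiples of the diagonal entries. With
  \<open>N = n - 1\<close> and \<open>M = m + 1\<close>, linear algebra does the rest once the
  dimension is bounded by \<open>|M| - |N| = p + q + 1\<close>. This choice of \<open>N\<close> and
  \<open>M\<close> is forced by the left-hand side: multiplication by \<open>z\<close> moves the
  argument of the transform from \<open>t\<close> to \<open>t + 1\<close>, which costs one node per
  column, and raises every degree by one. Near-diagonality ensures that one product of Pochhammer
  symbols clears all denominators of a row vector, and \<open>r < q\<close> makes the fractions
  proper. The conditions on \<open>a - b\<close> enter as \<open>a \<rho> \<noteq> b h + k\<close>:
  they keep the coefficients of B meaningful and make the clearing of denominators
  injective.\<close>

lemma degree_prod_linear:
  fixes x :: "'b \<Rightarrow> 'a::idom"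
  shows "degree (\<Prod>j\<in>J. [:x j, 1:]) = card J"
  by (subst degree_prod_sum_eq) auto

lemma lagrange_interpolation:
  fixes x :: "'b \<Rightarrow> 'a::field"
  assumes fin: "finite I" and inj: "inj_on x I" and deg: "degree P < card I"
  shows "P = (\<Sum>k\<in>I. smult (poly P (x k) / (\<Prod>j\<in>I - {k}. x k - x j)) (\<Prod>j\<in>I - {k}. [:- x j, 1:]))"
    (is "P = ?R")
proof (rule poly_eqI_degree[of "x ` I"])
  fix y assume "y \<in> x ` I"
  then obtain k where k: "k \<in> I" "y = x k" by auto
  have "poly ?R y = (\<Sum>l\<in>I. (poly P (x l) / (\<Prod>j\<in>I - {l}. x l - x j)) * (\<Prod>j\<in>I - {l}. x k - x j))"
    by (simp add: poly_sum poly_prod k)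
  also have "\<dots> = (\<Sum>l\<in>I. if l = k then poly P (x k) else 0)"
  proof (rule sum.cong[OF refl])
    fix l assume l: "l \<in> I"
    show "(poly P (x l) / (\<Prod>j\<in>I - {l}. x l - x j)) * (\<Prod>j\<in>I - {l}. x k - x j) =
      (if l = k then poly P (x k) else 0)"
    proof (cases "l = k")
      case True
      have "(\<Prod>j\<in>I - {k}. x k - x j) \<noteq> 0"
        using fin inj k by (auto simp: inj_on_def)
      with True show ?thesis by simp
    next
      case False
      then have "(\<Prod>j\<in>I - {l}. x k - x j) = 0"
        using fin k by (intro prod_zero) auto
      with False show ?thesis by simp
    qed
  qed
  finally show "poly P y = poly ?R y"
    using fin k by simp
next
  have c: "card (x ` I) = card I" using inj by (rule card_image)
  show "degree P < card (x ` I)" using deg c by simp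
  have "degree ?R \<le> card I - 1"
  proof (rule degree_sum_le[OF fin])
    fix k assume "k \<in> I"
    then have "degree (\<Prod>j\<in>I - {k}. [:- x j, 1:]) = card I - 1"
      using degree_prod_linear[of "\<lambda>j. - x j" "I - {k}"] fin by simp
    then show "degree (smult (poly P (x k) / (\<Prod>j\<in>I - {k}. x k - x j)) (\<Prod>j\<in>I - {k}. [:- x j, 1:])) \<le> card I - 1"
      using degree_smult_le by metis
  qed
  then show "degree ?R < card (x ` I)" using deg c by linarith
qed

text \<open>Compare coefficients of degree \<open>card I - 1\<close> in the interpolation formula:
  every basis product is monic of that degree, while \<open>P\<close> has a smaller one. In terms of
  residues, \<open>P\<close> over the node polynomial is O(1 / t^2) at infinity, so its residues add
  up to zero.\<close>

lemma lagrange_sum_eq_0: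
  fixes x :: "'b \<Rightarrow> 'a::field"
  assumes fin: "finite I" and inj: "inj_on x I" and deg: "degree P + 1 < card I"
  shows "(\<Sum>k\<in>I. poly P (x k) / (\<Prod>j\<in>I - {k}. x k - x j)) = 0"
proof -
  have lc: "coeff (\<Prod>j\<in>I - {k}. [:- x j, 1:]) (card I - 1) = 1" if "k \<in> I" for k
  proof -
    have "degree (\<Prod>j\<in>I - {k}. [:- x j, 1:]) = card I - 1"
      using degree_prod_linear[of "\<lambda>j. - x j" "I - {k}"] fin that by simp
    moreover have "lead_coeff (\<Prod>j\<in>I - {k}. [:- x j, 1:]) = 1"
      by (subst lead_coeff_prod) simp
    ultimately show ?thesis by simp
  qed
  have "0 = coeff P (card I - 1)"
    using deg by (intro coeff_eq_0[symmetric]) linarith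
  also have "\<dots> = (\<Sum>k\<in>I. poly P (x k) / (\<Prod>j\<in>I - {k}. x k - x j))"
    using deg lc arg_cong[OF lagrange_interpolation[OF fin inj, of P], of "\<lambda>P. coeff P (card I - 1)"]
    by (simp add: coeff_sum del: One_nat_def)
  finally show ?thesis by simp
qed

text \<open>The interpolation formula divided by the node polynomial; regularity of the parameters
  will make all poles simple.\<close>

lemma partial_fractions_simple:
  fixes x :: "'b \<Rightarrow> 'a::field"
  assumes fin: "finite I" and inj: "inj_on x I" and deg: "degree P < card I"
    and t: "\<And>k. k \<in> I \<Longrightarrow> t \<noteq> x k"
  shows "poly P t / (\<Prod>j\<in>I. t - x j) =
    (\<Sum>k\<in>I. poly P (x k) / (\<Prod>j\<in>I - {k}. x k - x j) / (t - x k))"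
proof -
  have "poly P t = (\<Sum>k\<in>I. poly P (x k) / (\<Prod>j\<in>I - {k}. x k - x j) * (\<Prod>j\<in>I - {k}. t - x j))"
    using arg_cong[OF lagrange_interpolation[OF fin inj deg], of "\<lambda>P. poly P t"]
    by (simp add: poly_sum poly_prod)
  then have "poly P t / (\<Prod>j\<in>I. t - x j) =
      (\<Sum>k\<in>I. poly P (x k) / (\<Prod>j\<in>I - {k}. x k - x j) * (\<Prod>j\<in>I - {k}. t - x j) / (\<Prod>j\<in>I. t - x j))"
    by (simp add: sum_divide_distrib)
  also have "\<dots> = (\<Sum>k\<in>I. poly P (x k) / (\<Prod>j\<in>I - {k}. x k - x j) / (t - x k))"
  proof (rule sum.cong[OF refl])
    fix k assume k: "k \<in> I"
    have "(\<Prod>j\<in>I. t - x j) = (t - x k) * (\<Prod>j\<in>I - {k}. t - x j)"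
      using fin k by (rule prod.remove)
    moreover have "(\<Prod>j\<in>I - {k}. t - x j) \<noteq> 0"
      using fin t by auto
    ultimately show "poly P (x k) / (\<Prod>j\<in>I - {k}. x k - x j) * (\<Prod>j\<in>I - {k}. t - x j) / (\<Prod>j\<in>I. t - x j) =
        poly P (x k) / (\<Prod>j\<in>I - {k}. x k - x j) / (t - x k)"
      by (simp add: divide_simps)
  qed
  finally show ?thesis .
qed

lemma prod_linear_dvd:
  fixes P :: "'a::field poly"
  assumes "finite X" "\<And>x. x \<in> X \<Longrightarrow> poly P x = 0"
  shows "(\<Prod>x\<in>X. [:- x, 1:]) dvd P"
  using assms
proof (induction X arbitrary: P rule: finite_induct)
  case (insert y X)
  then obtain Q where Q: "P = [:- y, 1:] * Q"
    using poly_eq_0_iff_dvd by (metis dvdE insertI1)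
  have "poly Q x = 0" if "x \<in> X" for x
    using insert.prems[of x] insert.hyps that Q by auto
  then have "(\<Prod>x\<in>X. [:- x, 1:]) dvd Q"
    using insert.IH by blast
  then show ?case
    unfolding Q using insert.hyps by (simp add: mult_dvd_mono del: mult_pCons_left)
qed simp

section \<open>Pochhammer symbols with integer subscripts\<close>

lemma pochhammer_prod_lessThan: "pochhammer x n = (\<Prod>s<n. x + of_nat s)"
  by (simp add: pochhammer_prod atLeast0LessThan)

lemma poch_of_nat [simp]: "poch x (int n) = pochhammer x n"
  by (simp add: poch_def)

lemma poch_nonneg: "0 \<le> n \<Longrightarrow> poch x n = pochhammer x (nat n)"
  by (simp add: poch_def)

text \<open>Subscripts in the pairing block can be negative. Over a common base \<open>x\<close>
  both signs become one quotient of ordinary Pochhammer symbols, provided that the divisor does not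
  vanish.\<close>

lemma poch_eq_pochhammer_quotient:
  assumes nz: "pochhammer x k \<noteq> 0" and y: "y = x + of_nat k" and n: "n = int l - int k"
  shows "poch y n = pochhammer x l / pochhammer x k"
proof (cases "k \<le> l")
  case True
  then have "n = int (l - k)" using n by simp
  then have "poch y n = pochhammer (x + of_nat k) (l - k)"
    by (simp only: poch_of_nat y)
  also have "\<dots> = pochhammer x l / pochhammer x k"
    using pochhammer_product[OF True, of x] nz by (simp add: field_simps)
  finally show ?thesis .
next
  case False
  then have *: "pochhammer x k = pochhammer x l * pochhammer (x + of_nat l) (k - l)"
    by (intro pochhammer_product) simp
  have "nat (- n) = k - l" "\<not> 0 \<le> n" "y + of_int n = x + of_nat l"
    using False by (auto simp: n y)
  then have "poch y n = 1 / pochhammer (x + of_nat l) (k - l)"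
    unfolding poch_def by (simp only: if_False)
  also have "\<dots> = pochhammer x l / pochhammer x k"
    using nz unfolding * by simp
  finally show ?thesis .
qed

section \<open>Powers on the unit circle\<close>

lemma has_contour_integral_powi_circlepath:
  "((\<lambda>z. z powi n) has_contour_integral (if n = -1 then 2 * pi * \<i> else 0)) (circlepath 0 1)"
proof (cases "n = -1")
  case True
  have "((\<lambda>z. 1 / (z - 0)) has_contour_integral (2 * complex_of_real pi * \<i> * 1)) (circlepath 0 1)"
    by (rule Cauchy_integral_circlepath_simple) auto
  then show ?thesis
    using True by (simp add: power_int_minus field_simps)
next
  case False
  have "((\<lambda>z. z powi n) has_contour_integral 0) (circlepath 0 1)"
  proof (rule Cauchy_theorem_primitive[where S = "- {0}" and f = "\<lambda>z. z powi (n + 1) / of_int (n + 1)"])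
    fix z :: complex assume "z \<in> - {0}"
    moreover have "of_int (n + 1) \<noteq> (0::complex)"
      using False by (simp only: of_int_eq_0_iff)
    ultimately show "((\<lambda>z. z powi (n + 1) / of_int (n + 1)) has_field_derivative z powi n) (at z within - {0})"
      by (auto intro!: derivative_eq_intros)
  qed auto
  with False show ?thesis by simp
qed

section \<open>Moments\<close>

text \<open>The linear functional sending \<open>z ^ d\<close> to \<open>f d\<close>. The degree is
  only a convenient cutoff: any larger one gives the same value, which lets different components
  share one range of summation.\<close>

definition coeff_functional :: "(nat \<Rightarrow> complex) \<Rightarrow> complex poly \<Rightarrow> complex" where
  "coeff_functional f Q = (\<Sum>d\<le>degree Q. coeff Q d * f d)"

lemma coeff_functional_lessThan:
  assumes "\<And>d. N \<le> d \<Longrightarrow> coeff Q d = 0"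
  shows "coeff_functional f Q = (\<Sum>d<N. coeff Q d * f d)"
  unfolding coeff_functional_def
proof (rule sum.mono_neutral_cong)
  show "coeff Q d * f d = 0" if "d \<in> {..<N} - {..degree Q}" for d
    using that by (simp add: coeff_eq_0)
  show "coeff Q d * f d = 0" if "d \<in> {..degree Q} - {..<N}" for d
    using that assms by simp
qed auto

lemma coeff_functional_add: "coeff_functional f (P + Q) = coeff_functional f P + coeff_functional f Q"
proof -
  define N where "N = Suc (max (degree P) (degree Q))"
  have "coeff P d = 0" "coeff Q d = 0" if "N \<le> d" for d
    using that by (auto simp: N_def coeff_eq_0)
  then show ?thesis
    by (simp add: coeff_functional_lessThan[of N] algebra_simps sum.distrib)
qed

lemma coeff_functional_smult: "coeff_functional f (smult c Q) = c * coeff_functional f Q"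
  by (cases "c = 0") (auto simp: coeff_functional_def sum_distrib_left mult_ac)

lemma coeff_functional_0 [simp]: "coeff_functional f 0 = 0"
  by (simp add: coeff_functional_def)

lemma coeff_functional_pCons:
  "coeff_functional f (pCons 0 Q) = coeff_functional (\<lambda>d. f (Suc d)) Q"
  by (simp add: coeff_functional_def sum.atMost_Suc_shift degree_pCons_eq_if del: sum.atMost_Suc)

lemma coeff_functional_cmult: "coeff_functional (\<lambda>d. c * f d) Q = c * coeff_functional f Q"
  by (simp add: coeff_functional_def sum_distrib_left mult_ac)

text \<open>On the unit circle the terms are bounded by a multiple of \<open>norm (c k)\<close>, so
  the series converges uniformly and may be integrated term by term. Only the power
  \<open>z powi (-1)\<close> contributes, which selects \<open>k = l + d\<close>.\<close>

lemma contour_integral_laurent_moment: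
  assumes "summable (\<lambda>k. norm (c k))"
  shows "contour_integral (circlepath 0 1)
           (\<lambda>z. z ^ l * poly Q z * (\<Sum>k. c k * z powi (- int k - 1))) =
         2 * pi * \<i> * coeff_functional (\<lambda>d. c (l + d)) Q"
proof -
  define f where "f k z = z ^ l * poly Q z * (c k * z powi (- int k - 1))" for k z
  define M where "M = (\<Sum>d\<le>degree Q. norm (coeff Q d))"
  have nz: "norm (f k z) \<le> M * norm (c k)" if "z \<in> sphere 0 1" for k z
  proof -
    have z: "norm z = 1" using that by simp
    have "norm (poly Q z) \<le> M"
      unfolding M_def poly_altdef by (rule order.trans[OF norm_sum]) (simp add: norm_mult norm_power z)
    then show ?thesis
      by (simp add: f_def norm_mult norm_divide norm_power norm_power_int z mult_right_mono)
  qed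
  have ul: "uniform_limit (sphere 0 1) (\<lambda>N z. \<Sum>k<N. f k z) (\<lambda>z. \<Sum>k. f k z) sequentially"
    using nz by (rule Weierstrass_m_test) (use assms in \<open>auto intro: summable_mult\<close>)
  have int: "(f k has_contour_integral (\<Sum>d\<le>degree Q. coeff Q d * (if l + d = k then 2 * pi * \<i> * c k else 0)))
      (circlepath 0 1)" for k
  proof -
    let ?g = "\<lambda>z. \<Sum>d\<le>degree Q. coeff Q d * c k * z powi (int l + int d - int k - 1)"
    have "(?g has_contour_integral
        (\<Sum>d\<le>degree Q. coeff Q d * c k *
           (if int l + int d - int k - 1 = -1 then 2 * pi * \<i> else 0))) (circlepath 0 1)"
      by (intro has_contour_integral_sum has_contour_integral_lmul has_contour_integral_powi_circlepath) auto
    moreover have "(\<Sum>d\<le>degree Q. coeff Q d * c k *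
           (if int l + int d - int k - 1 = -1 then 2 * pi * \<i> else 0)) =
        (\<Sum>d\<le>degree Q. coeff Q d * (if l + d = k then 2 * pi * \<i> * c k else 0))"
      by (intro sum.cong) auto
    ultimately have g: "(?g has_contour_integral (\<Sum>d\<le>degree Q. coeff Q d * (if l + d = k then 2 * pi * \<i> * c k else 0)))
      (circlepath 0 1)" by simp
    show ?thesis
    proof (rule has_contour_integral_eq[OF g])
      fix z assume "z \<in> path_image (circlepath (0::complex) 1)"
      then have z: "z \<noteq> 0" by auto
      have "z powi (int l + int d - int k - 1) = z ^ l * z ^ d * z powi (- int k - 1)" for d
        using z power_int_add[of z "int l + int d" "- int k - 1"] by (simp add: power_int_add algebra_simps)
      then show "?g z = f k z"
        by (simp add: f_def poly_altdef sum_distrib_left sum_distrib_right sum_divide_distrib mult_ac)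
    qed
  qed
  have "(\<lambda>N. contour_integral (circlepath 0 1) (\<lambda>z. \<Sum>k<N. f k z))
      \<longlonglongrightarrow> contour_integral (circlepath 0 1) (\<lambda>z. \<Sum>k. f k z)"
  proof (rule contour_integral_uniform_limit_circlepath(2)[OF _ ul])
    show "\<forall>\<^sub>F N in sequentially. (\<lambda>z. \<Sum>k<N. f k z) contour_integrable_on circlepath 0 1"
      by (intro always_eventually allI contour_integrable_sum has_contour_integral_integrable[OF int]) auto
  qed auto
  \<comment> \<open>The truncated integrals are eventually constant, since terms with
    \<open>k > l + degree Q\<close> integrate to zero.\<close>
  moreover have "\<forall>\<^sub>F N in sequentially. contour_integral (circlepath 0 1) (\<lambda>z. \<Sum>k<N. f k z) =
      2 * pi * \<i> * coeff_functional (\<lambda>d. c (l + d)) Q"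
    using eventually_gt_at_top[of "l + degree Q"]
  proof eventually_elim
    case (elim N)
    have "contour_integral (circlepath 0 1) (\<lambda>z. \<Sum>k<N. f k z) =
        (\<Sum>k<N. \<Sum>d\<le>degree Q. coeff Q d * (if l + d = k then 2 * pi * \<i> * c k else 0))"
      by (intro contour_integral_unique has_contour_integral_sum int) auto
    also have "\<dots> = (\<Sum>d\<le>degree Q. \<Sum>k<N. coeff Q d * (if l + d = k then 2 * pi * \<i> * c k else 0))"
      by (rule sum.swap)
    also have "\<dots> = (\<Sum>d\<le>degree Q. coeff Q d * (2 * pi * \<i> * c (l + d)))"
      using elim by (intro sum.cong) (auto simp flip: sum_distrib_left)
    finally show ?case by (simp add: coeff_functional_def sum_distrib_left mult_ac)
  qed
  ultimately have "contour_integral (circlepath 0 1) (\<lambda>z. \<Sum>k. f k z) =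
      2 * pi * \<i> * coeff_functional (\<lambda>d. c (l + d)) Q"
    by (intro tendsto_unique[OF _ _ tendsto_eventually]) auto
  moreover have "contour_integral (circlepath 0 1) (\<lambda>z. \<Sum>k. f k z) = contour_integral (circlepath 0 1)
           (\<lambda>z. z ^ l * poly Q z * (\<Sum>k. c k * z powi (- int k - 1)))"
  proof (rule contour_integral_eq)
    fix z assume "z \<in> path_image (circlepath (0::complex) 1)"
    then have z: "norm z = 1" by simp
    have "summable (\<lambda>k. c k * z powi (- int k - 1))"
      by (rule summable_norm_cancel) (use assms in \<open>simp add: norm_mult norm_power_int z\<close>)
    then show "(\<Sum>k. f k z) = z ^ l * poly Q z * (\<Sum>k. c k * z powi (- int k - 1))"
      unfolding f_def by (rule suminf_mult)
  qed
  ultimately show ?thesis by simp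
qed

section \<open>Convergence of the weight series and the moment conditions\<close>

lemma tendsto_of_nat_add_quotient:
  fixes \<alpha> \<beta> :: complex
  shows "(\<lambda>k. 1 / (of_nat k + \<beta>)) \<longlonglongrightarrow> 0"
    and "(\<lambda>k. (of_nat k + \<alpha>) / (of_nat k + \<beta>)) \<longlonglongrightarrow> 1"
proof -
  have inf: "filterlim (\<lambda>k. of_nat k + \<beta>) at_infinity sequentially"
    by (rule filterlim_cong[THEN iffD1, OF refl refl _ tendsto_add_filterlim_at_infinity[OF tendsto_const tendsto_of_nat]])
       (auto simp: add.commute)
  show 1: "(\<lambda>k. 1 / (of_nat k + \<beta>)) \<longlonglongrightarrow> 0"
    by (intro tendsto_divide_0[OF tendsto_const] inf)
  have "(\<lambda>k. 1 + (\<alpha> - \<beta>) * (1 / (of_nat k + \<beta>))) \<longlonglongrightarrow> 1 + (\<alpha> - \<beta>) * 0"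
    by (intro tendsto_intros 1)
  moreover have "\<forall>\<^sub>F k in sequentially. 1 + (\<alpha> - \<beta>) * (1 / (of_nat k + \<beta>)) = (of_nat k + \<alpha>) / (of_nat k + \<beta>)"
    using filterlim_at_infinity_imp_eventually_ne[OF inf, of 0]
    by eventually_elim (simp add: field_simps)
  ultimately show "(\<lambda>k. (of_nat k + \<alpha>) / (of_nat k + \<beta>)) \<longlonglongrightarrow> 1"
    using tendsto_cong by force
qed

lemma pochhammer_neq_0_of_notin_nonpos_Ints:
  fixes x :: complex
  assumes "x \<notin> \<int>\<^sub>\<le>\<^sub>0"
  shows "pochhammer x n \<noteq> 0"
  using assms by (auto simp: pochhammer_eq_0_iff)

lemma Gamma_add_of_nat:
  fixes x :: complex
  assumes "x \<notin> \<int>\<^sub>\<le>\<^sub>0"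
  shows "Gamma (x + of_nat n) = Gamma x * pochhammer x n"
  using assms pochhammer_Gamma[OF assms, of n] by (simp add: Gamma_eq_zero_iff)

lemma add_of_nat_notin_nonpos_Ints:
  fixes x :: complex
  assumes "x \<notin> \<int>\<^sub>\<le>\<^sub>0"
  shows "x + of_nat n \<notin> \<int>\<^sub>\<le>\<^sub>0"
proof
  assume "x + of_nat n \<in> \<int>\<^sub>\<le>\<^sub>0"
  then obtain k where "k \<le> 0" "x + of_nat n = of_int k" by (auto elim: nonpos_Ints_cases)
  then have "x = of_int (k - int n)" "k - int n \<le> 0" by (auto simp: algebra_simps)
  with assms show False by (metis nonpos_Ints_of_int)
qed

text \<open>Regularity together with the part of admissibility that involves no row index. The
  conditions on \<open>a - b\<close> depend on the index pair and are supplied in the individual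
  lemmas.\<close>

locale hypergeometric_system =
  fixes p q r :: nat and a b \<kappa> :: "nat \<Rightarrow> complex"
  assumes r_less_q: "r < q"
    and regular: "regular_params p q b \<kappa>"
    and \<kappa>_a: "\<And>i \<rho>. i \<in> {1..p} \<Longrightarrow> \<rho> \<in> {1..r} \<Longrightarrow> \<kappa> i + a \<rho> + 1 \<notin> \<int>\<^sub>\<le>\<^sub>0"
    and \<kappa>_b: "\<And>i h. i \<in> {1..p} \<Longrightarrow> h \<in> {1..q} \<Longrightarrow> \<kappa> i + b h + 1 \<notin> \<int>\<^sub>\<le>\<^sub>0"
begin

text \<open>
  The quotient of the moment of \<open>C\<^sub>j\<^sub>,\<^sub>i\<close> at \<open>t + d\<close> by a factor depending only on
  \<open>t = \<kappa>\<^sub>i + l\<close>: it makes every moment condition an evaluation of one rational function.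
\<close>
definition \<phi> :: "nat \<Rightarrow> nat \<Rightarrow> complex \<Rightarrow> complex" where
  "\<phi> j d t = (\<Prod>\<rho>=1..r. pochhammer (t + a \<rho> + 1) d) /
             ((\<Prod>h=1..q. pochhammer (t + b h + 1) d) * (t + b j + 1 + of_nat d))"

definition transform :: "(nat \<Rightarrow> complex poly) \<Rightarrow> complex \<Rightarrow> complex" where
  "transform Q t = (\<Sum>j=1..q. coeff_functional (\<lambda>d. \<phi> j d t) (Q j))"

definition moment :: "nat \<Rightarrow> nat \<Rightarrow> nat \<Rightarrow> complex" where
  "moment j i k = vGamma {1..r} (\<lambda>\<rho>. of_nat k + \<kappa> i + a \<rho> + 1) /
     vGamma {1..q} (\<lambda>h. of_nat k + \<kappa> i + b h + of_bool (h = j) + 1)"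

definition moment_scale :: "nat \<Rightarrow> nat \<Rightarrow> complex" where
  "moment_scale i l = vGamma {1..r} (\<lambda>\<rho>. of_nat l + \<kappa> i + a \<rho> + 1) /
     vGamma {1..q} (\<lambda>h. of_nat l + \<kappa> i + b h + 1)"

lemma \<kappa>_a_shift: "i \<in> {1..p} \<Longrightarrow> \<rho> \<in> {1..r} \<Longrightarrow> \<kappa> i + of_nat l + a \<rho> + 1 \<notin> \<int>\<^sub>\<le>\<^sub>0"
  using add_of_nat_notin_nonpos_Ints[OF \<kappa>_a, of i \<rho> l] by (simp add: algebra_simps)

lemma \<kappa>_b_shift: "i \<in> {1..p} \<Longrightarrow> h \<in> {1..q} \<Longrightarrow> \<kappa> i + of_nat l + b h + 1 \<notin> \<int>\<^sub>\<le>\<^sub>0"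
  using add_of_nat_notin_nonpos_Ints[OF \<kappa>_b, of i h l] by (simp add: algebra_simps)

lemma b_diff_notin_Ints: "j \<in> {1..q} \<Longrightarrow> h \<in> {1..q} \<Longrightarrow> j \<noteq> h \<Longrightarrow> b j - b h \<notin> \<int>"
  using regular by (auto simp: regular_params_def)

lemma \<kappa>_diff_notin_Ints: "i \<in> {1..p} \<Longrightarrow> h \<in> {1..p} \<Longrightarrow> i \<noteq> h \<Longrightarrow> \<kappa> i - \<kappa> h \<notin> \<int>"
  using regular by (auto simp: regular_params_def)

lemma moment_scale_neq_0: "i \<in> {1..p} \<Longrightarrow> moment_scale i l \<noteq> 0"
  using \<kappa>_a_shift[of i _ l] \<kappa>_b_shift[of i _ l]
  by (auto simp: moment_scale_def vGamma_def Gamma_eq_zero_iff algebra_simps)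

text \<open>The functional equation of \<open>Gamma\<close> pulls a Pochhammer symbol out of every
  factor. The unit vector in the denominator of the weight costs one further step in component
  \<open>j\<close>, which is the linear factor in \<open>\<phi>\<close>.\<close>

lemma moment_add:
  assumes i: "i \<in> {1..p}" and j: "j \<in> {1..q}"
  shows "moment j i (l + d) = moment_scale i l * \<phi> j d (\<kappa> i + of_nat l)"
proof -
  let ?t = "\<kappa> i + of_nat l"
  have A: "Gamma (of_nat (l + d) + \<kappa> i + a \<rho> + 1) = Gamma (of_nat l + \<kappa> i + a \<rho> + 1) * pochhammer (?t + a \<rho> + 1) d"
    if "\<rho> \<in> {1..r}" for \<rho>
    using Gamma_add_of_nat[OF \<kappa>_a_shift[OF i that, of l], of d] by (simp add: algebra_simps)
  have B: "Gamma (of_nat (l + d) + \<kappa> i + b h + of_bool (h = j) + 1) =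
      Gamma (of_nat l + \<kappa> i + b h + 1) * pochhammer (?t + b h + 1) d * (if h = j then ?t + b j + 1 + of_nat d else 1)"
    if "h \<in> {1..q}" for h
  proof -
    define g where "g = ?t + b h + 1"
    have g: "g \<notin> \<int>\<^sub>\<le>\<^sub>0" using \<kappa>_b_shift[OF i that] by (simp add: g_def)
    have "Gamma (g + of_nat d + 1) = (g + of_nat d) * Gamma (g + of_nat d)"
      by (intro Gamma_plus1 add_of_nat_notin_nonpos_Ints g)
    then have "Gamma (g + of_nat d + of_bool (h = j)) =
        Gamma g * pochhammer g d * (if h = j then g + of_nat d else 1)"
      using Gamma_add_of_nat[OF g, of d] by simp
    moreover have "of_nat (l + d) + \<kappa> i + b h + of_bool (h = j) + 1 = g + of_nat d + of_bool (h = j)"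
      "of_nat l + \<kappa> i + b h + 1 = g" by (simp_all add: g_def)
    ultimately show ?thesis by (simp only: g_def cong: if_cong)
  qed
  have "(\<Prod>h=1..q. if h = j then ?t + b j + 1 + of_nat d else 1) = ?t + b j + 1 + of_nat d"
    using j by simp
  then have "(\<Prod>h=1..q. Gamma (of_nat (l + d) + \<kappa> i + b h + of_bool (h = j) + 1)) =
      (\<Prod>h=1..q. Gamma (of_nat l + \<kappa> i + b h + 1)) * (\<Prod>h=1..q. pochhammer (?t + b h + 1) d) *
      (?t + b j + 1 + of_nat d)"
    by (simp only: B prod.distrib cong: prod.cong)
  moreover have "(\<Prod>\<rho>=1..r. Gamma (of_nat (l + d) + \<kappa> i + a \<rho> + 1)) =
      (\<Prod>\<rho>=1..r. Gamma (of_nat l + \<kappa> i + a \<rho> + 1)) * (\<Prod>\<rho>=1..r. pochhammer (?t + a \<rho> + 1) d)"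
    by (simp only: A prod.distrib cong: prod.cong)
  ultimately show ?thesis
    by (simp only: moment_def moment_scale_def vGamma_def \<phi>_def times_divide_times_eq mult.assoc)
qed

text \<open>Ratio test. The quotient \<open>R k\<close> of consecutive moments has \<open>r\<close>
  factors tending to 1 and \<open>q - r\<close> factors \<open>1 / (k + \<beta> h)\<close> tending
  to 0; since \<open>r < q\<close>, at least one of the latter is present, for instance
  \<open>h = q\<close>.\<close>

lemma summable_moment:
  assumes i: "i \<in> {1..p}" and j: "j \<in> {1..q}"
  shows "summable (\<lambda>k. norm (moment j i k))"
proof -
  define \<alpha> where "\<alpha> \<rho> = \<kappa> i + a \<rho> + 1" for \<rho>
  define \<beta> where "\<beta> h = \<kappa> i + b h + of_bool (h = j) + 1" for h
  define R where "R k = (\<Prod>\<rho>=1..r. of_nat k + \<alpha> \<rho>) / (\<Prod>h=1..q. of_nat k + \<beta> h)" for k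
  have \<beta>: "of_nat k + \<beta> h \<notin> \<int>\<^sub>\<le>\<^sub>0" if "h \<in> {1..q}" for h k
    using add_of_nat_notin_nonpos_Ints[OF \<kappa>_b[OF i that], of "k + of_bool (h = j)"] by (simp add: \<beta>_def algebra_simps)
  have \<alpha>: "of_nat k + \<alpha> \<rho> \<notin> \<int>\<^sub>\<le>\<^sub>0" if "\<rho> \<in> {1..r}" for \<rho> k
    using \<kappa>_a_shift[OF i that, of k] by (simp add: \<alpha>_def algebra_simps)
  have Suc: "moment j i (Suc k) = R k * moment j i k" for k
  proof -
    have "Gamma (of_nat (Suc k) + \<alpha> \<rho>) = (of_nat k + \<alpha> \<rho>) * Gamma (of_nat k + \<alpha> \<rho>)" if "\<rho> \<in> {1..r}" for \<rho>
      using Gamma_plus1[OF \<alpha>[OF that, of k]] by (simp add: algebra_simps)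
    moreover have "Gamma (of_nat (Suc k) + \<beta> h) = (of_nat k + \<beta> h) * Gamma (of_nat k + \<beta> h)" if "h \<in> {1..q}" for h
      using Gamma_plus1[OF \<beta>[OF that, of k]] by (simp add: algebra_simps)
    moreover have "moment j i k = (\<Prod>\<rho>=1..r. Gamma (of_nat k + \<alpha> \<rho>)) / (\<Prod>h=1..q. Gamma (of_nat k + \<beta> h))" for k
      by (simp add: moment_def vGamma_def \<alpha>_def \<beta>_def add.assoc)
    ultimately show ?thesis
      by (simp add: R_def prod.distrib del: of_nat_Suc)
  qed
  have R_eq: "R k = (\<Prod>h=1..q. if h \<in> {1..r} then (of_nat k + \<alpha> h) / (of_nat k + \<beta> h) else 1 / (of_nat k + \<beta> h))" for k
  proof -
    have "(\<Prod>\<rho>=1..r. of_nat k + \<alpha> \<rho>) = (\<Prod>h=1..q. if h \<in> {1..r} then of_nat k + \<alpha> h else 1)"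
      using r_less_q by (intro prod.mono_neutral_cong_left) auto
    then show ?thesis
      by (simp only: R_def flip: prod_dividef) (rule prod.cong, auto)
  qed
  moreover have "(\<lambda>k. \<Prod>h=1..q. if h \<in> {1..r} then (of_nat k + \<alpha> h) / (of_nat k + \<beta> h) else 1 / (of_nat k + \<beta> h))
      \<longlonglongrightarrow> (\<Prod>h=1..q. if h \<in> {1..r} then 1 else 0)"
    by (intro tendsto_prod) (simp add: tendsto_of_nat_add_quotient)
  moreover have "(\<Prod>h=1..q. if h \<in> {1..r} then 1 else 0 :: complex) = 0"
    using r_less_q by (intro prod_zero) (auto intro!: bexI[of _ q])
  ultimately have "R \<longlonglongrightarrow> 0"
    unfolding R_eq[abs_def] by (simp only:)
  then have "\<forall>\<^sub>F k in sequentially. norm (R k) < 1 / 2"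
    by (auto dest!: tendstoD[of _ _ _ "1 / 2"])
  then obtain N where N: "\<And>k. k \<ge> N \<Longrightarrow> norm (R k) < 1 / 2"
    by (auto simp: eventually_sequentially)
  show ?thesis
  proof (rule summable_ratio_test[of "1 / 2" N])
    show "norm (norm (moment j i (Suc k))) \<le> 1 / 2 * norm (norm (moment j i k))" if "N \<le> k" for k
      using mult_right_mono[OF less_imp_le[OF N[OF that]], of "norm (moment j i k)"] by (simp add: Suc norm_mult)
  qed simp
qed

lemma sum_contour_integral_weight:
  assumes i: "i \<in> {1..p}"
  shows "(\<Sum>j=1..q. contour_integral (circlepath 0 1)
            (\<lambda>z. z ^ l * poly (Q j) z * weight q r a b \<kappa> j i z) / (2 * pi * \<i>)) =
         moment_scale i l * transform Q (\<kappa> i + of_nat l)"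
proof -
  have "contour_integral (circlepath 0 1)
      (\<lambda>z. z ^ l * poly (Q j) z * weight q r a b \<kappa> j i z) / (2 * pi * \<i>) =
      moment_scale i l * coeff_functional (\<lambda>d. \<phi> j d (\<kappa> i + of_nat l)) (Q j)" if j: "j \<in> {1..q}" for j
    using contour_integral_laurent_moment[OF summable_moment[OF i j], of l "Q j"]
    unfolding weight_def moment_def[symmetric]
    by (simp add: moment_add[OF i j] coeff_functional_cmult)
  then show ?thesis
    by (simp add: transform_def sum_distrib_left)
qed

text \<open>\<open>moment_scale\<close> is nonzero and depends neither on \<open>j\<close> nor on
  \<open>Q\<close>, so it cancels from each condition. After this point no integral occurs:
  orthogonality is a statement about zeros of \<open>transform Q\<close>.\<close>

lemma local_space_iff:
  "Q \<in> local_space p q r a b \<kappa> N M \<longleftrightarrow>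
     (\<forall>j. j \<notin> {1..q} \<longrightarrow> Q j = 0) \<and>
     (\<forall>j\<in>{1..q}. Q j \<in> polys_le (M j - 1)) \<and>
     (\<forall>i\<in>{1..p}. \<forall>l. int l < N i \<longrightarrow> transform Q (\<kappa> i + of_nat l) = 0)"
proof -
  have "int l \<le> N i - 1 \<longleftrightarrow> int l < N i" for i l by auto
  then show ?thesis
    unfolding local_space_def mem_Collect_eq
    by (intro conj_cong refl ball_cong)
       (simp only: sum_contour_integral_weight mult_eq_0_iff moment_scale_neq_0 simp_thms)
qed

end

section \<open>Row vectors with a simple pole as transform\<close>

context hypergeometric_system
begin

lemma b_neq: "j \<in> {1..q} \<Longrightarrow> h \<in> {1..q} \<Longrightarrow> j \<noteq> h \<Longrightarrow> b j \<noteq> b h + of_int k"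
  using b_diff_notin_Ints[of j h] by (metis Ints_of_int add_diff_cancel_left')

lemma pochhammer_b_diff_neq_0:
  assumes "j \<in> {1..q}" "h \<in> {1..q}" "j \<noteq> h"
  shows "pochhammer (b j - (b h + of_int k)) n \<noteq> 0"
proof -
  have "b j \<noteq> b h + of_int (k - int s)" for s using b_neq[OF assms] .
  then show ?thesis by (auto simp: pochhammer_eq_0_iff algebra_simps)
qed

text \<open>The coefficient of \<open>1 / (b j - X)\<close> in the partial fractions of
  \<open>(\<Prod>\<rho>. a \<rho> - X) / (\<Prod>h. b h - X)\<close>, which is proper because
  \<open>r < q\<close>.\<close>

definition residue_b :: "nat \<Rightarrow> complex" where
  "residue_b j = (\<Prod>\<rho>=1..r. a \<rho> - b j) / (\<Prod>h\<in>{1..q} - {j}. b h - b j)"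

lemma sum_residue_b:
  assumes "\<And>h. h \<in> {1..q} \<Longrightarrow> X \<noteq> b h"
  shows "(\<Sum>j=1..q. residue_b j / (b j - X)) = (\<Prod>\<rho>=1..r. a \<rho> - X) / (\<Prod>h=1..q. b h - X)"
proof -
  have "inj_on (\<lambda>h. - b h) {1..q}"
    using b_neq[of _ _ 0] by (intro inj_onI) (metis add.right_neutral neg_equal_iff_equal of_int_0)
  moreover have "degree (\<Prod>\<rho>=1..r. [:a \<rho>, 1:]) < card {1..q}"
    using r_less_q by (simp add: degree_prod_linear)
  moreover have "- X \<noteq> - b h" if "h \<in> {1..q}" for h using assms[OF that] by simp
  ultimately have "poly (\<Prod>\<rho>=1..r. [:a \<rho>, 1:]) (- X) / (\<Prod>j=1..q. - X - (- b j)) =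
    (\<Sum>k=1..q. poly (\<Prod>\<rho>=1..r. [:a \<rho>, 1:]) (- b k) / (\<Prod>j\<in>{1..q} - {k}. - b k - (- b j)) / (- X - (- b k)))"
    by (intro partial_fractions_simple) auto
  then show ?thesis
    by (simp add: poly_prod residue_b_def)
qed

text \<open>Splitting \<open>1 / ((b j - X) * (b j - Y))\<close> turns the sum into a divided
  difference of the fraction in \<open>sum_residue_b\<close>; this difference is what telescopes
  later.\<close>

lemma sum_residue_b_product:
  assumes "\<And>h. h \<in> {1..q} \<Longrightarrow> X \<noteq> b h" "\<And>h. h \<in> {1..q} \<Longrightarrow> Y \<noteq> b h" "X \<noteq> Y"
  shows "(\<Sum>j=1..q. residue_b j / ((b j - X) * (b j - Y))) =
    ((\<Prod>\<rho>=1..r. a \<rho> - X) / (\<Prod>h=1..q. b h - X) - (\<Prod>\<rho>=1..r. a \<rho> - Y) / (\<Prod>h=1..q. b h - Y)) / (X - Y)"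
proof -
  have "residue_b j / ((b j - X) * (b j - Y)) = (residue_b j / (b j - X) - residue_b j / (b j - Y)) / (X - Y)"
    if "j \<in> {1..q}" for j
    using assms(1,2)[OF that] assms(3) by (simp add: divide_simps) (simp add: algebra_simps)
  then show ?thesis
    by (simp only: sum_divide_distrib[symmetric] sum_subtractf sum_residue_b[OF assms(1)] sum_residue_b[OF assms(2)] cong: sum.cong)
qed

text \<open>
  For \<open>x = b\<^sub>H + K\<close>: the coefficient of \<open>z\<^sup>d\<close> in the \<open>j\<close>-th component of the
  row vector whose transform is \<open>1 / (t + x + 1)\<close>, written so that no factor \<open>b\<^sub>j - x + d\<close>,
  which vanishes for \<open>j = H\<close>, \<open>d = K\<close>, is divided by.
\<close>
definition elementary_coeff :: "nat \<Rightarrow> nat \<Rightarrow> nat \<Rightarrow> nat \<Rightarrow> complex" where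
  "elementary_coeff H K j d =
     residue_b j * (\<Prod>h\<in>{1..q} - {j}. pochhammer (b h - (b H + of_nat K)) (Suc d)) *
     pochhammer (b j - (b H + of_nat K)) d / (\<Prod>\<rho>=1..r. pochhammer (a \<rho> - (b H + of_nat K)) (Suc d))"

text \<open>For fixed \<open>d < K\<close> the sum over \<open>j\<close> is, by
  \<open>sum_residue_b_product\<close>, the difference of \<open>V d * F d\<close> and its
  successor, divided by \<open>t + x + 1\<close>. Summation over \<open>d\<close> leaves
  \<open>1 - V K * F K\<close>, and the single extra term \<open>j = H\<close>, \<open>d = K\<close>
  restores the missing \<open>V K * F K\<close>.\<close>

lemma sum_elementary_coeff:
  assumes H: "H \<in> {1..q}"
    and a: "\<And>\<rho> k. \<rho> \<in> {1..r} \<Longrightarrow> k \<le> K \<Longrightarrow> a \<rho> \<noteq> b H + of_nat k"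
    and t: "\<And>h. h \<in> {1..q} \<Longrightarrow> t + b h + 1 \<notin> \<int>\<^sub>\<le>\<^sub>0"
  shows "(\<Sum>j=1..q. \<Sum>d<K + of_bool (j = H). elementary_coeff H K j d * \<phi> j d t) = 1 / (t + b H + of_nat K + 1)"
proof -
  define x where "x = b H + of_nat K"
  define V where "V d = (\<Prod>h=1..q. pochhammer (b h - x) d) / (\<Prod>\<rho>=1..r. pochhammer (a \<rho> - x) d)" for d
  define F where "F d = (\<Prod>\<rho>=1..r. pochhammer (t + a \<rho> + 1) d) / (\<Prod>h=1..q. pochhammer (t + b h + 1) d)" for d
  have tb: "t + b h + 1 + of_nat d \<noteq> 0" if "h \<in> {1..q}" for h d
    using add_of_nat_notin_nonpos_Ints[OF t[OF that], of d] by auto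
  have tx: "t + x + 1 \<noteq> 0"
    using tb[OF H, of K] by (simp add: x_def algebra_simps)
  have ax: "a \<rho> - x + of_nat d \<noteq> 0" if "\<rho> \<in> {1..r}" "d \<le> K" for \<rho> d
    using a[OF that(1), of "K - d"] that(2) by (auto simp: x_def of_nat_diff algebra_simps)
  have bx: "b h - x + of_nat d \<noteq> 0" if "h \<in> {1..q}" "d < K" for h d
  proof (cases "h = H")
    case False
    then show ?thesis using b_neq[OF that(1) H False, of "int K - int d"] by (auto simp: x_def algebra_simps)
  qed (use that in \<open>simp add: x_def\<close>)
  have step: "(\<Sum>j=1..q. elementary_coeff H K j d * \<phi> j d t) = (V d * F d - V (Suc d) * F (Suc d)) / (t + x + 1)"
    if d: "d < K" for d
  proof -
    \<comment> \<open>\<open>b j - ?X\<close> and \<open>b j - ?Y\<close> are the new factors of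
      component \<open>j\<close> when \<open>d\<close> grows by one, in \<open>V\<close> and in
      \<open>F\<close> respectively.\<close>
    let ?X = "x - of_nat d" and ?Y = "- (t + 1 + of_nat d)"
    define gX where "gX = (\<Prod>\<rho>=1..r. a \<rho> - ?X) / (\<Prod>h=1..q. b h - ?X)"
    define gY where "gY = (\<Prod>\<rho>=1..r. a \<rho> - ?Y) / (\<Prod>h=1..q. b h - ?Y)"
    have term_eq: "elementary_coeff H K j d * \<phi> j d t = V (Suc d) * F d * (residue_b j / ((b j - ?X) * (b j - ?Y)))"
      if j: "j \<in> {1..q}" for j
    proof -
      have nz: "b j - ?X \<noteq> 0" using bx[OF j d] by (simp add: algebra_simps)
      have "(\<Prod>h=1..q. pochhammer (b h - x) (Suc d)) =
          pochhammer (b j - x) d * (b j - ?X) * (\<Prod>h\<in>{1..q} - {j}. pochhammer (b h - x) (Suc d))"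
        using j by (subst prod.remove[of _ j]) (auto simp: pochhammer_Suc)
      then have "(\<Prod>h\<in>{1..q} - {j}. pochhammer (b h - x) (Suc d)) * pochhammer (b j - x) d =
          (\<Prod>h=1..q. pochhammer (b h - x) (Suc d)) / (b j - ?X)"
        using nz by simp
      then have "elementary_coeff H K j d = residue_b j * V (Suc d) / (b j - ?X)"
        unfolding elementary_coeff_def V_def x_def[symmetric] mult.assoc by (simp add: mult_ac)
      moreover have "\<phi> j d t = F d / (b j - ?Y)"
        by (simp add: \<phi>_def F_def algebra_simps)
      ultimately show ?thesis by (simp add: mult_ac)
    qed
    have "(\<Sum>j=1..q. elementary_coeff H K j d * \<phi> j d t) =
        V (Suc d) * F d * (\<Sum>j=1..q. residue_b j / ((b j - ?X) * (b j - ?Y)))"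
      unfolding sum_distrib_left by (intro sum.cong refl term_eq)
    also have "(\<Sum>j=1..q. residue_b j / ((b j - ?X) * (b j - ?Y))) = (gX - gY) / (?X - ?Y)"
      unfolding gX_def gY_def
    proof (rule sum_residue_b_product)
      show "?X \<noteq> b h" if "h \<in> {1..q}" for h using bx[OF that d] by (auto simp: algebra_simps)
      show "?Y \<noteq> b h" if "h \<in> {1..q}" for h using tb[OF that, of d] by (auto simp: add_eq_0_iff algebra_simps)
      show "?X \<noteq> ?Y" using tx by (auto simp: add_eq_0_iff algebra_simps)
    qed
    also have "?X - ?Y = t + x + 1" by simp
    also have "V (Suc d) * F d * ((gX - gY) / (t + x + 1)) = (V (Suc d) * gX * F d - V (Suc d) * (F d * gY)) / (t + x + 1)"
      by (simp add: algebra_simps)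
    also have "V (Suc d) * gX = V d"
    proof -
      have "(\<Prod>h=1..q. b h - ?X) \<noteq> 0" "(\<Prod>\<rho>=1..r. a \<rho> - ?X) \<noteq> 0"
        using bx d ax[of _ d] by (auto simp: algebra_simps)
      moreover have "V (Suc d) = V d * (\<Prod>h=1..q. b h - ?X) / (\<Prod>\<rho>=1..r. a \<rho> - ?X)"
        by (simp only: V_def pochhammer_Suc prod.distrib diff_diff_eq2 diff_add_eq[symmetric]
            times_divide_times_eq times_divide_eq_right divide_divide_eq_left times_divide_eq_left)
      ultimately show ?thesis by (simp add: gX_def)
    qed
    also have "F d * gY = F (Suc d)"
    proof -
      have "t + c + 1 + of_nat d = c - ?Y" for c by simp
      then show ?thesis
        by (simp only: F_def gY_def pochhammer_Suc prod.distrib times_divide_times_eq)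
    qed
    finally show ?thesis .
  qed
  \<comment> \<open>At \<open>d = K\<close> the point \<open>?X\<close> would be \<open>b H\<close>,
    a pole of the fraction, so the previous step does not apply. The factor
    \<open>b H - x + K = 0\<close> is simply absent from \<open>elementary_coeff H K H K\<close>,
    and the rest collapses to \<open>V K\<close>.\<close>
  have last: "elementary_coeff H K H K * \<phi> H K t = V K * F K / (t + x + 1)"
  proof -
    have "(\<Prod>h\<in>{1..q} - {H}. pochhammer (b h - x) (Suc K)) =
        (\<Prod>h\<in>{1..q} - {H}. pochhammer (b h - x) K) * (\<Prod>h\<in>{1..q} - {H}. b h - b H)"
      by (simp add: pochhammer_Suc prod.distrib x_def)
    moreover have "(\<Prod>\<rho>=1..r. pochhammer (a \<rho> - x) (Suc K)) =
        (\<Prod>\<rho>=1..r. pochhammer (a \<rho> - x) K) * (\<Prod>\<rho>=1..r. a \<rho> - b H)"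
      by (simp add: pochhammer_Suc prod.distrib x_def)
    moreover have "(\<Prod>h=1..q. pochhammer (b h - x) K) =
        pochhammer (b H - x) K * (\<Prod>h\<in>{1..q} - {H}. pochhammer (b h - x) K)"
      using H by (intro prod.remove) auto
    moreover have "(\<Prod>\<rho>=1..r. a \<rho> - b H) \<noteq> 0" "(\<Prod>h\<in>{1..q} - {H}. b h - b H) \<noteq> 0"
      using a[of _ 0] b_neq[OF _ H, of _ 0] by auto
    ultimately have "elementary_coeff H K H K = V K"
      unfolding elementary_coeff_def residue_b_def V_def x_def[symmetric] by simp
    moreover have "\<phi> H K t = F K / (t + x + 1)"
      by (simp add: \<phi>_def F_def x_def algebra_simps)
    ultimately show ?thesis by simp
  qed
  have "(\<Sum>j=1..q. \<Sum>d<K + of_bool (j = H). elementary_coeff H K j d * \<phi> j d t) =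
      (\<Sum>j=1..q. (\<Sum>d<K. elementary_coeff H K j d * \<phi> j d t) +
         (if j = H then elementary_coeff H K H K * \<phi> H K t else 0))"
    by (intro sum.cong) auto
  also have "\<dots> = (\<Sum>d<K. \<Sum>j=1..q. elementary_coeff H K j d * \<phi> j d t) + V K * F K / (t + x + 1)"
    using H by (subst sum.swap) (simp add: sum.distrib last)
  also have "(\<Sum>d<K. \<Sum>j=1..q. elementary_coeff H K j d * \<phi> j d t) =
      (\<Sum>d<K. V d * F d - V (Suc d) * F (Suc d)) / (t + x + 1)"
    unfolding sum_divide_distrib by (intro sum.cong refl step) simp
  also have "(\<Sum>d<K. V d * F d - V (Suc d) * F (Suc d)) = 1 - V K * F K"
    by (subst sum_lessThan_telescope') (simp add: V_def F_def)
  finally show ?thesis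
    by (simp add: x_def diff_divide_distrib algebra_simps)
qed

end

section \<open>The transform of B\<close>

lemma prod_Sigma_remove:
  fixes f :: "nat \<Rightarrow> nat \<Rightarrow> 'a::comm_monoid_mult"
  assumes "finite I" "H \<in> I" "K < N H"
  shows "(\<Prod>(h, s)\<in>Sigma I (\<lambda>h. {..<N h}) - {(H, K)}. f h s) =
    (\<Prod>h\<in>I - {H}. \<Prod>s<N h. f h s) * (\<Prod>s\<in>{..<N H} - {K}. f H s)"
proof -
  have "Sigma I (\<lambda>h. {..<N h}) - {(H, K)} = Sigma I (\<lambda>h. {..<N h} - (if h = H then {K} else {}))"
    by (auto split: if_splits)
  then have "(\<Prod>(h, s)\<in>Sigma I (\<lambda>h. {..<N h}) - {(H, K)}. f h s) =
      (\<Prod>h\<in>I. \<Prod>s\<in>{..<N h} - (if h = H then {K} else {}). f h s)"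
    using assms(1) by (simp add: prod.Sigma)
  also have "\<dots> = (\<Prod>s\<in>{..<N H} - {K}. f H s) * (\<Prod>h\<in>I - {H}. \<Prod>s<N h. f h s)"
    using assms by (subst prod.remove[of _ H]) (auto intro!: prod.cong)
  finally show ?thesis by (simp add: mult.commute)
qed

lemma prod_lessThan_diff:
  fixes K N :: nat
  assumes "K < N"
  shows "(\<Prod>s\<in>{..<N} - {K}. of_nat s - of_nat K :: complex) = (-1) ^ K * fact K * fact (N - K - 1)"
proof -
  have split: "{..<N} - {K} = {..<K} \<union> {Suc K..<N}" using assms by auto
  have "(\<Prod>s\<in>{..<N} - {K}. of_nat s - of_nat K :: complex) =
      (\<Prod>s<K. of_nat s - of_nat K) * (\<Prod>s\<in>{Suc K..<N}. of_nat s - of_nat K)"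
    unfolding split by (rule prod.union_disjoint) auto
  also have "(\<Prod>s<K. of_nat s - of_nat K :: complex) = (-1) ^ K * fact K"
    using pochhammer_same[of K, where ?'a = complex] by (simp add: pochhammer_prod_lessThan)
  also have "(\<Prod>s\<in>{Suc K..<N}. of_nat s - of_nat K :: complex) = (\<Prod>s<N - K - 1. 1 + of_nat s)"
    by (rule prod.reindex_bij_witness[of _ "\<lambda>s. s + Suc K" "\<lambda>s. s - Suc K"]) (auto simp: of_nat_diff)
  also have "\<dots> = fact (N - K - 1)"
    by (simp add: pochhammer_fact pochhammer_prod_lessThan)
  finally show ?thesis by simp
qed

lemma sum_int_atLeastAtMost_nat:
  "(\<Sum>K=1..M - 1. f K) = (\<Sum>k\<in>{1..<nat M}. f (int k))"
  "(\<Sum>K=0..M - 1. f K) = (\<Sum>k<nat M. f (int k))"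
  by (rule sum.reindex_bij_witness[of _ int nat]; auto)+

lemma sum_swap_outer:
  "(\<Sum>j\<in>A. \<Sum>d\<in>B. \<Sum>H\<in>C. f j d H) = (\<Sum>H\<in>C. \<Sum>j\<in>A. \<Sum>d\<in>B. f j d H)"
proof -
  have "(\<Sum>j\<in>A. \<Sum>d\<in>B. \<Sum>H\<in>C. f j d H) = (\<Sum>j\<in>A. \<Sum>H\<in>C. \<Sum>d\<in>B. f j d H)"
    by (intro sum.cong refl sum.swap)
  also have "\<dots> = (\<Sum>H\<in>C. \<Sum>j\<in>A. \<Sum>d\<in>B. f j d H)"
    by (rule sum.swap)
  finally show ?thesis .
qed

lemma sum_swap_dependent:
  "(\<Sum>j\<in>A. \<Sum>d\<in>B. \<Sum>H\<in>C. \<Sum>K\<in>D H. f j d H K) = (\<Sum>H\<in>C. \<Sum>K\<in>D H. \<Sum>j\<in>A. \<Sum>d\<in>B. f j d H K)"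
  by (rule trans[OF sum_swap_outer]) (intro sum.cong refl sum_swap_outer)

text \<open>For the last claim: if \<open>a \<rho> = b h + k\<close> with \<open>k < m h\<close>,
  then \<open>a \<rho> - b h - m h + 1\<close> would be the nonpositive integer
  \<open>k - m h + 1\<close>.\<close>

lemma admissible_pairD:
  assumes "admissible_pair p q r a b \<kappa> n m"
  shows "\<And>i. i \<in> {1..p} \<Longrightarrow> 0 \<le> n i"
    and "\<And>h. h \<in> {1..q} \<Longrightarrow> 0 \<le> m h"
    and "\<And>g h. g \<in> {1..q} \<Longrightarrow> h \<in> {1..q} \<Longrightarrow> m g \<le> m h + 1"
    and "\<And>\<rho> h k. \<rho> \<in> {1..r} \<Longrightarrow> h \<in> {1..q} \<Longrightarrow> int k < m h \<Longrightarrow> a \<rho> \<noteq> b h + of_nat k"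
proof -
  note A = assms[unfolded admissible_pair_def nonneg_idx_def is_near_diag_def near_diag_def mem_Collect_eq]
  show "0 \<le> n i" if "i \<in> {1..p}" for i using A that by blast
  show "0 \<le> m h" if "h \<in> {1..q}" for h using A that by blast
  show "m g \<le> m h + 1" if "g \<in> {1..q}" "h \<in> {1..q}" for g h
    using A that by (fastforce dest: bspec)
  show "a \<rho> \<noteq> b h + of_nat k" if "\<rho> \<in> {1..r}" "h \<in> {1..q}" "int k < m h" for \<rho> h k
  proof
    assume "a \<rho> = b h + of_nat k"
    then have "a \<rho> - b h - of_int (m h) + 1 = of_int (int k - m h + 1)" by simp
    moreover have "int k - m h + 1 \<le> 0" using that by simp
    ultimately have "a \<rho> - b h - of_int (m h) + 1 \<in> \<int>\<^sub>\<le>\<^sub>0" by (metis nonpos_Ints_of_int)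
    moreover have "m h \<ge> 1" using that by simp
    ultimately show False using A that unfolding admissible_params_def by blast
  qed
qed

context hypergeometric_system
begin

lemma elementary_coeff_0:
  assumes "H \<in> {1..q}" "\<And>\<rho>. \<rho> \<in> {1..r} \<Longrightarrow> a \<rho> \<noteq> b H"
  shows "elementary_coeff H 0 H 0 = 1"
proof -
  have "(\<Prod>\<rho>=1..r. a \<rho> - b H) \<noteq> 0" "(\<Prod>h\<in>{1..q} - {H}. b h - b H) \<noteq> 0"
    using assms b_neq[of _ H 0] by auto
  then show ?thesis by (simp add: elementary_coeff_def residue_b_def)
qed

text \<open>The isolated constant in the definition of B is the term \<open>H = j\<close>,
  \<open>K = 0\<close> of a uniform double sum, because \<open>elementary_coeff j 0 j 0 = 1\<close>.
  Thus B is a combination of elementary row vectors with coefficients \<open>B_pi\<close>, scaled by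
  \<open>B_nu\<close>.\<close>

lemma coeff_B_poly:
  assumes ad: "admissible_pair p q r a b \<kappa> n m" and j: "j \<in> {1..q}"
  shows "coeff (B_poly p q r a b \<kappa> n m j) d = B_nu p q r a b \<kappa> n m *
    (\<Sum>H=1..q. \<Sum>K<nat (m H). B_pi p q b \<kappa> n m H (int K) *
       (if d < K + of_bool (j = H) then elementary_coeff H K j d else 0))"
proof (cases "m j = 0")
  case True
  have "(\<Sum>K<nat (m H). B_pi p q b \<kappa> n m H (int K) *
       (if d < K + of_bool (j = H) then elementary_coeff H K j d else 0)) = 0" if "H \<in> {1..q}" for H
  proof (cases "H = j")
    case False
    have "m H \<le> 1" using admissible_pairD(3)[OF ad that j] True by simp
    then show ?thesis using False by (intro sum.neutral) auto
  qed (simp add: True)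
  then show ?thesis using True by (simp add: B_poly_def)
next
  case False
  then have mj: "0 < nat (m j)" using admissible_pairD(2)[OF ad j] by simp
  define \<pi> where "\<pi> H K = B_pi p q b \<kappa> n m H (int K)" for H K
  have inner: "coeff (\<Sum>d'=0..K - 1 + of_bool (j = H). monom (c d') (nat d')) d =
      (if d < nat K + of_bool (j = H) then c (int d) else 0)" if "1 \<le> K" for K :: int and H and c :: "int \<Rightarrow> complex"
  proof -
    have "coeff (\<Sum>d'=0..K - 1 + of_bool (j = H). monom (c d') (nat d')) d =
        (\<Sum>d'=0..K - 1 + of_bool (j = H). if d' = int d then c (int d) else 0)"
      unfolding coeff_sum by (intro sum.cong) auto
    also have "\<dots> = (if d < nat K + of_bool (j = H) then c (int d) else 0)"
      using that by (subst sum.delta) auto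
    finally show ?thesis .
  qed
  \<comment> \<open>The separate first factors of the formula are absorbed by
    \<open>pochhammer_rec\<close>; only component \<open>j\<close>, shifted back by one, keeps the
    shorter symbol starting at \<open>b j - x\<close>.\<close>
  have e: "vpoch {1..r} (\<lambda>\<rho>. a \<rho> - b j) (\<lambda>_. 1) / vpoch ({1..q} - {j}) (\<lambda>h. b h - b j) (\<lambda>_. 1) *
      (vpoch ({1..q} - {j}) (\<lambda>h. b h - (b H + of_int K)) (\<lambda>_. 1) / vpoch {1..r} (\<lambda>\<rho>. a \<rho> - (b H + of_int K)) (\<lambda>_. 1) *
      (if c then vpoch {1..q} (\<lambda>h. b h - (b H + of_int K) + 1 - of_bool (h = j)) (\<lambda>_. int d) /
       vpoch {1..r} (\<lambda>\<rho>. a \<rho> - (b H + of_int K) + 1) (\<lambda>_. int d) else 0)) =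
      (if c then elementary_coeff H (nat K) j d else 0)"
    if K: "1 \<le> K" for H K c
  proof -
    define x where "x = b H + of_int K"
    have x: "b H + of_nat (nat K) = x" using K by (simp add: x_def)
    have "(\<Prod>h=1..q. pochhammer (b h - x + 1 - of_bool (h = j)) d) =
        pochhammer (b j - x) d * (\<Prod>h\<in>{1..q} - {j}. pochhammer (b h - x + 1) d)"
      using j by (subst prod.remove[of _ j]) auto
    then have "vpoch {1..r} (\<lambda>\<rho>. a \<rho> - b j) (\<lambda>_. 1) / vpoch ({1..q} - {j}) (\<lambda>h. b h - b j) (\<lambda>_. 1) *
      (vpoch ({1..q} - {j}) (\<lambda>h. b h - (b H + of_int K)) (\<lambda>_. 1) / vpoch {1..r} (\<lambda>\<rho>. a \<rho> - (b H + of_int K)) (\<lambda>_. 1) *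
      (vpoch {1..q} (\<lambda>h. b h - (b H + of_int K) + 1 - of_bool (h = j)) (\<lambda>_. int d) /
       vpoch {1..r} (\<lambda>\<rho>. a \<rho> - (b H + of_int K) + 1) (\<lambda>_. int d))) = elementary_coeff H (nat K) j d"
      by (simp add: vpoch_def elementary_coeff_def residue_b_def x x_def[symmetric] pochhammer_rec prod.distrib
          poch_nonneg mult_ac)
    then show ?thesis by (cases c) (simp_all only: if_True if_False mult_zero_right)
  qed
  have expand: "coeff (smult \<nu> ([:c:] + smult s1 (\<Sum>H\<in>A. \<Sum>K\<in>D H. smult (f H K * s2 H K) (G H K)))) d =
      \<nu> * ((if d = 0 then c else 0) + (\<Sum>H\<in>A. \<Sum>K\<in>D H. f H K * (s1 * (s2 H K * coeff (G H K) d))))"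
    for \<nu> c s1 :: complex and A :: "nat set" and D :: "nat \<Rightarrow> int set" and f s2 G
    by (simp add: coeff_sum sum_distrib_left coeff_pCons mult_ac split: nat.split)
  have "coeff (B_poly p q r a b \<kappa> n m j) d = B_nu p q r a b \<kappa> n m *
     ((if d = 0 then \<pi> j 0 else 0) +
       (\<Sum>H=1..q. \<Sum>K=1..m H - 1. B_pi p q b \<kappa> n m H K *
         (if d < nat K + of_bool (j = H) then elementary_coeff H (nat K) j d else 0)))"
    unfolding B_poly_def if_not_P[OF False] expand
    by (intro arg_cong2[of _ _ _ _ "(*)"] arg_cong2[of _ _ _ _ "(+)"] refl sum.cong)
       (simp_all only: inner e atLeastAtMost_iff \<pi>_def of_nat_0)
  also have "\<dots> = B_nu p q r a b \<kappa> n m *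
     ((if d = 0 then \<pi> j 0 else 0) +
       (\<Sum>H=1..q. \<Sum>K\<in>{1..<nat (m H)}. \<pi> H K *
         (if d < K + of_bool (j = H) then elementary_coeff H K j d else 0)))"
    by (simp only: sum_int_atLeastAtMost_nat(1) \<pi>_def nat_int)
  also have "(if d = 0 then \<pi> j 0 else 0) = (\<Sum>H=1..q. if H = j \<and> d = 0 then \<pi> j 0 else 0)"
    using j by simp
  also have "\<dots> + (\<Sum>H=1..q. \<Sum>K\<in>{1..<nat (m H)}. \<pi> H K *
         (if d < K + of_bool (j = H) then elementary_coeff H K j d else 0)) =
      (\<Sum>H=1..q. \<Sum>K<nat (m H). \<pi> H K *
         (if d < K + of_bool (j = H) then elementary_coeff H K j d else 0))"
    unfolding sum.distrib[symmetric]
  proof (intro sum.cong refl)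
    fix H assume H: "H \<in> {1..q}"
    have "\<pi> H 0 * (if d < 0 + of_bool (j = H) then elementary_coeff H 0 j d else 0) =
        (if H = j \<and> d = 0 then \<pi> j 0 else 0)"
      using elementary_coeff_0[OF j] admissible_pairD(4)[OF ad _ j, of _ 0] mj by auto
    moreover have "{..<nat (m H)} = insert 0 {1..<nat (m H)}" if "0 < nat (m H)"
      using that by auto
    moreover have "H \<noteq> j" if "\<not> 0 < nat (m H)" using that mj by auto
    ultimately show "(if H = j \<and> d = 0 then \<pi> j 0 else 0) + (\<Sum>K\<in>{1..<nat (m H)}. \<pi> H K *
         (if d < K + of_bool (j = H) then elementary_coeff H K j d else 0)) =
        (\<Sum>K<nat (m H). \<pi> H K * (if d < K + of_bool (j = H) then elementary_coeff H K j d else 0))"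
      by (cases "0 < nat (m H)") auto
  qed
  finally show ?thesis by (simp add: \<pi>_def)
qed

text \<open>A summand has exponents at most \<open>K \<le> m j - 1\<close> if \<open>H = j\<close>,
  and below \<open>K \<le> m H - 1 \<le> m j\<close> otherwise; the last inequality is
  near-diagonality.\<close>

lemma coeff_B_poly_eq_0:
  assumes ad: "admissible_pair p q r a b \<kappa> n m" and j: "j \<in> {1..q}" and d: "nat (m j) \<le> d"
  shows "coeff (B_poly p q r a b \<kappa> n m j) d = 0"
proof -
  have "\<not> d < K + of_bool (j = H)" if "H \<in> {1..q}" "K < nat (m H)" for H K
    using admissible_pairD(3)[OF ad that(1) j] that(2) d by (cases "j = H") auto
  then show ?thesis by (simp add: coeff_B_poly[OF ad j])
qed

lemma inj_on_b_nodes: "inj_on (\<lambda>(H, K). - (b H + of_nat K + 1)) (Sigma {1..q} A)"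
proof (rule inj_onI, clarify)
  fix H K H' K'
  assume "H \<in> {1..q}" "H' \<in> {1..q}" and eq: "- (b H + of_nat K + 1) = - (b H' + of_nat K' + 1)"
  then have "H = H'"
    using b_neq[of H H' "int K' - int K"] by (auto simp: algebra_simps)
  with eq show "H = H' \<and> K = K'" by simp
qed

text \<open>\<open>B_pi\<close> is minus the residue of the displayed fraction at its simple pole
  \<open>- (b H + K + 1)\<close>. The fraction is proper because its numerator has degree
  \<open>|n| = |m| - 1\<close>.\<close>

lemma sum_B_pi:
  assumes ad: "admissible_pair p q r a b \<kappa> n m" and size: "idx_size q m = idx_size p n + 1"
    and t: "\<And>h. h \<in> {1..q} \<Longrightarrow> t + b h + 1 \<notin> \<int>\<^sub>\<le>\<^sub>0"
  shows "(\<Sum>H=1..q. \<Sum>K<nat (m H). B_pi p q b \<kappa> n m H (int K) / (t + b H + of_nat K + 1)) =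
    - ((\<Prod>i=1..p. pochhammer (\<kappa> i - t) (nat (n i))) / (\<Prod>h=1..q. pochhammer (t + b h + 1) (nat (m h))))"
proof -
  define I where "I = Sigma {1..q} (\<lambda>h. {..<nat (m h)})"
  define x where "x = (\<lambda>(H, K). - (b H + of_nat K + 1))"
  define P where "P = (\<Prod>i=1..p. \<Prod>l<nat (n i). [:\<kappa> i + of_nat l, -1:])"
  have poly_P: "poly P s = (\<Prod>i=1..p. pochhammer (\<kappa> i - s) (nat (n i)))" for s
    by (simp add: P_def poly_prod pochhammer_prod_lessThan algebra_simps)
  have "degree P = (\<Sum>i=1..p. nat (n i))"
    unfolding P_def by (simp add: degree_prod_sum_eq)
  also have "int \<dots> = idx_size p n"
    using admissible_pairD(1)[OF ad] by (simp add: idx_size_def)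
  finally have "int (degree P) < idx_size q m" using size by simp
  moreover have "idx_size q m = int (card I)"
    using admissible_pairD(2)[OF ad] by (simp add: idx_size_def I_def)
  ultimately have deg: "degree P < card I" by simp
  have tx: "t \<noteq> x k" if "k \<in> I" for k
    using add_of_nat_notin_nonpos_Ints[OF t, of "fst k" "snd k"] that
    by (auto simp: I_def x_def algebra_simps)
  have inj: "inj_on x I" using inj_on_b_nodes by (simp add: I_def x_def)
  have "(\<Prod>h=1..q. pochhammer (t + b h + 1) (nat (m h))) = (\<Prod>k\<in>I. t - x k)"
    by (simp add: I_def x_def prod.Sigma pochhammer_prod_lessThan split_def algebra_simps)
  then have "(\<Prod>i=1..p. pochhammer (\<kappa> i - t) (nat (n i))) / (\<Prod>h=1..q. pochhammer (t + b h + 1) (nat (m h))) =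
      (\<Sum>k\<in>I. poly P (x k) / (\<Prod>j\<in>I - {k}. x k - x j) / (t - x k))"
    unfolding poly_P[symmetric] using partial_fractions_simple[OF _ inj deg, of t] tx by (simp add: I_def)
  also have "\<dots> = (\<Sum>(H, K)\<in>I. - B_pi p q b \<kappa> n m H (int K) / (t + b H + of_nat K + 1))"
  proof (intro sum.cong refl, clarify)
    fix H K assume HK: "(H, K) \<in> I"
    then have H: "H \<in> {1..q}" and K: "K < nat (m H)" by (auto simp: I_def)
    have "(\<Prod>j\<in>I - {(H, K)}. x (H, K) - x j) = (\<Prod>(h, s)\<in>I - {(H, K)}. (b h - b H - of_nat K) + of_nat s)"
      by (intro prod.cong) (auto simp: x_def)
    also have "\<dots> = (\<Prod>h\<in>{1..q} - {H}. \<Prod>s<nat (m h). (b h - b H - of_nat K) + of_nat s) *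
        (\<Prod>s\<in>{..<nat (m H)} - {K}. of_nat s - of_nat K)"
      using H K by (simp add: I_def prod_Sigma_remove algebra_simps)
    also have "\<dots> = (-1) ^ K * fact K * fact (nat (m H) - K - 1) *
        (\<Prod>h\<in>{1..q} - {H}. poch (b h - b H - of_nat K) (m h))"
      using K admissible_pairD(2)[OF ad]
      by (simp add: prod_lessThan_diff pochhammer_prod_lessThan[symmetric] poch_nonneg mult.commute)
    finally have "(\<Prod>j\<in>I - {(H, K)}. x (H, K) - x j) = (-1) powi (int K) * ifact (int K) * ifact (m H - int K - 1) *
        (\<Prod>h\<in>{1..q} - {H}. poch (b h - b H - of_int (int K)) (m h))"
      using K by (simp add: ifact_def nat_diff_distrib)
    moreover have "poly P (x (H, K)) = (\<Prod>i=1..p. poch (\<kappa> i + b H + of_int (int K) + 1) (n i))"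
      using admissible_pairD(1)[OF ad] by (simp add: poly_P x_def poch_nonneg algebra_simps)
    ultimately show "poly P (x (H, K)) / (\<Prod>j\<in>I - {(H, K)}. x (H, K) - x j) / (t - x (H, K)) =
        - B_pi p q b \<kappa> n m H (int K) / (t + b H + of_nat K + 1)"
      unfolding B_pi_def by (simp only: x_def prod.case minus_minus diff_minus_eq_add add.assoc)
  qed
  also have "\<dots> = (\<Sum>H=1..q. \<Sum>K<nat (m H). - B_pi p q b \<kappa> n m H (int K) / (t + b H + of_nat K + 1))"
    by (simp add: I_def sum.Sigma)
  finally show ?thesis by (simp add: sum_negf)
qed

lemma transform_B_vec:
  assumes ad: "admissible_pair p q r a b \<kappa> n m" and size: "idx_size q m = idx_size p n + 1"
    and t: "\<And>h. h \<in> {1..q} \<Longrightarrow> t + b h + 1 \<notin> \<int>\<^sub>\<le>\<^sub>0"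
  shows "transform (B_vec p q r a b \<kappa> n m) t = - B_nu p q r a b \<kappa> n m *
    (\<Prod>i=1..p. pochhammer (\<kappa> i - t) (nat (n i))) / (\<Prod>h=1..q. pochhammer (t + b h + 1) (nat (m h)))"
proof -
  define \<nu> where "\<nu> = B_nu p q r a b \<kappa> n m"
  define \<pi> where "\<pi> H K = B_pi p q b \<kappa> n m H (int K)" for H K
  \<comment> \<open>A cutoff above all degrees, independent of \<open>j\<close>, so that the sums
    over \<open>j\<close> and \<open>d\<close> can be moved inside those over \<open>H\<close> and
    \<open>K\<close>.\<close>
  define N where "N = (\<Sum>H=1..q. nat (m H)) + 1"
  have N: "nat (m H) < N" if "H \<in> {1..q}" for H
    unfolding N_def using member_le_sum[OF that, of "\<lambda>H. nat (m H)"] by simp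
  have "transform (B_vec p q r a b \<kappa> n m) t =
      (\<Sum>j=1..q. \<Sum>d<N. coeff (B_poly p q r a b \<kappa> n m j) d * \<phi> j d t)"
    unfolding transform_def
  proof (intro sum.cong refl)
    fix j assume j: "j \<in> {1..q}"
    then have "coeff (B_poly p q r a b \<kappa> n m j) d = 0" if "N \<le> d" for d
      using coeff_B_poly_eq_0[OF ad j, of d] that N[OF j] by simp
    then show "coeff_functional (\<lambda>d. \<phi> j d t) (B_vec p q r a b \<kappa> n m j) =
        (\<Sum>d<N. coeff (B_poly p q r a b \<kappa> n m j) d * \<phi> j d t)"
      using j by (simp add: B_vec_def coeff_functional_lessThan)
  qed
  also have "\<dots> = (\<Sum>j=1..q. \<Sum>d<N. \<Sum>H=1..q. \<Sum>K<nat (m H). \<nu> * \<pi> H K *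
      ((if d < K + of_bool (j = H) then elementary_coeff H K j d else 0) * \<phi> j d t))"
    by (simp add: coeff_B_poly[OF ad] \<nu>_def \<pi>_def sum_distrib_left sum_distrib_right mult.assoc)
  also have "\<dots> = (\<Sum>H=1..q. \<Sum>K<nat (m H). \<Sum>j=1..q. \<Sum>d<N. \<nu> * \<pi> H K *
      ((if d < K + of_bool (j = H) then elementary_coeff H K j d else 0) * \<phi> j d t))"
    by (rule sum_swap_dependent)
  also have "\<dots> = (\<Sum>H=1..q. \<Sum>K<nat (m H). \<nu> * (\<pi> H K / (t + b H + of_nat K + 1)))"
  proof (intro sum.cong refl)
    fix H K assume H: "H \<in> {1..q}" and K: "K \<in> {..<nat (m H)}"
    have "(\<Sum>j=1..q. \<Sum>d<N. (if d < K + of_bool (j = H) then elementary_coeff H K j d else 0) * \<phi> j d t) =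
        (\<Sum>j=1..q. \<Sum>d<K + of_bool (j = H). elementary_coeff H K j d * \<phi> j d t)"
      using N[OF H] K by (intro sum.cong refl sum.mono_neutral_cong_right) (auto split: if_splits)
    also have "\<dots> = 1 / (t + b H + of_nat K + 1)"
      using admissible_pairD(4)[OF ad _ H] K by (intro sum_elementary_coeff[OF H _ t]) auto
    finally show "(\<Sum>j=1..q. \<Sum>d<N. \<nu> * \<pi> H K *
      ((if d < K + of_bool (j = H) then elementary_coeff H K j d else 0) * \<phi> j d t)) = \<nu> * (\<pi> H K / (t + b H + of_nat K + 1))"
      by (simp add: sum_distrib_left[symmetric])
  qed
  also have "\<dots> = \<nu> * (\<Sum>H=1..q. \<Sum>K<nat (m H). \<pi> H K / (t + b H + of_nat K + 1))"
    by (simp add: sum_distrib_left)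
  finally show ?thesis
    using sum_B_pi[OF ad size t] by (simp add: \<pi>_def \<nu>_def)
qed

text \<open>The orthogonality relations of B: at \<open>t = \<kappa> i + l\<close> the numerator
  contains the Pochhammer symbol of \<open>- l\<close> with subscript \<open>n i > l\<close>, which
  is zero.\<close>

lemma transform_B_vec_node_eq_0:
  assumes ad: "admissible_pair p q r a b \<kappa> n m" and size: "idx_size q m = idx_size p n + 1"
    and i: "i \<in> {1..p}" and l: "int l < n i"
  shows "transform (B_vec p q r a b \<kappa> n m) (\<kappa> i + of_nat l) = 0"
proof -
  have "pochhammer (\<kappa> i - (\<kappa> i + of_nat l)) (nat (n i)) = 0"
    using l by (auto simp: pochhammer_eq_0_iff)
  then have "(\<Prod>i'=1..p. pochhammer (\<kappa> i' - (\<kappa> i + of_nat l)) (nat (n i'))) = 0"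
    using i by (intro prod_zero bexI[of _ i]) auto
  then show ?thesis
    using transform_B_vec[OF ad size, of "\<kappa> i + of_nat l"] \<kappa>_b_shift[OF i] by simp
qed

end

section \<open>Test functionals\<close>

lemma pochhammer_minus_of_nat:
  assumes "k \<le> n"
  shows "pochhammer (- of_nat n :: complex) k = (-1) ^ k * fact n / fact (n - k)"
proof -
  have "fact n = (fact (n - k) * pochhammer (1 + of_nat (n - k)) k :: complex)"
    using pochhammer_product[of "n - k" n "1 :: complex"] assms by (simp add: pochhammer_fact)
  moreover have "pochhammer (- of_nat n :: complex) k = (-1) ^ k * pochhammer (1 + of_nat (n - k)) k"
    using assms by (simp add: pochhammer_minus of_nat_diff algebra_simps)
  ultimately show ?thesis by simp
qed

lemma minus_one_powi_cong:
  assumes "even (m - n)"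
  shows "(-1 :: 'a::field) powi m = (-1) powi n"
proof -
  obtain k where "m - n = 2 * k" using assms by (rule evenE)
  then have "m = n + 2 * k" by simp
  then show ?thesis by (simp add: power_int_add power_int_mult)
qed

lemma inverse_minus_one_powi: "inverse ((-1 :: 'a::field) powi m) = (-1) powi m"
  by (metis power_int_minus minus_one_powi_cong dvd_minus_iff minus_diff_eq mult_2 even_add diff_minus_eq_add)

lemma poch_1 [simp]: "poch x 1 = x"
  by (simp add: poch_def)

lemma prod_lessThan_reflect_pochhammer:
  fixes x :: complex
  shows "(\<Prod>s<n. x - of_nat s) = pochhammer (x - of_nat n + 1) n"
  unfolding pochhammer_prod_lessThan
  by (subst prod.nat_diff_reindex[symmetric], rule prod.cong) (auto simp: of_nat_diff)

context hypergeometric_system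
begin

definition denominator_b :: "(nat \<Rightarrow> int) \<Rightarrow> complex \<Rightarrow> complex" where
  "denominator_b M t = (\<Prod>h=1..q. pochhammer (t + b h + 1) (nat (M h)))"

definition nodes :: "(nat \<Rightarrow> int) \<Rightarrow> (nat \<times> nat) set" where
  "nodes lam = Sigma {1..p} (\<lambda>i. {..<nat (lam i)})"

definition node :: "nat \<times> nat \<Rightarrow> complex" where
  "node k = \<kappa> (fst k) + of_nat (snd k)"

text \<open>Up to a factor depending only on the index pair, this is
  \<open>moment_scale i \<alpha>\<close> times the coefficient of \<open>z ^ \<alpha>\<close> in the
  \<open>i\<close>-th component of A with index \<open>(lam, \<eta>)\<close>.\<close>

definition node_weight :: "(nat \<Rightarrow> int) \<Rightarrow> (nat \<Rightarrow> int) \<Rightarrow> nat \<times> nat \<Rightarrow> complex" where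
  "node_weight lam \<eta> k = denominator_b \<eta> (node k) / (\<Prod>k'\<in>nodes lam - {k}. node k - node k')"

text \<open>
  Up to a scalar, pairing with \<open>A\<close> of index \<open>(lam, \<eta>)\<close>: the residue of
  \<open>denominator_b \<eta> t * transform Q t / (\<Prod>k. t - node k)\<close> summed over all nodes.
\<close>
definition test_functional :: "(nat \<Rightarrow> int) \<Rightarrow> (nat \<Rightarrow> int) \<Rightarrow> (nat \<Rightarrow> complex poly) \<Rightarrow> complex" where
  "test_functional lam \<eta> Q = (\<Sum>k\<in>nodes lam. node_weight lam \<eta> k * transform Q (node k))"

lemma finite_nodes [simp]: "finite (nodes lam)"
  by (simp add: nodes_def)

lemma inj_on_node: "inj_on node (nodes lam)"
proof (rule inj_onI)
  fix k k' assume k: "k \<in> nodes lam" "k' \<in> nodes lam" "node k = node k'"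
  then have "\<kappa> (fst k) - \<kappa> (fst k') = of_int (int (snd k') - int (snd k))"
    by (simp add: node_def algebra_simps)
  then have "\<kappa> (fst k) - \<kappa> (fst k') \<in> \<int>" by (metis Ints_of_int)
  moreover have "fst k \<in> {1..p}" "fst k' \<in> {1..p}" using k by (auto simp: nodes_def)
  ultimately have "fst k = fst k'" using \<kappa>_diff_notin_Ints by blast
  with k show "k = k'" by (simp add: node_def prod_eq_iff)
qed

lemma node_b: "k \<in> nodes lam \<Longrightarrow> h \<in> {1..q} \<Longrightarrow> node k + b h + 1 \<notin> \<int>\<^sub>\<le>\<^sub>0"
  using \<kappa>_b_shift[of "fst k" h "snd k"] by (auto simp: nodes_def node_def)

lemma transform_add: "transform (P + Q) t = transform P t + transform Q t"
  by (simp add: transform_def coeff_functional_add sum.distrib)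

lemma transform_row_scale: "transform (row_scale c Q) t = c * transform Q t"
  by (simp add: transform_def row_scale_def coeff_functional_smult sum_distrib_left)

lemma transform_0 [simp]: "transform 0 t = 0"
  by (simp add: transform_def)

lemma test_functional_add: "test_functional lam \<eta> (P + Q) = test_functional lam \<eta> P + test_functional lam \<eta> Q"
  by (simp add: test_functional_def transform_add sum.distrib algebra_simps)

lemma test_functional_row_scale: "test_functional lam \<eta> (row_scale c Q) = c * test_functional lam \<eta> Q"
  by (simp add: test_functional_def transform_row_scale sum_distrib_left mult_ac)

text \<open>Differences within column \<open>i\<close> give two factorials, with one minus sign for
  each node beyond \<open>\<alpha>\<close>. Differences to another column descend in steps of one
  and form a Pochhammer symbol read backwards.\<close>

lemma node_denominator:
  assumes i: "i \<in> {1..p}" and \<alpha>: "\<alpha> < nat (lam i)" and lam: "\<And>i. i \<in> {1..p} \<Longrightarrow> 0 \<le> lam i"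
  shows "(\<Prod>k'\<in>nodes lam - {(i, \<alpha>)}. node (i, \<alpha>) - node k') =
    (-1) powi (lam i - 1 - int \<alpha>) * (ifact (int \<alpha>) * ifact (lam i - 1 - int \<alpha>) *
      vpoch ({1..p} - {i}) (\<lambda>l. \<kappa> i - \<kappa> l - of_int (lam l) + of_int (int \<alpha> + 1)) lam)"
proof -
  have "(\<Prod>k'\<in>nodes lam - {(i, \<alpha>)}. node (i, \<alpha>) - node k') =
      (\<Prod>(l, s)\<in>nodes lam - {(i, \<alpha>)}. \<kappa> i + of_nat \<alpha> - \<kappa> l - of_nat s)"
    by (intro prod.cong) (auto simp: node_def)
  also have "\<dots> = (\<Prod>l\<in>{1..p} - {i}. \<Prod>s<nat (lam l). \<kappa> i + of_nat \<alpha> - \<kappa> l - of_nat s) *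
      (\<Prod>s\<in>{..<nat (lam i)} - {\<alpha>}. of_nat \<alpha> - of_nat s)"
    using i \<alpha> by (simp add: nodes_def prod_Sigma_remove)
  also have "(\<Prod>l\<in>{1..p} - {i}. \<Prod>s<nat (lam l). \<kappa> i + of_nat \<alpha> - \<kappa> l - of_nat s) =
      vpoch ({1..p} - {i}) (\<lambda>l. \<kappa> i - \<kappa> l - of_int (lam l) + of_int (int \<alpha> + 1)) lam"
    unfolding vpoch_def prod_lessThan_reflect_pochhammer
    using lam by (intro prod.cong) (auto simp: poch_nonneg algebra_simps)
  also have "(\<Prod>s\<in>{..<nat (lam i)} - {\<alpha>}. of_nat \<alpha> - of_nat s :: complex) =
      (\<Prod>s\<in>{..<nat (lam i)} - {\<alpha>}. (-1) * (of_nat s - of_nat \<alpha>))"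
    by (intro prod.cong) auto
  also have "\<dots> = (-1) ^ (nat (lam i) - 1) * ((-1) ^ \<alpha> * fact \<alpha> * fact (nat (lam i) - \<alpha> - 1))"
    using \<alpha> by (subst prod.distrib) (simp add: prod_lessThan_diff)
  also have "\<dots> = (-1) powi (lam i - 1 - int \<alpha>) * (ifact (int \<alpha>) * ifact (lam i - 1 - int \<alpha>))"
  proof -
    have "(-1 :: complex) ^ (nat (lam i) - 1) * (-1) ^ \<alpha> = (-1) powi (lam i - 1 + int \<alpha>)"
      using \<alpha> by (simp add: power_int_def nat_diff_distrib nat_add_distrib flip: power_add)
    also have "\<dots> = (-1) powi (lam i - 1 - int \<alpha>)"
      by (rule minus_one_powi_cong) simp
    finally have sign: "(-1 :: complex) ^ (nat (lam i) - 1) * (-1) ^ \<alpha> = (-1) powi (lam i - 1 - int \<alpha>)" .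
    have "ifact (lam i - 1 - int \<alpha>) = fact (nat (lam i) - \<alpha> - 1)"
      using \<alpha> by (simp add: ifact_def nat_diff_distrib)
    then show ?thesis unfolding sign[symmetric] by (simp add: ifact_def)
  qed
  finally show ?thesis by (simp add: mult_ac)
qed

text \<open>In component \<open>h\<close> the denominator of \<open>\<phi>\<close> is a Pochhammer
  symbol of length \<open>d + of_bool (h = j)\<close> on the same base, so the quotient is one
  symbol whose subscript may be negative.\<close>

lemma denominator_b_mult_\<phi>:
  assumes t: "\<And>h. h \<in> {1..q} \<Longrightarrow> t + b h + 1 \<notin> \<int>\<^sub>\<le>\<^sub>0" and j: "j \<in> {1..q}"
    and \<eta>: "\<And>h. h \<in> {1..q} \<Longrightarrow> 0 \<le> \<eta> h"
  shows "denominator_b \<eta> t * \<phi> j d t = vpoch {1..r} (\<lambda>\<rho>. t + a \<rho> + 1) (\<lambda>_. int d) *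
    vpoch {1..q} (\<lambda>h. t + b h + of_int (int d + 1) + of_bool (h = j)) (\<lambda>h. \<eta> h - int d - of_bool (h = j))"
proof -
  have "(\<Prod>h=1..q. pochhammer (t + b h + 1) d) * (t + b j + 1 + of_nat d) =
      (\<Prod>h=1..q. pochhammer (t + b h + 1) d * (if h = j then t + b j + 1 + of_nat d else 1))"
    using j by (simp add: prod.distrib)
  also have "\<dots> = (\<Prod>h=1..q. pochhammer (t + b h + 1) (d + of_bool (h = j)))"
    by (intro prod.cong) (auto simp: pochhammer_Suc)
  finally have "denominator_b \<eta> t * \<phi> j d t = (\<Prod>\<rho>=1..r. pochhammer (t + a \<rho> + 1) d) *
      (\<Prod>h=1..q. pochhammer (t + b h + 1) (nat (\<eta> h)) / pochhammer (t + b h + 1) (d + of_bool (h = j)))"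
    by (simp add: denominator_b_def \<phi>_def prod_dividef)
  also have "(\<Prod>h=1..q. pochhammer (t + b h + 1) (nat (\<eta> h)) / pochhammer (t + b h + 1) (d + of_bool (h = j))) =
      vpoch {1..q} (\<lambda>h. t + b h + of_int (int d + 1) + of_bool (h = j)) (\<lambda>h. \<eta> h - int d - of_bool (h = j))"
    unfolding vpoch_def
    by (intro prod.cong refl poch_eq_pochhammer_quotient[symmetric] pochhammer_neq_0_of_notin_nonpos_Ints t)
       (auto simp: \<eta>)
  finally show ?thesis by (simp add: vpoch_def)
qed

text \<open>Brings the product into the form of the first case of \<open>pair_S\<close>. The symbol
  of \<open>b H - x = - K\<close> of length \<open>\<beta>\<close> trades \<open>K!\<close> for
  \<open>(K - \<beta>)!\<close>, and the numerator of \<open>residue_b\<close> is the last factor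
  \<open>a \<rho> - x + K\<close> of the symbol of length \<open>K + 1\<close>.\<close>

lemma elementary_coeff_diag:
  assumes ad: "admissible_pair p q r a b \<kappa> \<nu> \<mu>" and H: "H \<in> {1..q}" and K: "K < nat (\<mu> H)" and \<beta>: "\<beta> \<le> K"
  shows "elementary_coeff H K H \<beta> * inverse (ifact (int K) * (\<Prod>I\<in>{1..q} - {H}. poch (b I - b H - of_int (int K)) (\<mu> I))) =
    (-1) powi int \<beta> * inverse (ifact (int K - int \<beta>)) *
    (vpoch {1..r} (\<lambda>\<rho>. a \<rho> - (b H + of_int (int K)) + of_int (int \<beta> + 1)) (\<lambda>_. int K - int \<beta>) *
      inverse (vpoch {1..r} (\<lambda>\<rho>. a \<rho> - (b H + of_int (int K))) (\<lambda>_. int K))) *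
    inverse (vpoch ({1..q} - {H}) (\<lambda>h. b h - b H) (\<lambda>_. 1) *
      vpoch ({1..q} - {H}) (\<lambda>h. b h - (b H + of_int (int K)) + of_int (int \<beta> + 1)) (\<lambda>h. \<mu> h - (int \<beta> + 1)))"
proof -
  define x where "x = b H + of_nat K"
  have x: "b H + of_int (int K) = x" "b I - b H - of_int (int K) = b I - x" for I by (simp_all add: x_def)
  have poch_ax: "pochhammer (a \<rho> - x) k \<noteq> 0" if "\<rho> \<in> {1..r}" "k \<le> Suc K" for \<rho> k
  proof -
    have "a \<rho> \<noteq> b H + of_nat (K - s)" if "s \<le> K" for s
      using admissible_pairD(4)[OF ad \<open>\<rho> \<in> {1..r}\<close> H, of "K - s"] K that by simp
    then have "a \<rho> - x + of_nat s \<noteq> 0" if "s \<le> K" for s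
      using that by (auto simp: x_def of_nat_diff algebra_simps)
    then show ?thesis using that(2) by (auto simp: pochhammer_prod_lessThan)
  qed
  have poch_bx: "pochhammer (b h - x) k \<noteq> 0" if "h \<in> {1..q} - {H}" for h k
    using pochhammer_b_diff_neq_0[of h H "int K" k] that H by (simp add: x_def)
  have "vpoch {1..r} (\<lambda>\<rho>. a \<rho> - x + of_int (int \<beta> + 1)) (\<lambda>_. int K - int \<beta>) =
      (\<Prod>\<rho>=1..r. pochhammer (a \<rho> - x) (Suc K) / pochhammer (a \<rho> - x) (Suc \<beta>))"
    unfolding vpoch_def using \<beta> by (intro prod.cong refl poch_eq_pochhammer_quotient poch_ax) auto
  also have "\<dots> = (\<Prod>\<rho>=1..r. pochhammer (a \<rho> - x) K) * (\<Prod>\<rho>=1..r. a \<rho> - b H) / (\<Prod>\<rho>=1..r. pochhammer (a \<rho> - x) (Suc \<beta>))"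
    unfolding prod_dividef pochhammer_Suc[of _ K] prod.distrib by (simp add: x_def)
  finally have A: "vpoch {1..r} (\<lambda>\<rho>. a \<rho> - x + of_int (int \<beta> + 1)) (\<lambda>_. int K - int \<beta>) *
      inverse (vpoch {1..r} (\<lambda>\<rho>. a \<rho> - x) (\<lambda>_. int K)) =
      (\<Prod>\<rho>=1..r. a \<rho> - b H) / (\<Prod>\<rho>=1..r. pochhammer (a \<rho> - x) (Suc \<beta>))"
    using poch_ax by (simp add: vpoch_def field_simps)
  have B: "vpoch ({1..q} - {H}) (\<lambda>h. b h - x + of_int (int \<beta> + 1)) (\<lambda>h. \<mu> h - (int \<beta> + 1)) =
      (\<Prod>h\<in>{1..q} - {H}. poch (b h - x) (\<mu> h)) / (\<Prod>h\<in>{1..q} - {H}. pochhammer (b h - x) (Suc \<beta>))"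
    unfolding vpoch_def prod_dividef[symmetric]
    using admissible_pairD(2)[OF ad]
    by (intro prod.cong refl, subst poch_eq_pochhammer_quotient[OF poch_bx[of _ "Suc \<beta>"]]) (auto simp: poch_nonneg)
  have C: "pochhammer (b H - x) \<beta> = (-1) powi int \<beta> * ifact (int K) * inverse (ifact (int K - int \<beta>))"
    using pochhammer_minus_of_nat[OF \<beta>] \<beta> by (simp add: x_def ifact_def nat_diff_distrib divide_inverse)
  have "ifact (int K) \<noteq> 0" by (simp add: ifact_def)
  then show ?thesis
    unfolding x A B elementary_coeff_def x_def[symmetric] residue_b_def C
    by (simp add: vpoch_def divide_inverse mult_ac)
qed

text \<open>The counterpart for the second case of \<open>pair_S\<close>. Now component
  \<open>H\<close> has the longer symbol of length \<open>\<beta> + 1\<close> and component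
  \<open>j\<close> the shorter one, which accounts for \<open>(K - 1 - \<beta>)!\<close> and for the
  shifts by \<open>of_bool (h = j)\<close>.\<close>

lemma elementary_coeff_offdiag:
  assumes ad: "admissible_pair p q r a b \<kappa> \<nu> \<mu>" and H: "H \<in> {1..q}" and j: "j \<in> {1..q}" and Hj: "H \<noteq> j"
    and K: "K < nat (\<mu> H)" and \<beta>: "\<beta> < K"
  shows "elementary_coeff H K j \<beta> * inverse (ifact (int K) * (\<Prod>I\<in>{1..q} - {H}. poch (b I - b H - of_int (int K)) (\<mu> I))) =
    (-1) powi (int \<beta> + 1) * inverse (ifact (int K - 1 - int \<beta>)) *
    (vpoch {1..r} (\<lambda>\<rho>. a \<rho> - b j) (\<lambda>_. 1) *
      inverse (vpoch {1..r} (\<lambda>\<rho>. a \<rho> - (b H + of_int (int K))) (\<lambda>_. int \<beta> + 1))) *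
    inverse (vpoch ({1..q} - {j}) (\<lambda>h. b h - b j) (\<lambda>_. 1) *
      vpoch ({1..q} - {H}) (\<lambda>h. b h - (b H + of_int (int K)) + of_int (int \<beta> + 1) - of_bool (h = j))
        (\<lambda>h. \<mu> h - (int \<beta> + 1) + of_bool (h = j)))"
proof -
  define x where "x = b H + of_nat K"
  have x: "b H + of_int (int K) = x" "b I - b H - of_int (int K) = b I - x" for I by (simp_all add: x_def)
  have poch_bx: "pochhammer (b h - x) k \<noteq> 0" if "h \<in> {1..q} - {H}" for h k
    using pochhammer_b_diff_neq_0[of h H "int K" k] that H by (simp add: x_def)
  have A: "vpoch {1..r} (\<lambda>\<rho>. a \<rho> - x) (\<lambda>_. int \<beta> + 1) = (\<Prod>\<rho>=1..r. pochhammer (a \<rho> - x) (Suc \<beta>))"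
    by (simp add: vpoch_def poch_nonneg nat_add_distrib)
  have B: "vpoch ({1..q} - {H}) (\<lambda>h. b h - x + of_int (int \<beta> + 1) - of_bool (h = j))
        (\<lambda>h. \<mu> h - (int \<beta> + 1) + of_bool (h = j)) =
      (\<Prod>h\<in>{1..q} - {H}. poch (b h - x) (\<mu> h)) / (\<Prod>h\<in>{1..q} - {H}. pochhammer (b h - x) (Suc \<beta> - of_bool (h = j)))"
    unfolding vpoch_def prod_dividef[symmetric]
  proof (intro prod.cong refl)
    fix h assume h: "h \<in> {1..q} - {H}"
    then have "0 \<le> \<mu> h" using admissible_pairD(2)[OF ad] by blast
    then show "poch (b h - x + of_int (int \<beta> + 1) - of_bool (h = j)) (\<mu> h - (int \<beta> + 1) + of_bool (h = j)) =
        poch (b h - x) (\<mu> h) / pochhammer (b h - x) (Suc \<beta> - of_bool (h = j))"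
      unfolding poch_nonneg[OF \<open>0 \<le> \<mu> h\<close>]
      by (intro poch_eq_pochhammer_quotient poch_bx h) auto
  qed
  have C: "pochhammer (b H - x) (Suc \<beta>) = (-1) powi (int \<beta> + 1) * ifact (int K) * inverse (ifact (int K - 1 - int \<beta>))"
  proof -
    have "(-1 :: complex) powi (int \<beta> + 1) = (-1) ^ Suc \<beta>"
      by (metis power_int_of_nat of_nat_Suc add.commute)
    moreover have "ifact (int K - 1 - int \<beta>) = fact (K - Suc \<beta>)"
      using \<beta> by (simp add: ifact_def nat_diff_distrib)
    ultimately show ?thesis
      using pochhammer_minus_of_nat[of "Suc \<beta>" K] \<beta> by (simp add: x_def ifact_def divide_inverse)
  qed
  \<comment> \<open>The coefficient singles out component \<open>j\<close>, the block singles out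
    \<open>H\<close>; joining the full product and removing \<open>H\<close> instead converts one
    into the other.\<close>
  have "(\<Prod>h\<in>{1..q} - {j}. pochhammer (b h - x) (Suc \<beta>)) * pochhammer (b j - x) \<beta> =
      (\<Prod>h=1..q. pochhammer (b h - x) (Suc \<beta> - of_bool (h = j)))"
    using j by (subst prod.remove[of "{1..q}" j]) (auto intro!: prod.cong)
  also have "\<dots> = pochhammer (b H - x) (Suc \<beta>) * (\<Prod>h\<in>{1..q} - {H}. pochhammer (b h - x) (Suc \<beta> - of_bool (h = j)))"
    using H Hj by (subst prod.remove[of "{1..q}" H]) auto
  finally have E: "elementary_coeff H K j \<beta> = residue_b j * (pochhammer (b H - x) (Suc \<beta>) *
      (\<Prod>h\<in>{1..q} - {H}. pochhammer (b h - x) (Suc \<beta> - of_bool (h = j)))) / (\<Prod>\<rho>=1..r. pochhammer (a \<rho> - x) (Suc \<beta>))"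
    by (simp only: elementary_coeff_def x_def[symmetric] mult.assoc)
  have "ifact (int K) \<noteq> 0" by (simp add: ifact_def)
  then show ?thesis
    unfolding x A B E residue_b_def C
    by (simp add: vpoch_def divide_inverse mult_ac)
qed

end

section \<open>Pairing blocks\<close>

lemma j_max_props:
  assumes "1 \<le> q"
  shows "j_max q m \<in> {1..q}" "m (j_max q m) = m_max q m" "\<And>h. h \<in> {1..q} \<Longrightarrow> m h \<le> m_max q m"
proof -
  have "m_max q m \<in> m ` {1..q}"
    unfolding m_max_def using assms by (intro Max_in) auto
  then have "{j \<in> {1..q}. m j = m_max q m} \<noteq> {}" by auto
  then have "j_max q m \<in> {j \<in> {1..q}. m j = m_max q m}"
    unfolding j_max_def by (intro Max_in) auto
  then show "j_max q m \<in> {1..q}" "m (j_max q m) = m_max q m" by auto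
  show "m h \<le> m_max q m" if "h \<in> {1..q}" for h
    unfolding m_max_def using that by (intro Max_ge) auto
qed

lemma coeff_functional_monom_mult:
  "coeff_functional f (monom 1 d * Q) = coeff_functional (\<lambda>s. f (d + s)) Q"
proof (induction d arbitrary: f)
  case (Suc d)
  have "monom 1 (Suc d) * Q = pCons 0 (monom 1 d * Q)"
    by (simp add: monom_Suc)
  then show ?case by (simp add: coeff_functional_pCons Suc)
qed simp

lemma minus_one_powi_mult: "(-1 :: 'a::field) powi m * (-1) powi n = (-1) powi (m + n)"
  by (simp add: power_int_add)

text \<open>The algebra common to both cases of \<open>pair_S\<close>, with every Pochhammer product
  as an opaque factor: \<open>\<Delta>\<close> is the product of node differences, \<open>D\<close>
  the cleared \<open>\<phi>\<close>, \<open>X / (sK * fK * fd * W)\<close> is minus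
  \<open>B_pi\<close>, and \<open>e\<close> the elementary coefficient. The remaining
  \<open>s\<close> variables are signs.\<close>

lemma rearrange_factors:
  fixes s :: "'a::field"
  assumes "s = s1 * s2 * s3 * s4" "inverse s2 = s2" "inverse sK = s3" "\<Delta> = s2 * (fa * fb * P)" "D = vA * G"
    and "e * inverse (fK * W) = s4 * inverse fc * (vA2 * inverse vA3) * inverse R"
  shows "s / (fa * fb * fc * fd) * (vA * vA2 / (P * vA3)) * (X / Y) * (G / R) =
    s1 * (D / \<Delta>) * (X / (sK * fK * fd * W) * e) / Y"
proof -
  have "s1 * (D / \<Delta>) * (X / (sK * fK * fd * W) * e) / Y =
      s1 * D * inverse \<Delta> * X * inverse sK * inverse fd * (e * inverse (fK * W)) * inverse Y"
    by (simp add: divide_inverse mult_ac)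
  also have "inverse \<Delta> = s2 * inverse (fa * fb * P)"
    by (simp add: assms(2,4))
  also have "s1 * D * (s2 * inverse (fa * fb * P)) * X * inverse sK * inverse fd * (e * inverse (fK * W)) * inverse Y =
      s / (fa * fb * fc * fd) * (vA * vA2 / (P * vA3)) * (X / Y) * (G / R)"
    unfolding assms(1,3,5,6) by (simp add: divide_inverse mult_ac)
  finally show ?thesis ..
qed

context hypergeometric_system
begin

text \<open>In \<open>B_nu\<close> this product belongs to the normalization, whereas
  \<open>pair_S\<close> carries it in every summand; naming it allows it to be moved from one place
  to the other.\<close>

definition pair_ratio_denominator :: "(nat \<Rightarrow> int) \<Rightarrow> (nat \<Rightarrow> int) \<Rightarrow> complex" where
  "pair_ratio_denominator \<nu> \<mu> = vpoch {1..p} (\<lambda>l. \<kappa> l + (b (j_max q \<mu>) + of_int (m_max q \<mu> - 1) + 1)) \<nu>"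

text \<open>Separates a summand into a factor of the test vector, the kernel \<open>\<phi>\<close>
  and a factor of B. The case conditions of \<open>pair_S\<close> amount to
  \<open>\<beta> < K + of_bool (j = H)\<close>, the support of the elementary coefficients.\<close>

lemma pair_S_eq:
  assumes ad: "admissible_pair p q r a b \<kappa> \<nu> \<mu>"
    and i: "i \<in> {1..p}" and \<alpha>: "\<alpha> < nat (lam i)" and j: "j \<in> {1..q}" and H: "H \<in> {1..q}"
    and K: "K < nat (\<mu> H)"
    and lam: "\<And>i. i \<in> {1..p} \<Longrightarrow> 0 \<le> lam i" and \<eta>: "\<And>h. h \<in> {1..q} \<Longrightarrow> 0 \<le> \<eta> h"
  shows "pair_S p q r a b \<kappa> (int d) \<nu> \<mu> lam \<eta> i j H (int K) (int \<alpha>) (int \<beta>) =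
    (-1) powi (idx_size p lam - 1) * (node_weight lam \<eta> (i, \<alpha>) * \<phi> j (d + \<beta>) (node (i, \<alpha>))) *
    (- B_pi p q b \<kappa> \<nu> \<mu> H (int K) * (if \<beta> < K + of_bool (j = H) then elementary_coeff H K j \<beta> else 0)) /
    pair_ratio_denominator \<nu> \<mu>" (is "?S = _")
proof -
  define \<Delta> where "\<Delta> = (\<Prod>k'\<in>nodes lam - {(i, \<alpha>)}. node (i, \<alpha>) - node k')"
  define D where "D = denominator_b \<eta> (node (i, \<alpha>)) * \<phi> j (d + \<beta>) (node (i, \<alpha>))"
  define X where "X = vpoch {1..p} (\<lambda>l. \<kappa> l + (b H + of_int (int K) + 1)) \<nu>"
  define W where "W = (\<Prod>I\<in>{1..q} - {H}. poch (b I - b H - of_int (int K)) (\<mu> I))"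
  define sK where "sK = (-1 :: complex) powi (int K)"
  define fK where "fK = ifact (int K)"
  define fd where "fd = ifact (\<mu> H - int K - 1)"
  have mem: "(i, \<alpha>) \<in> nodes lam" using i \<alpha> by (simp add: nodes_def)
  have \<Delta>: "\<Delta> = (-1) powi (lam i - 1 - int \<alpha>) * (ifact (int \<alpha>) * ifact (lam i - 1 - int \<alpha>) *
      vpoch ({1..p} - {i}) (\<lambda>l. \<kappa> i - \<kappa> l - of_int (lam l) + of_int (int \<alpha> + 1)) lam)"
    unfolding \<Delta>_def by (rule node_denominator[where lam = lam, OF i \<alpha> lam])
  have D: "D = vpoch {1..r} (\<lambda>\<rho>. \<kappa> i + a \<rho> + of_int (int \<alpha> + 1)) (\<lambda>_. int d + int \<beta>) *
      vpoch {1..q} (\<lambda>h. \<kappa> i + b h + of_int (int d + int \<alpha> + int \<beta> + 1) + of_bool (h = j))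
        (\<lambda>h. \<eta> h - (int d + int \<beta>) - of_bool (h = j))"
    unfolding D_def by (subst denominator_b_mult_\<phi>[OF node_b[OF mem] j \<eta>])
      (simp_all add: node_def algebra_simps)
  have pi: "- B_pi p q b \<kappa> \<nu> \<mu> H (int K) = X / (sK * fK * fd * W)"
    by (simp add: B_pi_def X_def W_def sK_def fK_def fd_def vpoch_def add.assoc)
  have weight: "node_weight lam \<eta> (i, \<alpha>) * \<phi> j (d + \<beta>) (node (i, \<alpha>)) = D / \<Delta>"
    by (simp add: node_weight_def D_def \<Delta>_def)
  have sK: "inverse sK = sK" unfolding sK_def by (rule inverse_minus_one_powi)
  show ?thesis
  proof (cases "\<beta> < K + of_bool (j = H)")
    case False
    then have "?S = 0" by (auto simp: pair_S_def Let_def)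
    with False show ?thesis by simp
  next
    case True
    show ?thesis
    proof (cases "H = j")
      case diag: True
      then have \<beta>: "\<beta> \<le> K" using True by simp
      have cond: "0 \<le> int \<alpha> \<and> int \<alpha> \<le> lam i - 1 \<and> H = j \<and> 0 \<le> int K \<and> int K \<le> \<mu> H - 1 \<and> 0 \<le> int \<beta> \<and> int \<beta> \<le> int K"
        using \<alpha> K \<beta> diag by auto
      have sign: "(-1 :: complex) powi (idx_size p lam - lam i + int \<alpha> + int \<beta> - int K) =
          (-1) powi (idx_size p lam - 1) * (-1) powi (lam i - 1 - int \<alpha>) * sK * (-1) powi int \<beta>"
        unfolding sK_def minus_one_powi_mult by (rule minus_one_powi_cong) presburger
      show ?thesis
        unfolding pair_S_def Let_def if_P[OF cond] if_P[OF True] weight pi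
        unfolding diag[symmetric] pair_ratio_denominator_def X_def[symmetric] fd_def[symmetric]
        by (rule rearrange_factors[OF sign inverse_minus_one_powi sK \<Delta> D[folded diag]
              elementary_coeff_diag[OF ad H K \<beta>, folded fK_def W_def]])
    next
      case offdiag: False
      then have \<beta>: "\<beta> < K" using True by simp
      have cond1: "\<not> (0 \<le> int \<alpha> \<and> int \<alpha> \<le> lam i - 1 \<and> H = j \<and> 0 \<le> int K \<and> int K \<le> \<mu> H - 1 \<and> 0 \<le> int \<beta> \<and> int \<beta> \<le> int K)"
        using offdiag by simp
      have cond: "0 \<le> int \<alpha> \<and> int \<alpha> \<le> lam i - 1 \<and> H \<noteq> j \<and> 1 \<le> int K \<and> int K \<le> \<mu> H - 1 \<and> 0 \<le> int \<beta> \<and> int \<beta> \<le> int K - 1"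
        using \<alpha> K \<beta> offdiag by auto
      have sign: "(-1 :: complex) powi (idx_size p lam - lam i + 1 + int \<alpha> + int K + int \<beta>) =
          (-1) powi (idx_size p lam - 1) * (-1) powi (lam i - 1 - int \<alpha>) * sK * (-1) powi (int \<beta> + 1)"
        unfolding sK_def minus_one_powi_mult by (rule minus_one_powi_cong) presburger
      show ?thesis
        unfolding pair_S_def Let_def if_not_P[OF cond1] if_P[OF cond] if_P[OF True] weight pi
        unfolding pair_ratio_denominator_def X_def[symmetric] fd_def[symmetric]
          mult.commute[of "vpoch {1..r} (\<lambda>\<rho>. a \<rho> - b j) (\<lambda>_. 1)" "vpoch _ _ (\<lambda>_. int d + int \<beta>)"]
        by (rule rearrange_factors[OF sign inverse_minus_one_powi sK \<Delta> D
              elementary_coeff_offdiag[OF ad H j offdiag K \<beta>, folded fK_def W_def]])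
    qed
  qed
qed

text \<open>The normalization constant of A with index \<open>(lam, \<eta>)\<close>, times the sign
  \<open>(-1) powi idx_size p lam\<close>; the leading minus sign of that constant accounts for the
  exponent here.\<close>

definition test_scale :: "(nat \<Rightarrow> int) \<Rightarrow> (nat \<Rightarrow> int) \<Rightarrow> complex" where
  "test_scale lam \<eta> = (-1) powi (idx_size p lam - 1) *
     (vpoch {1..p} (\<lambda>i. \<kappa> i + (b (j_min q \<eta>) + of_int (m_min q \<eta>) + 1)) lam /
      (vpoch {1..r} (\<lambda>\<rho>. a \<rho> - (b (j_min q \<eta>) + of_int (m_min q \<eta>))) (\<lambda>_. m_min q \<eta>) *
       (\<Prod>h\<in>{h \<in> {1..q}. \<eta> h = m_min q \<eta> + 1}. b h - b (j_min q \<eta>))))"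

text \<open>The numerator symbol of \<open>B_nu\<close> has length \<open>m_max\<close>, that of
  \<open>pair_N\<close> one less; the extra factor \<open>a \<rho> - b jx\<close> cancels against
  the denominator of \<open>B_nu\<close>. This requires \<open>m_max \<ge> 1\<close>, which follows
  from \<open>|\<mu>| = |\<nu>| + 1\<close>.\<close>

lemma pair_N_eq:
  assumes ad: "admissible_pair p q r a b \<kappa> \<nu> \<mu>" and size: "idx_size q \<mu> = idx_size p \<nu> + 1"
  shows "(-1) powi (idx_size p lam - 1) * pair_N p q r a b \<kappa> \<mu> lam \<eta> / pair_ratio_denominator \<nu> \<mu> =
    - test_scale lam \<eta> * B_nu p q r a b \<kappa> \<nu> \<mu>"
proof -
  have q: "1 \<le> q" using r_less_q by simp
  define jx where "jx = j_max q \<mu>"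
  define mx where "mx = m_max q \<mu>"
  have jx: "jx \<in> {1..q}" "\<mu> jx = mx" using j_max_props[OF q] by (auto simp: jx_def mx_def)
  have "0 < idx_size q \<mu>"
    using size admissible_pairD(1)[OF ad] sum_nonneg[of "{1..p}" \<nu>] by (simp add: idx_size_def)
  have mx: "1 \<le> mx"
  proof (rule ccontr)
    assume "\<not> 1 \<le> mx"
    then have "\<mu> h \<le> 0" if "h \<in> {1..q}" for h
      using j_max_props(3)[OF q that, of \<mu>] by (simp add: mx_def)
    then have "idx_size q \<mu> \<le> 0" unfolding idx_size_def by (rule sum_nonpos)
    with \<open>0 < idx_size q \<mu>\<close> show False by simp
  qed
  have "vpoch {1..r} (\<lambda>\<rho>. a \<rho> - b jx - of_int (mx - 1)) (\<lambda>_. mx) =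
      vpoch {1..r} (\<lambda>\<rho>. a \<rho> - (b jx + of_int (mx - 1))) (\<lambda>_. mx - 1) * vpoch {1..r} (\<lambda>\<rho>. a \<rho> - b jx) (\<lambda>_. 1)"
  proof -
    have "nat mx = Suc (nat (mx - 1))" "of_nat (nat (mx - 1)) = (of_int (mx - 1) :: complex)"
      using mx by simp_all
    then show ?thesis
      unfolding vpoch_def prod.distrib[symmetric] using mx
      by (intro prod.cong refl) (simp add: poch_nonneg pochhammer_Suc algebra_simps)
  qed
  moreover have "vpoch {1..r} (\<lambda>\<rho>. a \<rho> - b jx) (\<lambda>_. 1) \<noteq> 0"
    using admissible_pairD(4)[OF ad _ jx(1), of _ 0] jx(2) mx by (auto simp: vpoch_def)
  moreover have "(\<Prod>i=1..p. poch (\<kappa> i + b jx + of_int mx) (\<nu> i)) = pair_ratio_denominator \<nu> \<mu>"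
    by (simp add: pair_ratio_denominator_def vpoch_def jx_def mx_def algebra_simps)
  ultimately have "B_nu p q r a b \<kappa> \<nu> \<mu> =
      - (vpoch {1..r} (\<lambda>\<rho>. a \<rho> - (b jx + of_int (mx - 1))) (\<lambda>_. mx - 1) *
         (\<Prod>h\<in>{h \<in> {1..q}. h \<noteq> jx \<and> \<mu> h = mx}. b h - b jx) / pair_ratio_denominator \<nu> \<mu>)"
    unfolding B_nu_def Let_def jx_def[symmetric] mx_def[symmetric] by simp
  then show ?thesis
    unfolding pair_N_def Let_def test_scale_def jx_def[symmetric] mx_def[symmetric]
    by (simp add: divide_inverse mult_ac)
qed

lemma transform_monom_mult_B_vec:
  assumes ad: "admissible_pair p q r a b \<kappa> \<nu> \<mu>"
  shows "transform (\<lambda>j. monom 1 d * B_vec p q r a b \<kappa> \<nu> \<mu> j) t =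
    (\<Sum>j=1..q. \<Sum>\<beta><nat (\<mu> j). coeff (B_poly p q r a b \<kappa> \<nu> \<mu> j) \<beta> * \<phi> j (d + \<beta>) t)"
  unfolding transform_def coeff_functional_monom_mult
  by (intro sum.cong refl, subst coeff_functional_lessThan)
     (auto simp: B_vec_def coeff_B_poly_eq_0[OF ad])

text \<open>After the factorization of each summand, the sums over \<open>H\<close> and
  \<open>K\<close> rebuild a coefficient of B, those over \<open>j\<close> and
  \<open>\<beta>\<close> its transform, and those over \<open>i\<close> and \<open>\<alpha>\<close>
  run through the nodes.\<close>

lemma pairing_eq_test_functional:
  assumes ad: "admissible_pair p q r a b \<kappa> \<nu> \<mu>" and size: "idx_size q \<mu> = idx_size p \<nu> + 1"
    and lam: "\<And>i. i \<in> {1..p} \<Longrightarrow> 0 \<le> lam i" and \<eta>: "\<And>h. h \<in> {1..q} \<Longrightarrow> 0 \<le> \<eta> h"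
  shows "pairing p q r a b \<kappa> (int d) \<nu> \<mu> lam \<eta> =
    test_scale lam \<eta> * test_functional lam \<eta> (\<lambda>j. monom 1 d * B_vec p q r a b \<kappa> \<nu> \<mu> j)"
proof -
  define T where "T i \<alpha> j \<beta> = node_weight lam \<eta> (i, \<alpha>) *
    (coeff (B_poly p q r a b \<kappa> \<nu> \<mu> j) \<beta> * \<phi> j (d + \<beta>) (node (i, \<alpha>)))" for i \<alpha> j \<beta>
  have "pairing p q r a b \<kappa> (int d) \<nu> \<mu> lam \<eta> =
      (\<Sum>j=1..q. \<Sum>i=1..p. \<Sum>\<beta><nat (\<mu> j). \<Sum>\<alpha><nat (lam i). \<Sum>H=1..q. \<Sum>K<nat (\<mu> H).
        pair_N p q r a b \<kappa> \<mu> lam \<eta> *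
        pair_S p q r a b \<kappa> (int d) \<nu> \<mu> lam \<eta> i j H (int K) (int \<alpha>) (int \<beta>))"
    unfolding pairing_def sum_int_atLeastAtMost_nat(2) sum_distrib_left ..
  also have "\<dots> = (\<Sum>j=1..q. \<Sum>i=1..p. \<Sum>\<beta><nat (\<mu> j). \<Sum>\<alpha><nat (lam i). test_scale lam \<eta> * T i \<alpha> j \<beta>)"
  proof (intro sum.cong refl)
    fix i j \<alpha> \<beta> assume i: "i \<in> {1..p}" and j: "j \<in> {1..q}" and \<alpha>: "\<alpha> \<in> {..<nat (lam i)}"
    have "(\<Sum>H=1..q. \<Sum>K<nat (\<mu> H). pair_N p q r a b \<kappa> \<mu> lam \<eta> *
        pair_S p q r a b \<kappa> (int d) \<nu> \<mu> lam \<eta> i j H (int K) (int \<alpha>) (int \<beta>)) =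
      (\<Sum>H=1..q. \<Sum>K<nat (\<mu> H).
        (-1) powi (idx_size p lam - 1) * pair_N p q r a b \<kappa> \<mu> lam \<eta> / pair_ratio_denominator \<nu> \<mu> *
        (node_weight lam \<eta> (i, \<alpha>) * \<phi> j (d + \<beta>) (node (i, \<alpha>)) *
        (- B_pi p q b \<kappa> \<nu> \<mu> H (int K) * (if \<beta> < K + of_bool (j = H) then elementary_coeff H K j \<beta> else 0))))"
    proof (intro sum.cong refl)
      fix H K assume "H \<in> {1..q}" "K \<in> {..<nat (\<mu> H)}"
      then show "pair_N p q r a b \<kappa> \<mu> lam \<eta> *
        pair_S p q r a b \<kappa> (int d) \<nu> \<mu> lam \<eta> i j H (int K) (int \<alpha>) (int \<beta>) =
        (-1) powi (idx_size p lam - 1) * pair_N p q r a b \<kappa> \<mu> lam \<eta> / pair_ratio_denominator \<nu> \<mu> *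
        (node_weight lam \<eta> (i, \<alpha>) * \<phi> j (d + \<beta>) (node (i, \<alpha>)) *
        (- B_pi p q b \<kappa> \<nu> \<mu> H (int K) * (if \<beta> < K + of_bool (j = H) then elementary_coeff H K j \<beta> else 0)))"
        using i j \<alpha> by (subst pair_S_eq[where lam = lam and \<eta> = \<eta>, OF ad i _ j _ _ lam \<eta>]) (auto simp: divide_inverse mult_ac)
    qed
    also have "\<dots> = test_scale lam \<eta> * (node_weight lam \<eta> (i, \<alpha>) * \<phi> j (d + \<beta>) (node (i, \<alpha>)) *
        (B_nu p q r a b \<kappa> \<nu> \<mu> * (\<Sum>H=1..q. \<Sum>K<nat (\<mu> H).
        B_pi p q b \<kappa> \<nu> \<mu> H (int K) * (if \<beta> < K + of_bool (j = H) then elementary_coeff H K j \<beta> else 0))))"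
      unfolding pair_N_eq[OF ad size] sum_distrib_left by (intro sum.cong refl) simp
    also have "\<dots> = test_scale lam \<eta> * T i \<alpha> j \<beta>"
      unfolding T_def coeff_B_poly[OF ad j] by (simp only: mult_ac)
    finally show "(\<Sum>H=1..q. \<Sum>K<nat (\<mu> H). pair_N p q r a b \<kappa> \<mu> lam \<eta> *
        pair_S p q r a b \<kappa> (int d) \<nu> \<mu> lam \<eta> i j H (int K) (int \<alpha>) (int \<beta>)) = test_scale lam \<eta> * T i \<alpha> j \<beta>" .
  qed
  also have "\<dots> = test_scale lam \<eta> * (\<Sum>j=1..q. \<Sum>i=1..p. \<Sum>\<beta><nat (\<mu> j). \<Sum>\<alpha><nat (lam i). T i \<alpha> j \<beta>)"
    by (simp only: sum_distrib_left)
  \<comment> \<open>The range of \<open>\<beta>\<close> depends on \<open>j\<close> and that of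
    \<open>\<alpha>\<close> on \<open>i\<close>, so the order is changed by adjacent swaps that keep
    each dependent index inside its partner.\<close>
  also have "(\<Sum>j=1..q. \<Sum>i=1..p. \<Sum>\<beta><nat (\<mu> j). \<Sum>\<alpha><nat (lam i). T i \<alpha> j \<beta>) =
      (\<Sum>j=1..q. \<Sum>i=1..p. \<Sum>\<alpha><nat (lam i). \<Sum>\<beta><nat (\<mu> j). T i \<alpha> j \<beta>)"
    by (intro sum.cong refl sum.swap)
  also have "\<dots> = (\<Sum>i=1..p. \<Sum>j=1..q. \<Sum>\<alpha><nat (lam i). \<Sum>\<beta><nat (\<mu> j). T i \<alpha> j \<beta>)"
    by (rule sum.swap)
  also have "\<dots> = (\<Sum>i=1..p. \<Sum>\<alpha><nat (lam i). \<Sum>j=1..q. \<Sum>\<beta><nat (\<mu> j). T i \<alpha> j \<beta>)"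
    by (intro sum.cong refl sum.swap)
  also have "\<dots> = test_functional lam \<eta> (\<lambda>j. monom 1 d * B_vec p q r a b \<kappa> \<nu> \<mu> j)"
    unfolding test_functional_def transform_monom_mult_B_vec[OF ad] T_def nodes_def
    by (subst sum.Sigma) (simp_all add: sum_distrib_left split_def)
  finally show ?thesis .
qed

end

section \<open>Biorthogonality and dimension\<close>

interpretation cpoly: vector_space "smult :: complex \<Rightarrow> complex poly \<Rightarrow> complex poly"
  by standard (auto simp: smult_add_right smult_add_left)

interpretation row_cpoly: vector_space_pair row_scale "smult :: complex \<Rightarrow> complex poly \<Rightarrow> complex poly" ..

text \<open>Applying \<open>\<tau> k\<close> to a combination isolates its \<open>k\<close>-th
  coefficient, which gives independence and the coordinates. The family spans because a vector
  outside the span would yield an independent set larger than \<open>bound\<close> allows.\<close>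

lemma biorthogonal_basis:
  assumes J: "finite J" and L: "row.subspace L" and W: "\<And>k. k \<in> J \<Longrightarrow> W k \<in> L"
    and add: "\<And>k x y. \<tau> k (x + y) = \<tau> k x + \<tau> k y" and scale: "\<And>k c x. \<tau> k (row_scale c x) = c * \<tau> k x"
    and diag: "\<And>k. k \<in> J \<Longrightarrow> \<tau> k (W k) \<noteq> 0"
    and offdiag: "\<And>k l. k \<in> J \<Longrightarrow> l \<in> J \<Longrightarrow> k \<noteq> l \<Longrightarrow> \<tau> k (W l) = 0"
    and bound: "\<And>S. finite S \<Longrightarrow> S \<subseteq> L \<Longrightarrow> row.independent S \<Longrightarrow> card S \<le> card J"
  shows "inj_on W J" "row.independent (W ` J)" "row.span (W ` J) = L"
    and "\<And>x. x \<in> L \<Longrightarrow> x = (\<Sum>k\<in>J. row_scale (\<tau> k x / \<tau> k (W k)) (W k))"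
proof -
  have zero: "\<tau> k 0 = 0" for k
    using scale[of k 0 0] by simp
  have sum: "\<tau> k (\<Sum>x\<in>X. F x) = (\<Sum>x\<in>X. \<tau> k (F x))" for k and X :: "'a set" and F
    by (induction X rule: infinite_finite_induct) (simp_all only: sum.infinite sum.empty sum.insert zero add simp_thms)
  have coord: "\<tau> k (\<Sum>l\<in>J. row_scale (c l) (W l)) = c k * \<tau> k (W k)" if k: "k \<in> J" for k c
  proof -
    have "(\<Sum>l\<in>J. c l * \<tau> k (W l)) = (\<Sum>l\<in>J. if l = k then c k * \<tau> k (W k) else 0)"
      using offdiag[OF k] by (intro sum.cong) auto
    then show ?thesis using J k by (simp add: sum scale)
  qed
  show inj: "inj_on W J"
    using diag offdiag by (metis inj_onI)
  show indep: "row.independent (W ` J)"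
  proof
    assume "row.dependent (W ` J)"
    then obtain u where u: "\<exists>v\<in>W ` J. u v \<noteq> 0" "(\<Sum>v\<in>W ` J. row_scale (u v) v) = 0"
      using J by (auto simp: row.dependent_finite)
    then have "(\<Sum>l\<in>J. row_scale (u (W l)) (W l)) = 0"
      using sum.reindex[OF inj, of "\<lambda>v. row_scale (u v) v"] by (simp only: o_def)
    then have "u (W k) * \<tau> k (W k) = 0" if "k \<in> J" for k
      using coord[OF that, of "\<lambda>l. u (W l)"] zero by simp
    with u(1) diag show False by auto
  qed
  have sub: "row.span (W ` J) \<subseteq> L"
    using W L by (intro row.span_minimal) auto
  show span: "row.span (W ` J) = L"
  proof (rule antisym[OF sub], rule ccontr)
    assume "\<not> L \<subseteq> row.span (W ` J)"
    then obtain x where x: "x \<in> L" "x \<notin> row.span (W ` J)" by auto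
    then have "x \<notin> W ` J" using row.span_base by auto
    then have "card (insert x (W ` J)) = Suc (card J)"
      using J inj by (simp add: card_image)
    moreover have "row.independent (insert x (W ` J))"
      using x indep by (simp add: row.independent_insert)
    ultimately show False using bound[of "insert x (W ` J)"] x W J by auto
  qed
  show "x = (\<Sum>k\<in>J. row_scale (\<tau> k x / \<tau> k (W k)) (W k))" if "x \<in> L" for x
  proof -
    have "x \<in> range (\<lambda>u. \<Sum>v\<in>W ` J. row_scale (u v) v)"
      using that J span row.span_finite[of "W ` J"] by auto
    then obtain u where "x = (\<Sum>v\<in>W ` J. row_scale (u v) v)" by (elim rangeE)
    then have x: "x = (\<Sum>k\<in>J. row_scale (u (W k)) (W k))"
      using sum.reindex[OF inj, of "\<lambda>v. row_scale (u v) v"] by (simp only: o_def)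
    have "\<tau> k x / \<tau> k (W k) = u (W k)" if "k \<in> J" for k
      using coord[OF that, of "\<lambda>l. u (W l)"] diag[OF that] x by simp
    then show ?thesis by (subst x) (intro sum.cong, auto)
  qed
qed

text \<open>In terms of coefficients the zero polynomial is covered uniformly, also when
  \<open>N = 0\<close>.\<close>

lemma polys_le_iff: "f \<in> polys_le (N - 1) \<longleftrightarrow> (\<forall>d. N \<le> int d \<longrightarrow> coeff f d = 0)"
proof
  assume "f \<in> polys_le (N - 1)"
  then show "\<forall>d. N \<le> int d \<longrightarrow> coeff f d = 0"
    by (cases "f = 0") (auto simp: polys_le_def intro!: coeff_eq_0)
next
  assume *: "\<forall>d. N \<le> int d \<longrightarrow> coeff f d = 0"
  have "int (degree f) \<le> N - 1" if "f \<noteq> 0"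
  proof (rule ccontr)
    assume "\<not> int (degree f) \<le> N - 1"
    with * have "lead_coeff f = 0" by simp
    with that show False by simp
  qed
  then show "f \<in> polys_le (N - 1)" by (auto simp: polys_le_def)
qed

section \<open>Clearing denominators and the dimension bound\<close>

context hypergeometric_system
begin

text \<open>The function \<open>denominator_b M * \<phi> j d\<close> with common factors cancelled.
  It is a polynomial identity only if \<open>d + of_bool (h = j) \<le> M h\<close> for all
  \<open>h\<close>, which for \<open>d < M j\<close> is near-diagonality of
  \<open>M\<close>.\<close>

definition numerator_term :: "(nat \<Rightarrow> int) \<Rightarrow> nat \<Rightarrow> nat \<Rightarrow> complex poly" where
  "numerator_term M j d = (\<Prod>\<rho>=1..r. \<Prod>s<d. [:a \<rho> + 1 + of_nat s, 1:]) *
     (\<Prod>h=1..q. \<Prod>s\<in>{d + of_bool (h = j)..<nat (M h)}. [:b h + 1 + of_nat s, 1:])"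

text \<open>Coefficients from exponent \<open>M j\<close> on are cut off, so the map is linear on
  all row vectors while nothing is lost on the local space.\<close>

definition numerator_poly :: "(nat \<Rightarrow> int) \<Rightarrow> (nat \<Rightarrow> complex poly) \<Rightarrow> complex poly" where
  "numerator_poly M Q = (\<Sum>j=1..q. \<Sum>d<nat (M j). smult (coeff (Q j) d) (numerator_term M j d))"

lemma linear_numerator_poly: "Vector_Spaces.linear row_scale smult (numerator_poly M)"
  unfolding Vector_Spaces.linear_iff
  using row.vector_space_axioms cpoly.vector_space_axioms
  by (simp add: numerator_poly_def row_scale_def sum.distrib smult_add_left cpoly.scale_sum_right)

lemma poly_numerator_term:
  assumes t: "\<And>h. h \<in> {1..q} \<Longrightarrow> t + b h + 1 \<notin> \<int>\<^sub>\<le>\<^sub>0" and j: "j \<in> {1..q}"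
    and d: "\<And>h. h \<in> {1..q} \<Longrightarrow> d + of_bool (h = j) \<le> nat (M h)"
  shows "poly (numerator_term M j d) t = denominator_b M t * \<phi> j d t"
proof -
  have split: "pochhammer (t + b h + 1) (nat (M h)) =
      pochhammer (t + b h + 1) d * (if h = j then t + b j + 1 + of_nat d else 1) *
      (\<Prod>s\<in>{d + of_bool (h = j)..<nat (M h)}. t + b h + 1 + of_nat s)" if "h \<in> {1..q}" for h
  proof -
    have "pochhammer (t + b h + 1) (nat (M h)) = (\<Prod>s\<in>{..<d + of_bool (h = j)} \<union> {d + of_bool (h = j)..<nat (M h)}. t + b h + 1 + of_nat s)"
      unfolding pochhammer_prod_lessThan using d[OF that] by (intro prod.cong) auto
    also have "\<dots> = pochhammer (t + b h + 1) (d + of_bool (h = j)) * (\<Prod>s\<in>{d + of_bool (h = j)..<nat (M h)}. t + b h + 1 + of_nat s)"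
      unfolding pochhammer_prod_lessThan by (rule prod.union_disjoint) auto
    also have "pochhammer (t + b h + 1) (d + of_bool (h = j)) = pochhammer (t + b h + 1) d * (if h = j then t + b j + 1 + of_nat d else 1)"
      by (simp add: pochhammer_Suc)
    finally show ?thesis .
  qed
  have "denominator_b M t = (\<Prod>h=1..q. pochhammer (t + b h + 1) d * (if h = j then t + b j + 1 + of_nat d else 1) *
      (\<Prod>s\<in>{d + of_bool (h = j)..<nat (M h)}. t + b h + 1 + of_nat s))"
    unfolding denominator_b_def by (intro prod.cong refl split)
  then have "denominator_b M t = (\<Prod>h=1..q. pochhammer (t + b h + 1) d) * (t + b j + 1 + of_nat d) *
      (\<Prod>h=1..q. \<Prod>s\<in>{d + of_bool (h = j)..<nat (M h)}. t + b h + 1 + of_nat s)"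
    using j by (simp add: prod.distrib)
  moreover have "(\<Prod>h=1..q. pochhammer (t + b h + 1) d) \<noteq> 0"
    using pochhammer_neq_0_of_notin_nonpos_Ints[OF t] by simp
  moreover have "t + b j + 1 + of_nat d \<noteq> 0"
    using add_of_nat_notin_nonpos_Ints[OF t[OF j], of d] by auto
  moreover have "poly (numerator_term M j d) t = (\<Prod>\<rho>=1..r. pochhammer (t + a \<rho> + 1) d) *
      (\<Prod>h=1..q. \<Prod>s\<in>{d + of_bool (h = j)..<nat (M h)}. t + b h + 1 + of_nat s)"
    by (simp add: numerator_term_def poly_prod pochhammer_prod_lessThan algebra_simps)
  ultimately show ?thesis
    by (simp add: \<phi>_def)
qed

lemma poly_numerator_poly:
  assumes t: "\<And>h. h \<in> {1..q} \<Longrightarrow> t + b h + 1 \<notin> \<int>\<^sub>\<le>\<^sub>0"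
    and M: "\<And>g h. g \<in> {1..q} \<Longrightarrow> h \<in> {1..q} \<Longrightarrow> M g \<le> M h + 1"
    and Q: "\<And>j d. j \<in> {1..q} \<Longrightarrow> M j \<le> int d \<Longrightarrow> coeff (Q j) d = 0"
  shows "poly (numerator_poly M Q) t = denominator_b M t * transform Q t"
proof -
  have "poly (numerator_poly M Q) t = (\<Sum>j=1..q. \<Sum>d<nat (M j). coeff (Q j) d * (denominator_b M t * \<phi> j d t))"
    unfolding numerator_poly_def poly_sum
  proof (intro sum.cong refl)
    fix j d assume j: "j \<in> {1..q}" and d: "d \<in> {..<nat (M j)}"
    have le: "d + of_bool (h = j) \<le> nat (M h)" if "h \<in> {1..q}" for h
      using M[OF j that] d by auto
    show "poly (smult (coeff (Q j) d) (numerator_term M j d)) t = coeff (Q j) d * (denominator_b M t * \<phi> j d t)"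
      by (simp only: poly_smult poly_numerator_term[OF t j le])
  qed
  also have "\<dots> = denominator_b M t * (\<Sum>j=1..q. \<Sum>d<nat (M j). coeff (Q j) d * \<phi> j d t)"
    by (simp add: sum_distrib_left mult_ac)
  also have "(\<Sum>j=1..q. \<Sum>d<nat (M j). coeff (Q j) d * \<phi> j d t) = transform Q t"
    unfolding transform_def
    by (intro sum.cong refl coeff_functional_lessThan[symmetric] Q) auto
  finally show ?thesis .
qed

text \<open>A term has degree at most \<open>r * d + (|M| - q * d - 1)\<close>, and
  \<open>r < q\<close>; the 1 comes from the extra linear factor of component \<open>j\<close> in
  \<open>\<phi>\<close>.\<close>

lemma degree_numerator_poly:
  assumes nonneg: "\<And>h. h \<in> {1..q} \<Longrightarrow> 0 \<le> M h"
    and M: "\<And>g h. g \<in> {1..q} \<Longrightarrow> h \<in> {1..q} \<Longrightarrow> M g \<le> M h + 1"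
  shows "degree (numerator_poly M Q) \<le> nat (idx_size q M) - 1"
  unfolding numerator_poly_def
proof (intro degree_sum_le)
  fix j d assume j: "j \<in> {1..q}" and d: "d \<in> {..<nat (M j)}"
  have le: "d + of_bool (h = j) \<le> nat (M h)" if "h \<in> {1..q}" for h
    using M[OF j that] d by auto
  have d1: "degree (\<Prod>\<rho>=1..r. \<Prod>s<d. [:a \<rho> + 1 + of_nat s, 1:]) = r * d"
    by (subst degree_prod_sum_eq) (auto simp: degree_prod_linear)
  have d2: "degree (\<Prod>h=1..q. \<Prod>s\<in>{d + of_bool (h = j)..<nat (M h)}. [:b h + 1 + of_nat s, 1:]) =
      (\<Sum>h=1..q. nat (M h) - (d + of_bool (h = j)))"
    by (subst degree_prod_sum_eq) (auto simp: degree_prod_linear)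
  have "degree (numerator_term M j d) \<le> r * d + (\<Sum>h=1..q. nat (M h) - (d + of_bool (h = j)))"
    unfolding numerator_term_def by (rule order.trans[OF degree_mult_le]) (simp only: d1 d2 order.refl)
  moreover have "(\<Sum>h=1..q. nat (M h) - (d + of_bool (h = j))) + (q * d + 1) = nat (idx_size q M)"
  proof -
    have "(\<Sum>h=1..q. nat (M h) - (d + of_bool (h = j))) + (\<Sum>h=1..q. d + of_bool (h = j)) = (\<Sum>h=1..q. nat (M h))"
      unfolding sum.distrib[symmetric] using le by (intro sum.cong) auto
    moreover have "(\<Sum>h=1..q. d + of_bool (h = j)) = q * d + 1"
      using j by (simp add: sum.distrib)
    moreover have "(\<Sum>h=1..q. nat (M h)) = nat (idx_size q M)"
    proof -
      have "int (\<Sum>h=1..q. nat (M h)) = idx_size q M"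
        using nonneg by (simp add: idx_size_def)
      then show ?thesis by linarith
    qed
    ultimately show ?thesis by simp
  qed
  moreover have "r * d \<le> q * d" using r_less_q by simp
  ultimately show "degree (smult (coeff (Q j) d) (numerator_term M j d)) \<le> nat (idx_size q M) - 1"
    using degree_smult_le[of "coeff (Q j) d" "numerator_term M j d"] by linarith
qed auto

text \<open>Let \<open>D\<close> be the largest exponent in \<open>Q\<close>, occurring in component
  \<open>j0\<close>. Evaluation at a zero shared by all terms with \<open>d \<le> D\<close> except
  \<open>(j0, D)\<close> isolates that coefficient; the condition on \<open>a\<close> keeps the
  surviving value nonzero.\<close>

lemma numerator_poly_eq_0:
  assumes M: "\<And>g h. g \<in> {1..q} \<Longrightarrow> h \<in> {1..q} \<Longrightarrow> M g \<le> M h + 1"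
    and a: "\<And>\<rho> h k. \<rho> \<in> {1..r} \<Longrightarrow> h \<in> {1..q} \<Longrightarrow> int k < M h \<Longrightarrow> a \<rho> \<noteq> b h + of_nat k"
    and Q: "\<And>j d. j \<in> {1..q} \<Longrightarrow> M j \<le> int d \<Longrightarrow> coeff (Q j) d = 0"
    and zero: "numerator_poly M Q = 0" and j: "j \<in> {1..q}"
  shows "Q j = 0"
proof (rule ccontr)
  assume "Q j \<noteq> 0"
  define A where "A = {d. \<exists>j\<in>{1..q}. coeff (Q j) d \<noteq> 0}"
  have "A \<subseteq> (\<Union>j\<in>{1..q}. {..<nat (M j)})"
    unfolding A_def using Q by (force simp: not_le)
  then have fin: "finite A" by (rule finite_subset) auto
  have "degree (Q j) \<in> A" using \<open>Q j \<noteq> 0\<close> j by (auto simp: A_def intro!: bexI[of _ j])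
  define D where "D = Max A"
  have "D \<in> A" unfolding D_def using fin \<open>degree (Q j) \<in> A\<close> by (intro Max_in) auto
  then obtain j0 where j0: "j0 \<in> {1..q}" "coeff (Q j0) D \<noteq> 0" by (auto simp: A_def)
  have D: "D < nat (M j0)" using Q[OF j0(1), of D] j0(2) by force
  have above: "coeff (Q j) d = 0" if "j \<in> {1..q}" "D < d" for j d
  proof (rule ccontr)
    assume "coeff (Q j) d \<noteq> 0"
    with that have "d \<in> A" by (auto simp: A_def)
    then have "d \<le> D" unfolding D_def using fin by (intro Max_ge)
    with that show False by simp
  qed
  \<comment> \<open>The zero of the factor with \<open>s = D\<close> in component \<open>j0\<close>.
    That component's product begins at \<open>D + 1\<close> in the term \<open>(j0, D)\<close> but
    still contains \<open>D\<close> in every other term with \<open>d \<le> D\<close>.\<close>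
  define t where "t = - (b j0 + 1 + of_nat D)"
  have other: "coeff (Q j) d * poly (numerator_term M j d) t = (if j = j0 \<and> d = D then coeff (Q j0) D * poly (numerator_term M j0 D) t else 0)"
    if "j \<in> {1..q}" for j d
  proof (cases "D < d \<or> (j = j0 \<and> d = D)")
    case False
    then have "D \<in> {d + of_bool (j0 = j)..<nat (M j0)}" using D by auto
    moreover have "b j0 + 1 + of_nat D + t = 0" by (simp add: t_def)
    ultimately have "(\<Prod>s\<in>{d + of_bool (j0 = j)..<nat (M j0)}. b j0 + 1 + of_nat s + t) = 0"
      by (intro prod_zero) auto
    then have "(\<Prod>h=1..q. \<Prod>s\<in>{d + of_bool (h = j)..<nat (M h)}. b h + 1 + of_nat s + t) = 0"
      using j0(1) by (subst prod.remove[of _ j0]) simp_all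
    then have "poly (numerator_term M j d) t = 0"
      by (simp add: numerator_term_def poly_prod)
    with False show ?thesis by auto
  qed (use above[OF that] in auto)
  have "poly (numerator_term M j0 D) t \<noteq> 0"
  proof -
    have "a \<rho> + 1 + of_nat s + t \<noteq> 0" if "\<rho> \<in> {1..r}" "s < D" for \<rho> s
      using a[OF that(1) j0(1), of "D - s"] that(2) D by (auto simp: t_def of_nat_diff algebra_simps)
    moreover have "b h + 1 + of_nat s + t \<noteq> 0" if "h \<in> {1..q}" "D + of_bool (h = j0) \<le> s" for h s
    proof (cases "h = j0")
      case False
      then show ?thesis
        using b_neq[OF that(1) j0(1), of "int D - int s"] by (auto simp: t_def algebra_simps)
    next
      case True
      then have "b h + 1 + of_nat s + t = of_nat (s - D)" using that by (simp add: t_def of_nat_diff)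
      then show ?thesis using True that by (auto simp del: of_nat_diff)
    qed
    ultimately show ?thesis
      by (simp add: numerator_term_def poly_prod)
  qed
  moreover have "poly (numerator_poly M Q) t = (\<Sum>j=1..q. \<Sum>d<nat (M j).
      if j = j0 \<and> d = D then coeff (Q j0) D * poly (numerator_term M j0 D) t else 0)"
    unfolding numerator_poly_def poly_sum poly_smult by (intro sum.cong refl other)
  moreover have "\<dots> = (\<Sum>j=1..q. if j = j0 then coeff (Q j0) D * poly (numerator_term M j0 D) t else 0)"
    using D by (intro sum.cong) auto
  moreover have "\<dots> = coeff (Q j0) D * poly (numerator_term M j0 D) t"
    using j0(1) by simp
  ultimately show False using zero j0(2) by simp
qed

lemma card_nodes:
  assumes "\<And>i. i \<in> {1..p} \<Longrightarrow> 0 \<le> lam i"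
  shows "int (card (nodes lam)) = idx_size p lam"
  using assms by (simp add: nodes_def idx_size_def)

lemma test_functional_eq_0_of_coeff:
  assumes lam: "\<And>i. i \<in> {1..p} \<Longrightarrow> 0 \<le> lam i" and nonneg: "\<And>h. h \<in> {1..q} \<Longrightarrow> 0 \<le> \<eta> h"
    and \<eta>: "\<And>g h. g \<in> {1..q} \<Longrightarrow> h \<in> {1..q} \<Longrightarrow> \<eta> g \<le> \<eta> h + 1"
    and size: "idx_size p lam = idx_size q \<eta> + 1"
    and Q: "\<And>j d. j \<in> {1..q} \<Longrightarrow> \<eta> j \<le> int d \<Longrightarrow> coeff (Q j) d = 0"
  shows "test_functional lam \<eta> Q = 0"
proof (cases "idx_size q \<eta> = 0")
  \<comment> \<open>With \<open>|\<eta>| = 0\<close> there is a single node and the degree estimate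
    fails to be strict, but then the degree condition forces all components of \<open>Q\<close> to
    vanish.\<close>
  case True
  then have "\<eta> h = 0" if "h \<in> {1..q}" for h
    using sum_nonneg_eq_0_iff[of "{1..q}" \<eta>] nonneg that by (simp add: idx_size_def)
  then have "Q j = 0" if "j \<in> {1..q}" for j
    using Q[OF that] that by (simp add: poly_eq_iff)
  then have "transform Q t = 0" for t by (simp add: transform_def)
  then show ?thesis by (simp add: test_functional_def)
next
  case False
  have "0 \<le> idx_size q \<eta>" using sum_nonneg[of "{1..q}" \<eta>] nonneg by (simp add: idx_size_def)
  then have deg: "degree (numerator_poly \<eta> Q) + 1 < card (nodes lam)"
    using degree_numerator_poly[where M = \<eta> and Q = Q, OF nonneg \<eta>] card_nodes[where lam = lam, OF lam] size False by linarith
  have "test_functional lam \<eta> Q =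
      (\<Sum>k\<in>nodes lam. poly (numerator_poly \<eta> Q) (node k) / (\<Prod>k'\<in>nodes lam - {k}. node k - node k'))"
    unfolding test_functional_def node_weight_def
  proof (intro sum.cong refl)
    fix k assume k: "k \<in> nodes lam"
    show "denominator_b \<eta> (node k) / (\<Prod>k'\<in>nodes lam - {k}. node k - node k') * transform Q (node k) =
      poly (numerator_poly \<eta> Q) (node k) / (\<Prod>k'\<in>nodes lam - {k}. node k - node k')"
      by (subst poly_numerator_poly[OF node_b[OF k] \<eta> Q]) auto
  qed
  also have "\<dots> = 0"
    by (rule lagrange_sum_eq_0[OF finite_nodes inj_on_node deg])
  finally show ?thesis .
qed

lemma test_functional_eq_0_of_transform:
  assumes "\<And>i l. i \<in> {1..p} \<Longrightarrow> int l < lam i \<Longrightarrow> transform Q (\<kappa> i + of_nat l) = 0"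
  shows "test_functional lam \<eta> Q = 0"
  using assms by (auto simp: test_functional_def nodes_def node_def intro!: sum.neutral)

lemma subspace_local_space: "row.subspace (local_space p q r a b \<kappa> N M)"
  by (rule row.subspaceI)
     (auto simp: local_space_iff polys_le_iff transform_add transform_row_scale[unfolded row_scale_def] row_scale_def)

text \<open>The image of a row vector has degree below \<open>|M|\<close> and vanishes at
  \<open>|N|\<close> distinct nodes. It is therefore \<open>R\<close> times a polynomial of degree
  below \<open>|M| - |N| = c\<close>, and injectivity transports independence.\<close>

lemma card_independent_local_space_le:
  assumes N: "\<And>i. i \<in> {1..p} \<Longrightarrow> 0 \<le> N i" and nonneg: "\<And>h. h \<in> {1..q} \<Longrightarrow> 0 \<le> M h"
    and M: "\<And>g h. g \<in> {1..q} \<Longrightarrow> h \<in> {1..q} \<Longrightarrow> M g \<le> M h + 1"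
    and a: "\<And>\<rho> h k. \<rho> \<in> {1..r} \<Longrightarrow> h \<in> {1..q} \<Longrightarrow> int k < M h \<Longrightarrow> a \<rho> \<noteq> b h + of_nat k"
    and S: "S \<subseteq> local_space p q r a b \<kappa> N M" "row.independent S"
    and size: "idx_size q M = idx_size p N + int c" and c: "0 < c"
  shows "card S \<le> c"
proof -
  let ?L = "local_space p q r a b \<kappa> N M" and ?f = "numerator_poly M"
  define R where "R = (\<Prod>k\<in>nodes N. [:- node k, 1:])"
  have coeff_L: "coeff (Q j) d = 0" if "Q \<in> ?L" "j \<in> {1..q}" "M j \<le> int d" for Q j d
    using that by (auto simp: local_space_iff polys_le_iff)
  have "row.span S \<subseteq> ?L"
    by (rule row.span_minimal[OF S(1) subspace_local_space])
  moreover have "Q = 0" if Q: "Q \<in> ?L" "?f Q = 0" for Q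
  proof
    show "Q j = (0 :: nat \<Rightarrow> complex poly) j" for j
    proof (cases "j \<in> {1..q}")
      case True
      then show ?thesis using numerator_poly_eq_0[OF M a coeff_L[OF Q(1)] Q(2)] by simp
    next
      case False
      then show ?thesis using Q(1) by (simp add: local_space_iff del: atLeastAtMost_iff)
    qed
  qed
  ultimately have inj: "inj_on ?f (row.span S)"
    by (subst row_cpoly.linear_inj_on_iff_eq_0[OF linear_numerator_poly row.subspace_span]) blast
  then have indep: "cpoly.independent (?f ` S)"
    by (intro row_cpoly.linear_independent_injective_image[OF linear_numerator_poly S(2)])
  have "?f Q \<in> cpoly.span ((\<lambda>e. R * monom 1 e) ` {..<c})" if Q: "Q \<in> S" for Q
  proof -
    have QL: "Q \<in> ?L" using Q S by blast
    have "poly (?f Q) (node k) = 0" if k: "k \<in> nodes N" for k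
    proof -
      have "transform Q (node k) = 0"
        using k QL by (auto simp: local_space_iff nodes_def node_def)
      then show ?thesis
        by (subst poly_numerator_poly[OF node_b[OF k] M coeff_L[OF QL]]) auto
    qed
    then have "(\<Prod>x\<in>node ` nodes N. [:- x, 1:]) dvd ?f Q"
      by (intro prod_linear_dvd) auto
    then have "R dvd ?f Q"
      unfolding R_def by (simp add: prod.reindex[OF inj_on_node])
    then obtain T where T: "?f Q = R * T" by (elim dvdE)
    have "T = (\<Sum>e<c. smult (coeff T e) (monom 1 e))"
    proof (cases "T = 0")
      case False
      have R: "R \<noteq> 0" by (simp add: R_def)
      have "int (degree R) = idx_size p N"
        unfolding R_def using card_nodes[where lam = N, OF N] by (simp add: degree_prod_linear)
      moreover have "degree R + degree T \<le> nat (idx_size q M) - 1"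
        using degree_numerator_poly[where M = M and Q = Q, OF nonneg M] R False by (simp add: T degree_mult_eq)
      ultimately have "degree T < c" using size c by linarith
      then have "coeff T d = 0" if "c \<le> d" for d using that by (intro coeff_eq_0) simp
      then show ?thesis
        by (intro poly_eqI) (auto simp: coeff_sum not_less if_distrib[of "(*) _"] cong: if_cong)
    qed simp
    then have "?f Q = (\<Sum>e<c. smult (coeff T e) (R * monom 1 e))"
      unfolding T by (metis (no_types, lifting) sum_distrib_left mult_smult_right sum.cong)
    also have "\<dots> \<in> cpoly.span ((\<lambda>e. R * monom 1 e) ` {..<c})"
      by (intro cpoly.span_sum cpoly.span_scale cpoly.span_base) auto
    finally show ?thesis .
  qed
  then have "card (?f ` S) \<le> card ((\<lambda>e. R * monom 1 e) ` {..<c})"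
    using cpoly.independent_span_bound[OF _ indep, of "(\<lambda>e. R * monom 1 e) ` {..<c}"] by auto
  also have "\<dots> \<le> c" using card_image_le[of "{..<c}" "\<lambda>e. R * monom 1 e"] by simp
  also have "card (?f ` S) = card S"
    using inj row.span_superset by (intro card_image) (rule inj_on_subset)
  finally show ?thesis .
qed

text \<open>Raising the exponent by one splits off the first factor of each Pochhammer symbol and
  shifts its base. A zero of \<open>transform Q\<close> at node \<open>l + 1\<close> thus becomes
  one at node \<open>l\<close> for \<open>z * Q\<close>.\<close>

lemma transform_monom_1_mult:
  "transform (\<lambda>j. monom 1 1 * Q j) t =
    (\<Prod>\<rho>=1..r. t + a \<rho> + 1) / (\<Prod>h=1..q. t + b h + 1) * transform Q (t + 1)"
proof -
  have "\<phi> j (1 + d) t = (\<Prod>\<rho>=1..r. t + a \<rho> + 1) / (\<Prod>h=1..q. t + b h + 1) * \<phi> j d (t + 1)" for j d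
  proof -
    have "t + c + 1 + 1 = t + 1 + c + 1" "t + c + 1 + of_nat (Suc d) = t + 1 + c + 1 + of_nat d" for c
      by simp_all
    then show ?thesis
      by (simp only: \<phi>_def plus_1_eq_Suc pochhammer_rec prod.distrib times_divide_times_eq mult.assoc)
  qed
  then show ?thesis
    unfolding transform_def coeff_functional_monom_mult
    by (simp only: coeff_functional_cmult sum_distrib_left)
qed

end

section \<open>The recurrence\<close>

context hypergeometric_system
begin

text \<open>The conditions \<open>up\<close> and \<open>down\<close> match the two vanishing
  criteria: for \<open>k < l\<close> the transform of \<open>W l\<close> vanishes at all nodes of
  test \<open>k\<close>, and for \<open>l < k\<close> the degrees of \<open>W l\<close> lie below
  \<open>\<eta> k\<close>. \<open>lower0\<close> and \<open>upper0\<close> reserve the one node and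
  the one degree that \<open>z * W 0\<close> consumes.\<close>

lemma B_vec_recurrence_basis:
  fixes cn cm lam \<eta> :: "int \<Rightarrow> nat \<Rightarrow> int" and N M :: "nat \<Rightarrow> int"
  defines "J \<equiv> {- int p..int q}" and "W \<equiv> \<lambda>k. B_vec p q r a b \<kappa> (cn k) (cm k)"
    and "L \<equiv> local_space p q r a b \<kappa> N M"
  assumes ad: "\<And>k. k \<in> J \<Longrightarrow> admissible_pair p q r a b \<kappa> (cn k) (cm k)"
    and size: "\<And>k. k \<in> J \<Longrightarrow> idx_size q (cm k) = idx_size p (cn k) + 1"
    and test_ad: "\<And>k. k \<in> J \<Longrightarrow> admissible_pair p q r a b \<kappa> (lam k) (\<eta> k)"
    and test_size: "\<And>k. k \<in> J \<Longrightarrow> idx_size p (lam k) = idx_size q (\<eta> k) + 1"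
    and up: "\<And>k l i. k \<in> J \<Longrightarrow> l \<in> J \<Longrightarrow> k < l \<Longrightarrow> i \<in> {1..p} \<Longrightarrow> lam k i \<le> cn l i"
    and down: "\<And>k l h. k \<in> J \<Longrightarrow> l \<in> J \<Longrightarrow> l < k \<Longrightarrow> h \<in> {1..q} \<Longrightarrow> cm l h \<le> \<eta> k h"
    and lower: "\<And>k i. k \<in> J \<Longrightarrow> i \<in> {1..p} \<Longrightarrow> N i \<le> cn k i"
    and upper: "\<And>k h. k \<in> J \<Longrightarrow> h \<in> {1..q} \<Longrightarrow> cm k h \<le> M h"
    and lower0: "\<And>i. i \<in> {1..p} \<Longrightarrow> N i + 1 \<le> cn 0 i"
    and upper0: "\<And>h. h \<in> {1..q} \<Longrightarrow> cm 0 h + 1 \<le> M h"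
    and N: "\<And>i. i \<in> {1..p} \<Longrightarrow> 0 \<le> N i" and M_nonneg: "\<And>h. h \<in> {1..q} \<Longrightarrow> 0 \<le> M h"
    and M: "\<And>g h. g \<in> {1..q} \<Longrightarrow> h \<in> {1..q} \<Longrightarrow> M g \<le> M h + 1"
    and a: "\<And>\<rho> h k. \<rho> \<in> {1..r} \<Longrightarrow> h \<in> {1..q} \<Longrightarrow> int k < M h \<Longrightarrow> a \<rho> \<noteq> b h + of_nat k"
    and space_size: "idx_size q M = idx_size p N + int (p + q + 1)"
    and nz: "\<And>k. k \<in> J \<Longrightarrow> pairing p q r a b \<kappa> 0 (cn k) (cm k) (lam k) (\<eta> k) \<noteq> 0"
  shows "inj_on W J" "row.independent (W ` J)" "row.span (W ` J) = L"
    and "(\<lambda>h. [:0, 1:] * W 0 h) \<in> L"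
    and "(\<lambda>h. [:0, 1:] * W 0 h) = (\<Sum>k\<in>J. row_scale (pairing p q r a b \<kappa> 1 (cn 0) (cm 0) (lam k) (\<eta> k) /
           pairing p q r a b \<kappa> 0 (cn k) (cm k) (lam k) (\<eta> k)) (W k))"
proof -
  define \<tau> where "\<tau> k = test_functional (lam k) (\<eta> k)" for k
  have J: "finite J" "card J = p + q + 1" "0 \<in> J" by (auto simp: J_def)
  have pairing0: "pairing p q r a b \<kappa> 0 (cn l) (cm l) (lam k) (\<eta> k) = test_scale (lam k) (\<eta> k) * \<tau> k (W l)"
    and pairing1: "pairing p q r a b \<kappa> 1 (cn l) (cm l) (lam k) (\<eta> k) =
      test_scale (lam k) (\<eta> k) * \<tau> k (\<lambda>h. [:0, 1:] * W l h)" if "k \<in> J" "l \<in> J" for k l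
    using pairing_eq_test_functional[where lam = "lam k" and \<eta> = "\<eta> k" and d = 0, OF ad size admissible_pairD(1,2)[OF test_ad]]
      pairing_eq_test_functional[where lam = "lam k" and \<eta> = "\<eta> k" and d = 1, OF ad size admissible_pairD(1,2)[OF test_ad]] that
    by (simp_all add: \<tau>_def W_def monom_Suc)
  have coeff_W: "coeff (W k j) d = 0" if "k \<in> J" "j \<in> {1..q}" "cm k j \<le> int d" for k j d
    using coeff_B_poly_eq_0[OF ad[OF that(1)] that(2), of d] that(2,3) by (simp add: W_def B_vec_def)
  have transform_W: "transform (W k) (\<kappa> i + of_nat l) = 0" if "k \<in> J" "i \<in> {1..p}" "int l < cn k i" for k i l
    unfolding W_def using that by (intro transform_B_vec_node_eq_0 ad size)
  have W_outside: "W k j = 0" if "j \<notin> {1..q}" for k j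
    using that by (simp add: W_def B_vec_def del: atLeastAtMost_iff)
  have W_L: "W k \<in> L" if k: "k \<in> J" for k
    unfolding L_def local_space_iff polys_le_iff
  proof (intro conjI ballI allI impI W_outside)
    fix j d assume "j \<in> {1..q}" "M j \<le> int d"
    then show "coeff (W k j) d = 0" using upper[OF k, of j] by (intro coeff_W k) auto
  next
    fix i l assume "i \<in> {1..p}" "int l < N i"
    then show "transform (W k) (\<kappa> i + of_nat l) = 0" using lower[OF k, of i] by (intro transform_W k) auto
  qed
  show shift: "(\<lambda>h. [:0, 1:] * W 0 h) \<in> L"
    unfolding L_def local_space_iff polys_le_iff
  proof (intro conjI ballI allI impI)
    fix j assume "j \<notin> {1..q}"
    then show "[:0, 1:] * W 0 j = 0" by (simp add: W_outside del: atLeastAtMost_iff)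
  next
    fix j d assume "j \<in> {1..q}" "M j \<le> int d"
    then show "coeff ([:0, 1:] * W 0 j) d = 0"
      using upper0[of j] coeff_W[OF J(3), of j "d - 1"] by (cases d) auto
  next
    fix i l assume i: "i \<in> {1..p}" and l: "int l < N i"
    have "transform (W 0) (\<kappa> i + of_nat (Suc l)) = 0"
      using lower0[OF i] l by (intro transform_W J i) simp
    moreover have "(\<lambda>h. [:0, 1:] * W 0 h) = (\<lambda>h. monom 1 1 * W 0 h)"
      by (simp add: monom_Suc)
    ultimately show "transform (\<lambda>h. [:0, 1:] * W 0 h) (\<kappa> i + of_nat l) = 0"
      by (simp add: transform_monom_1_mult[unfolded One_nat_def] add_ac)
  qed
  have diag: "\<tau> k (W k) \<noteq> 0" if "k \<in> J" for k
    using nz[OF that] pairing0[OF that that] by auto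
  have offdiag: "\<tau> k (W l) = 0" if k: "k \<in> J" and l: "l \<in> J" and "k \<noteq> l" for k l
  proof (cases "k < l")
    case True
    show ?thesis
      unfolding \<tau>_def
    proof (rule test_functional_eq_0_of_transform)
      fix i s assume "i \<in> {1..p}" "int s < lam k i"
      then show "transform (W l) (\<kappa> i + of_nat s) = 0"
        using up[OF k l True, of i] by (intro transform_W l) auto
    qed
  next
    case False
    with \<open>k \<noteq> l\<close> have "l < k" by simp
    show ?thesis
      unfolding \<tau>_def
    proof (rule test_functional_eq_0_of_coeff)
      fix j d assume "j \<in> {1..q}" "\<eta> k j \<le> int d"
      then show "coeff (W l j) d = 0" using down[OF k l \<open>l < k\<close>, of j] by (intro coeff_W l) auto
    qed (use admissible_pairD(1-3)[OF test_ad[OF k]] test_size[OF k] in auto)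
  qed
  have bound: "card S \<le> card J" if "finite S" "S \<subseteq> L" "row.independent S" for S
    unfolding J(2) by (rule card_independent_local_space_le[where N = N and M = M, OF N M_nonneg M a])
      (use that space_size in \<open>auto simp: L_def\<close>)
  note basis = biorthogonal_basis[where J = J and L = L and W = W and \<tau> = \<tau>, OF J(1) _ W_L _ _ diag offdiag bound]
  have lin: "row.subspace L" "\<tau> k (x + y) = \<tau> k x + \<tau> k y" "\<tau> k (row_scale c x) = c * \<tau> k x" for k c x y
    by (simp_all only: L_def subspace_local_space \<tau>_def test_functional_add test_functional_row_scale)
  show "inj_on W J" "row.independent (W ` J)" "row.span (W ` J) = L"
    using basis(1-3) lin by blast+
  have "(\<lambda>h. [:0, 1:] * W 0 h) = (\<Sum>k\<in>J. row_scale (\<tau> k (\<lambda>h. [:0, 1:] * W 0 h) / \<tau> k (W k)) (W k))"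
    by (rule basis(4)) (use lin shift in auto)
  also have "\<dots> = (\<Sum>k\<in>J. row_scale (pairing p q r a b \<kappa> 1 (cn 0) (cm 0) (lam k) (\<eta> k) /
           pairing p q r a b \<kappa> 0 (cn k) (cm k) (lam k) (\<eta> k)) (W k))"
  proof (rule sum.cong[OF refl])
    fix k assume k: "k \<in> J"
    \<comment> \<open>The scale of the test vector occurs in numerator and denominator; it is
      nonzero because the denominator block is.\<close>
    have "test_scale (lam k) (\<eta> k) \<noteq> 0" using nz[OF k] pairing0[OF k k] by auto
    then show "row_scale (\<tau> k (\<lambda>h. [:0, 1:] * W 0 h) / \<tau> k (W k)) (W k) =
        row_scale (pairing p q r a b \<kappa> 1 (cn 0) (cm 0) (lam k) (\<eta> k) /
           pairing p q r a b \<kappa> 0 (cn k) (cm k) (lam k) (\<eta> k)) (W k)"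
      by (simp only: pairing0[OF k k] pairing1[OF k J(3)] mult_divide_mult_cancel_left not_False_eq_True)
  qed
  finally show "(\<lambda>h. [:0, 1:] * W 0 h) = (\<Sum>k\<in>J. row_scale (pairing p q r a b \<kappa> 1 (cn 0) (cm 0) (lam k) (\<eta> k) /
           pairing p q r a b \<kappa> 0 (cn k) (cm k) (lam k) (\<eta> k)) (W k))" .
qed

end

section \<open>Index paths and the assembly of the recurrence\<close>

lemma unit_step_seq_mono:
  assumes "unit_step_seq s w" "h \<in> {1..s}" "k \<le> l"
  shows "w k h \<le> w l h"
proof (rule lift_Suc_mono_le[of "\<lambda>k. w k h", OF _ assms(3)])
  fix k
  obtain l where "w (Suc k) h = w k h + of_bool (h = l)"
    using assms(1,2) unfolding unit_step_seq_def by blast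
  then show "w k h \<le> w (Suc k) h" by simp
qed

lemma idx_size_unit_step_seq:
  assumes "unit_step_seq s w"
  shows "idx_size s (w k) = int k"
proof (induction k)
  case 0
  then show ?case using assms by (simp add: idx_size_def unit_step_seq_def)
next
  case (Suc k)
  obtain l where l: "l \<in> {1..s}" "\<And>h. h \<in> {1..s} \<Longrightarrow> w (Suc k) h = w k h + of_bool (h = l)"
    using assms unfolding unit_step_seq_def by blast
  then have "idx_size s (w (Suc k)) = (\<Sum>h=1..s. w k h + of_bool (h = l))"
    unfolding idx_size_def by (intro sum.cong) auto
  then show ?case using Suc l(1) by (simp add: idx_size_def sum.distrib)
qed

lemma idx_size_add: "idx_size s (x \<oplus>\<^sub>v y) = idx_size s x + idx_size s y"
  by (simp add: idx_size_def idx_add_def sum.distrib)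

lemma idx_size_diff: "idx_size s (x \<ominus>\<^sub>v y) = idx_size s x - idx_size s y"
  by (simp add: idx_size_def idx_diff_def sum_subtractf)

lemma idx_size_const: "idx_size s (\<lambda>_. c) = int s * c"
  by (simp add: idx_size_def)

text \<open>
  The recurrence vectors in the order \<open>W\<^sub>p\<^sup>-, \<dots>, W\<^sub>1\<^sup>-, W\<^sup>0, W\<^sub>1\<^sup>+, \<dots>, W\<^sub>q\<^sup>+\<close> are numbered by
  \<open>- p, \<dots>, q\<close>. Then \<open>two_sided n g f\<close> is monotone, the vector numbered \<open>k\<close> has the index pair
  with number \<open>k\<close>, and its test vector has the column index numbered \<open>k + 1\<close> and the row index
  numbered \<open>k - 1\<close>.
\<close>
definition two_sided :: "(nat \<Rightarrow> int) \<Rightarrow> (nat \<Rightarrow> nat \<Rightarrow> int) \<Rightarrow> (nat \<Rightarrow> nat \<Rightarrow> int) \<Rightarrow> int \<Rightarrow> nat \<Rightarrow> int" where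
  "two_sided x g f k = (if 0 < k then x \<oplus>\<^sub>v f (nat k) else if k = 0 then x else x \<ominus>\<^sub>v g (nat (- k)))"

definition two_sided_next :: "(nat \<Rightarrow> int) \<Rightarrow> (nat \<Rightarrow> nat \<Rightarrow> int) \<Rightarrow> (nat \<Rightarrow> nat \<Rightarrow> int) \<Rightarrow> int \<Rightarrow> nat \<Rightarrow> int" where
  "two_sided_next x g f k = (if 0 \<le> k then x \<oplus>\<^sub>v f (nat k + 1) else x \<ominus>\<^sub>v g (nat (- k) - 1))"

definition two_sided_prev :: "(nat \<Rightarrow> int) \<Rightarrow> (nat \<Rightarrow> nat \<Rightarrow> int) \<Rightarrow> (nat \<Rightarrow> nat \<Rightarrow> int) \<Rightarrow> int \<Rightarrow> nat \<Rightarrow> int" where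
  "two_sided_prev x g f k = (if 0 < k then x \<oplus>\<^sub>v f (nat k - 1) else x \<ominus>\<^sub>v g (nat (- k) + 1))"

text \<open>Next to the centre the neighbours involve \<open>f 0\<close> or \<open>g 0\<close>,
  which are known to vanish only on \<open>{1..s}\<close>. Hence the equality is pointwise, while
  the separate definitions reproduce the index expressions of the test vectors verbatim.\<close>

lemma two_sided_shift:
  assumes "unit_step_seq s f" "unit_step_seq s g" "h \<in> {1..s}"
  shows "two_sided_next x g f k h = two_sided x g f (k + 1) h"
    and "two_sided_prev x g f k h = two_sided x g f (k - 1) h"
proof -
  have 0: "f 0 h = 0" "g 0 h = 0" using assms by (auto simp: unit_step_seq_def)
  have "nat k + 1 = nat (k + 1)" if "0 \<le> k" using that by simp
  moreover have "nat (- k) - 1 = nat (- (k + 1))" if "\<not> 0 \<le> k" using that by simp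
  moreover have "nat k - 1 = nat (k - 1)" if "0 < k" using that by simp
  moreover have "nat (- k) + 1 = nat (- (k - 1))" if "\<not> 0 < k" using that by simp
  ultimately show "two_sided_next x g f k h = two_sided x g f (k + 1) h"
    "two_sided_prev x g f k h = two_sided x g f (k - 1) h"
    using 0 by (auto simp: two_sided_def two_sided_next_def two_sided_prev_def idx_add_def idx_diff_def
        simp del: nat_add_distrib)
qed

lemma two_sided_mono:
  assumes f: "unit_step_seq s f" and g: "unit_step_seq s g" and h: "h \<in> {1..s}" and "k \<le> l"
  shows "two_sided x g f k h \<le> two_sided x g f l h"
proof -
  have nonneg: "0 \<le> f i h" "0 \<le> g i h" for i
    using unit_step_seq_mono[OF f h, of 0 i] unit_step_seq_mono[OF g h, of 0 i] f g h
    by (auto simp: unit_step_seq_def)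
  have "f (nat k) h \<le> f (nat l) h" "g (nat (- l)) h \<le> g (nat (- k)) h"
    using \<open>k \<le> l\<close> by (auto intro!: unit_step_seq_mono[OF f h] unit_step_seq_mono[OF g h])
  then show ?thesis
    using nonneg[of "nat k"] nonneg[of "nat l"] nonneg[of "nat (- k)"] \<open>k \<le> l\<close>
    by (auto simp: two_sided_def idx_add_def idx_diff_def add_increasing)
qed

lemma idx_size_two_sided:
  assumes "unit_step_seq s f" "unit_step_seq s g"
  shows "idx_size s (two_sided x g f k) = idx_size s x + k"
    and "idx_size s (two_sided_next x g f k) = idx_size s x + k + 1"
    and "idx_size s (two_sided_prev x g f k) = idx_size s x + k - 1"
proof -
  show *: "idx_size s (two_sided x g f k) = idx_size s x + k" for k
    using assms by (simp add: two_sided_def idx_size_add idx_size_diff idx_size_unit_step_seq)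
  have "idx_size s (two_sided_next x g f k) = idx_size s (two_sided x g f (k + 1))"
    "idx_size s (two_sided_prev x g f k) = idx_size s (two_sided x g f (k - 1))"
    unfolding idx_size_def by (intro sum.cong refl two_sided_shift[OF assms]; assumption)+
  then show "idx_size s (two_sided_next x g f k) = idx_size s x + k + 1"
    "idx_size s (two_sided_prev x g f k) = idx_size s x + k - 1"
    by (simp_all add: *)
qed

lemma atLeastAtMost_int_split:
  "{- int p..int q} = int ` {1..q} \<union> {0} \<union> (\<lambda>i. - int i) ` {1..p}"
proof (intro equalityI subsetI)
  fix k assume k: "k \<in> {- int p..int q}"
  have "k = int (nat k)" "nat k \<in> {1..q}" if "0 < k" using k that by auto
  moreover have "k = - int (nat (- k))" "nat (- k) \<in> {1..p}" if "k < 0" using k that by auto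
  ultimately show "k \<in> int ` {1..q} \<union> {0} \<union> (\<lambda>i. - int i) ` {1..p}"
    by (cases k "0 :: int" rule: linorder_cases) blast+
qed auto

lemma sum_int_split:
  "(\<Sum>k=- int p..int q. f k) = (\<Sum>j=1..q. f (int j)) + f 0 + (\<Sum>i=1..p. f (- int i))"
proof -
  have "(\<Sum>k=- int p..int q. f k) = sum f (int ` {1..q}) + sum f {0} + sum f ((\<lambda>i. - int i) ` {1..p})"
    unfolding atLeastAtMost_int_split by (subst sum.union_disjoint; (subst sum.union_disjoint)?) auto
  then show ?thesis
    by (simp add: sum.reindex inj_on_def)
qed

theorem theorem7p14:
  fixes p q r :: nat
    and a b \<kappa> :: "nat \<Rightarrow> complex"
    and n m :: "nat \<Rightarrow> int"
    and u fu v fv :: "nat \<Rightarrow> nat \<Rightarrow> int"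
    and Wplus Wminus :: "nat \<Rightarrow> nat \<Rightarrow> complex poly"
    and Wzero :: "nat \<Rightarrow> complex poly"
    and Pp1 Pp0 Pm1 Pm0 :: "nat \<Rightarrow> complex"
    and Pz1 Pz0 :: complex
  assumes "1 \<le> p" "1 \<le> q" "r < q"
    and regular: "regular_params p q b \<kappa>"
    and "nonneg_idx p n" "nonneg_idx q m"
    and "idx_size q m = idx_size p n + 1"
    and "is_near_diag q m"
    and "nonneg_idx p (n \<ominus>\<^sub>v (\<lambda>_. 1))"
    and data: "admissible_B_data p q r a b \<kappa> n m u fu v fv"
    and Wplus: "\<And>j. Wplus j = B_vec p q r a b \<kappa> (n \<oplus>\<^sub>v fu j) (m \<oplus>\<^sub>v v j)"
    and Wzero: "Wzero = B_vec p q r a b \<kappa> n m"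
    and Wminus: "\<And>i. Wminus i = B_vec p q r a b \<kappa> (n \<ominus>\<^sub>v u i) (m \<ominus>\<^sub>v fv i)"
    and Pp1: "\<And>j. Pp1 j = pairing p q r a b \<kappa> 1 n m (n \<oplus>\<^sub>v fu (j + 1)) (m \<oplus>\<^sub>v v (j - 1))"
    and Pp0: "\<And>j. Pp0 j = pairing p q r a b \<kappa> 0 (n \<oplus>\<^sub>v fu j) (m \<oplus>\<^sub>v v j)
                              (n \<oplus>\<^sub>v fu (j + 1)) (m \<oplus>\<^sub>v v (j - 1))"
    and Pz1: "Pz1 = pairing p q r a b \<kappa> 1 n m (n \<oplus>\<^sub>v fu 1) (m \<ominus>\<^sub>v fv 1)"
    and Pz0: "Pz0 = pairing p q r a b \<kappa> 0 n m (n \<oplus>\<^sub>v fu 1) (m \<ominus>\<^sub>v fv 1)"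
    and Pm1: "\<And>i. Pm1 i = pairing p q r a b \<kappa> 1 n m (n \<ominus>\<^sub>v u (i - 1)) (m \<ominus>\<^sub>v fv (i + 1))"
    and Pm0: "\<And>i. Pm0 i = pairing p q r a b \<kappa> 0 (n \<ominus>\<^sub>v u i) (m \<ominus>\<^sub>v fv i)
                              (n \<ominus>\<^sub>v u (i - 1)) (m \<ominus>\<^sub>v fv (i + 1))"
    and "\<And>j. j \<in> {1..q} \<Longrightarrow> Pp0 j \<noteq> 0"
    and "Pz0 \<noteq> 0"
    and "\<And>i. i \<in> {1..p} \<Longrightarrow> Pm0 i \<noteq> 0"
  shows "(\<forall>z. \<forall>h\<in>{1..q}.
            z * poly (Wzero h) z =
              (\<Sum>j=1..q. Pp1 j / Pp0 j * poly (Wplus j h) z) +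
              Pz1 / Pz0 * poly (Wzero h) z +
              (\<Sum>i=1..p. Pm1 i / Pm0 i * poly (Wminus i h) z)) \<and>
         (let S = Wplus ` {1..q} \<union> {Wzero} \<union> Wminus ` {1..p} in
            card S = p + q + 1 \<and>
            row.independent S \<and>
            row.span S = local_space p q r a b \<kappa> (n \<ominus>\<^sub>v (\<lambda>_. 1)) (m \<oplus>\<^sub>v (\<lambda>_. 1))) \<and>
         (\<lambda>h. [:0, 1:] * Wzero h) \<in> local_space p q r a b \<kappa> (n \<ominus>\<^sub>v (\<lambda>_. 1)) (m \<oplus>\<^sub>v (\<lambda>_. 1))"
proof -
  note D = data[unfolded admissible_B_data_def B_local_data_def]
  have u: "unit_step_seq p u" and fu: "unit_step_seq p fu" and v: "unit_step_seq q v" and fv: "unit_step_seq q fv"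
    and u_le: "\<And>i h. i \<le> p \<Longrightarrow> h \<in> {1..p} \<Longrightarrow> u i h \<le> 1" and v_le: "\<And>j h. j \<le> q \<Longrightarrow> h \<in> {1..q} \<Longrightarrow> v j h \<le> 1"
    using D by blast+
  have ad: "admissible_pair p q r a b \<kappa> n m" using D by blast
  interpret hypergeometric_system p q r a b \<kappa>
    using ad \<open>r < q\<close> regular
    by unfold_locales (auto simp: admissible_pair_def admissible_params_def)
  define cn cm where "cn = two_sided n u fu" and "cm = two_sided m fv v"
  define lam \<eta> where "lam = two_sided_next n u fu" and "\<eta> = two_sided_prev m fv v"
  define N M where "N = n \<ominus>\<^sub>v (\<lambda>_. 1)" and "M = m \<oplus>\<^sub>v (\<lambda>_. 1)"
  define W where "W = (\<lambda>k. B_vec p q r a b \<kappa> (cn k) (cm k))"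
  \<comment> \<open>The entries of \<open>v q\<close> are at most 1 and add up to \<open>q\<close>.
    So \<open>M\<close> agrees with the row index of the last vector \<open>Wplus q\<close>, whose
    admissibility then applies to \<open>M\<close>.\<close>
  have v_q: "v q h = 1" if h: "h \<in> {1..q}" for h
  proof -
    have "(\<Sum>h=1..q. 1 - v q h) = 0"
      using idx_size_unit_step_seq[OF v, of q] by (simp add: idx_size_def sum_subtractf)
    then have "1 - v q h = 0"
      using v_le h by (subst (asm) sum_nonneg_eq_0_iff) auto
    then show ?thesis by simp
  qed
  have M_eq: "M h = (m \<oplus>\<^sub>v v q) h" if "h \<in> {1..q}" for h
    using v_q[OF that] by (simp add: M_def idx_add_def)
  have ad_q: "admissible_pair p q r a b \<kappa> (n \<oplus>\<^sub>v fu q) (m \<oplus>\<^sub>v v q)"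
    using D \<open>1 \<le> q\<close> by auto
  have adW: "admissible_pair p q r a b \<kappa> (cn k) (cm k)" if "k \<in> {- int p..int q}" for k
  proof (cases "0 < k")
    case True
    with that have "nat k \<in> {1..q}" by auto
    with D True show ?thesis unfolding cn_def cm_def two_sided_def by auto
  next
    case False
    show ?thesis
    proof (cases "k = 0")
      case True
      then show ?thesis using ad by (simp add: cn_def cm_def two_sided_def)
    next
      case nz: False
      with that False have "nat (- k) \<in> {1..p}" by auto
      with D nz False show ?thesis unfolding cn_def cm_def two_sided_def by auto
    qed
  qed
  have adU: "admissible_pair p q r a b \<kappa> (lam k) (\<eta> k)" if "k \<in> {- int p..int q}" for k
  proof (cases "0 < k")
    case True
    with that have "nat k \<in> {1..q}" by auto
    with D True show ?thesis unfolding lam_def \<eta>_def two_sided_next_def two_sided_prev_def by auto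
  next
    case False
    show ?thesis
    proof (cases "k = 0")
      case True
      then show ?thesis using D by (simp add: lam_def \<eta>_def two_sided_next_def two_sided_prev_def)
    next
      case nz: False
      with that False have "nat (- k) \<in> {1..p}" by auto
      with D nz False show ?thesis unfolding lam_def \<eta>_def two_sided_next_def two_sided_prev_def by auto
    qed
  qed
  \<comment> \<open>On the lower branch a column drops by at most 1 because
    \<open>u i h \<le> 1\<close>; on the upper branch it can only grow. The bound for rows is the
    mirror image with \<open>v\<close> and \<open>fv\<close>.\<close>
  have u_bound: "- 1 \<le> cn k h - n h" if "k \<in> {- int p..int q}" "h \<in> {1..p}" for k h
    using u_le[of "nat (- k)" h] unit_step_seq_mono[OF fu that(2), of 0 "nat k"] fu that
    by (auto simp: cn_def two_sided_def idx_add_def idx_diff_def unit_step_seq_def)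
  have v_bound: "cm k h - m h \<le> 1" if "k \<in> {- int p..int q}" "h \<in> {1..q}" for k h
    using v_le[of "nat k" h] unit_step_seq_mono[OF fv that(2), of 0 "nat (- k)"] fv that
    by (auto simp: cm_def two_sided_def idx_add_def idx_diff_def unit_step_seq_def)
  have Wplus_eq: "Wplus j = W (int j)" if "j \<in> {1..q}" for j
    using that by (simp add: Wplus W_def cn_def cm_def two_sided_def)
  have Wzero_eq: "Wzero = W 0"
    by (simp add: Wzero W_def cn_def cm_def two_sided_def)
  have Wminus_eq: "Wminus i = W (- int i)" if "i \<in> {1..p}" for i
    using that by (simp add: Wminus W_def cn_def cm_def two_sided_def)
  define P1 where "P1 k = pairing p q r a b \<kappa> 1 (cn 0) (cm 0) (lam k) (\<eta> k)" for k
  define P0 where "P0 k = pairing p q r a b \<kappa> 0 (cn k) (cm k) (lam k) (\<eta> k)" for k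
  note two_sided_defs = cn_def cm_def lam_def \<eta>_def two_sided_def two_sided_next_def two_sided_prev_def
  have Pp: "Pp1 j = P1 (int j)" "Pp0 j = P0 (int j)" if "j \<in> {1..q}" for j
    using that by (simp_all add: Pp1 Pp0 P1_def P0_def two_sided_defs)
  have Pz: "Pz1 = P1 0" "Pz0 = P0 0"
    by (simp_all add: Pz1 Pz0 P1_def P0_def two_sided_defs)
  have Pm: "Pm1 i = P1 (- int i)" "Pm0 i = P0 (- int i)" if "i \<in> {1..p}" for i
    using that by (simp_all add: Pm1 Pm0 P1_def P0_def two_sided_defs)
  have nz: "P0 k \<noteq> 0" if "k \<in> {- int p..int q}" for k
    using that assms(20-22) Pp Pz Pm unfolding atLeastAtMost_int_split by fastforce
  note basis = B_vec_recurrence_basis[where cn = cn and cm = cm and lam = lam and \<eta> = \<eta> and N = N and M = M,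
      folded P0_def P1_def]
  have hyps:
    "idx_size q (cm k) = idx_size p (cn k) + 1" "idx_size p (lam k) = idx_size q (\<eta> k) + 1" for k
    using assms(7) by (simp_all add: cn_def cm_def lam_def \<eta>_def idx_size_two_sided u fu v fv)
  have up: "lam k i \<le> cn l i" if "k < l" "i \<in> {1..p}" for k l i
    unfolding lam_def cn_def two_sided_shift(1)[OF fu u that(2)] using that by (intro two_sided_mono[OF fu u]) auto
  have down: "cm l h \<le> \<eta> k h" if "l < k" "h \<in> {1..q}" for k l h
    unfolding \<eta>_def cm_def two_sided_shift(2)[OF v fv that(2)] using that by (intro two_sided_mono[OF v fv]) auto
  have lower: "N i \<le> cn k i" if "k \<in> {- int p..int q}" "i \<in> {1..p}" for k i
    using u_bound[OF that] by (simp add: N_def idx_diff_def)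
  have upper: "cm k h \<le> M h" if "k \<in> {- int p..int q}" "h \<in> {1..q}" for k h
    using v_bound[OF that] by (simp add: M_def idx_add_def)
  have N: "0 \<le> N i" if "i \<in> {1..p}" for i
    using \<open>nonneg_idx p (n \<ominus>\<^sub>v (\<lambda>_. 1))\<close> that by (simp add: N_def nonneg_idx_def)
  have M_nonneg: "0 \<le> M h" if "h \<in> {1..q}" for h
    using admissible_pairD(2)[OF ad that] by (simp add: M_def idx_add_def)
  have M: "M g \<le> M h + 1" if "g \<in> {1..q}" "h \<in> {1..q}" for g h
    using admissible_pairD(3)[OF ad that] by (simp add: M_def idx_add_def)
  \<comment> \<open>The admissibility of \<open>m\<close> alone would exclude only
    \<open>k < m h\<close>; the index \<open>m \<oplus>\<^sub>v v q\<close> also covers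
    \<open>k = m h\<close>.\<close>
  have a_neq: "a \<rho> \<noteq> b h + of_nat k" if "\<rho> \<in> {1..r}" "h \<in> {1..q}" "int k < M h" for \<rho> h k
    using admissible_pairD(4)[OF ad_q that(1,2), of k] that(2,3) by (simp add: M_eq)
  have space_size: "idx_size q M = idx_size p N + int (p + q + 1)"
    using assms(7) by (simp add: N_def M_def idx_size_add idx_size_diff idx_size_const)
  have lower0: "N i + 1 \<le> cn 0 i" and upper0: "cm 0 h + 1 \<le> M h" for i h
    by (simp_all add: N_def M_def cn_def cm_def two_sided_def idx_add_def idx_diff_def)
  note facts = basis[OF adW hyps(1) adU hyps(2) up down lower upper lower0 upper0 N M_nonneg M a_neq space_size nz]
  have inj: "inj_on W {- int p..int q}"
    unfolding W_def by (rule facts(1); assumption)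
  have indep: "row.independent (W ` {- int p..int q})"
    unfolding W_def by (rule facts(2); assumption)
  have span: "row.span (W ` {- int p..int q}) = local_space p q r a b \<kappa> N M"
    unfolding W_def by (rule facts(3); assumption)
  have shift: "(\<lambda>h. [:0, 1:] * W 0 h) \<in> local_space p q r a b \<kappa> N M"
    unfolding W_def by (rule facts(4); assumption)
  have expansion: "(\<lambda>h. [:0, 1:] * W 0 h) = (\<Sum>k=- int p..int q. row_scale (P1 k / P0 k) (W k))"
    unfolding W_def by (rule facts(5); assumption)
  have image: "Wplus ` {1..q} \<union> {Wzero} \<union> Wminus ` {1..p} = W ` {- int p..int q}"
    unfolding atLeastAtMost_int_split image_Un image_image using Wplus_eq Wminus_eq Wzero_eq by simp
  have "z * poly (Wzero h) z =
      (\<Sum>j=1..q. Pp1 j / Pp0 j * poly (Wplus j h) z) + Pz1 / Pz0 * poly (Wzero h) z +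
      (\<Sum>i=1..p. Pm1 i / Pm0 i * poly (Wminus i h) z)" for z h
  proof -
    have sum_apply: "(\<Sum>k\<in>K. F k) h = (\<Sum>k\<in>K. F k h)" for K :: "int set" and F :: "int \<Rightarrow> nat \<Rightarrow> complex poly"
      by (induction K rule: infinite_finite_induct) auto
    have "z * poly (Wzero h) z = poly ([:0, 1:] * W 0 h) z"
      by (simp add: Wzero_eq)
    also have "[:0, 1:] * W 0 h = (\<Sum>k=- int p..int q. row_scale (P1 k / P0 k) (W k) h)"
      using fun_cong[OF expansion, of h] by (simp add: sum_apply)
    also have "poly \<dots> z = (\<Sum>k=- int p..int q. P1 k / P0 k * poly (W k h) z)"
      by (simp add: poly_sum row_scale_def)
    also have "\<dots> = (\<Sum>j=1..q. Pp1 j / Pp0 j * poly (Wplus j h) z) + Pz1 / Pz0 * poly (Wzero h) z +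
      (\<Sum>i=1..p. Pm1 i / Pm0 i * poly (Wminus i h) z)"
      unfolding sum_int_split by (simp add: Pp Pz Pm Wplus_eq Wzero_eq Wminus_eq)
    finally show ?thesis .
  qed
  moreover have "card (W ` {- int p..int q}) = p + q + 1"
    using inj by (simp add: card_image)
  ultimately show ?thesis
    using indep span shift unfolding Let_def image by (simp add: Wzero_eq N_def M_def)
qed

end
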